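(* Let $\alpha\ge0$, $1<p<\infty$, $\frac1p+\frac1{p'}=1$, and $\beta,\mu\in\mathbb{R}$ with $0<\beta-\frac1p<\mu$. For real parameters $b,m$ write $\mathcal{S}_{b,m}f(t)=t^{m-b}\int_0^\infty\frac{s^{b-1}}{(s+t)^m}f(s)\,ds$, $t>0$. Then the adjoint of $\mathcal{S}_{\beta,\mu}$ on $\mathcal{T}_p^{(\alpha)}(t^\alpha)$ is $\mathcal{S}_{\mu-\beta+1,\mu}$ on $\mathcal{T}_{p'}^{(\alpha)}(t^\alpha)$, i.e. $$\langle\mathcal{S}_{\beta,\mu}f,g\rangle_\alpha=\langle f,\mathcal{S}_{\mu-\beta+1,\mu}g\rangle_\alpha,\qquad f\in\mathcal{T}_p^{(\alpha)}(t^\alpha),\ g\in\mathcal{T}_{p'}^{(\alpha)}(t^\alpha).$$ Moreover, $\mathcal{S}_{\beta,\mu}$ is injective, not surjective, and has dense range on $\mathcal{T}_p^{(\alpha)}(t^\alpha)$.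
   Context: Let $\mathcal{S}_+$ be the Schwartz class on $[0,\infty)$. For $f\in\mathcal{S}_+$ and $\alpha>0$ put $W_+^{-\alpha}f(t)=\frac1{\Gamma(\alpha)}\int_t^\infty(s-t)^{\alpha-1}f(s)\,ds$ and $W_+^{\alpha}f(t)=(-1)^n\frac{d^n}{dt^n}W_+^{-(n-\alpha)}f(t)$ with $n=[\alpha]+1$; $W_+^0=\mathrm{Id}$. For $1\le p<\infty$ and $\alpha>0$, $\mathcal{T}_p^{(\alpha)}(t^\alpha)$ is the completion of $\mathcal{S}_+$ in the norm $\|f\|_{\alpha,p}=\frac1{\Gamma(\alpha+1)}\left(\int_0^\infty|W_+^\alpha f(t)|^p t^{\alpha p}dt\right)^{1/p}$; $\mathcal{T}_p^{(0)}(t^0)=L^p(\mathbb{R}^+)$. These spaces are continuously embedded in $L^p(\mathbb{R}^+)$ and regarded as subspaces of it. The map $D_+^\alpha f(t)=\frac1{\Gamma(\alpha+1)}t^\alpha W_+^\alpha f(t)$ extends to an isometric isomorphism $\mathcal{T}_p^{(\alpha)}(t^\alpha)\to L^p(\mathbb{R}^+)$ with inverse (for $\alpha>0$) $(D_+^\alpha)^{-1}h(t)=\alpha\int_t^\infty(s-t)^{\alpha-1}\frac{h(s)}{s^\alpha}ds$. For $1<p<\infty$ the dual of $\mathcal{T}_p^{(\alpha)}(t^\alpha)$ is $\mathcal{T}_{p'}^{(\alpha)}(t^\alpha)$ via the bilinear pairing $\langle f,g\rangle_\alpha=\int_0^\infty D_+^\alpha f(t)\,D_+^\alpha g(t)\,dt=\frac1{\Gamma(\alpha+1)^2}\int_0^\infty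 W_+^\alpha f(t)W_+^\alpha g(t)t^{2\alpha}dt$; adjoints are taken with respect to it. The operator $\mathcal{S}_{b,m}$ is bounded on $\mathcal{T}_q^{(\alpha)}(t^\alpha)$ whenever $0<b-\frac1q<m$. *)

theory Defs
  imports "HOL-Analysis.Analysis"
begin

text \<open>Functions on the half-line are represented by total functions \<open>real \<Rightarrow> complex\<close>; all notions
  below only depend on the values on the half-line, and elements of Lebesgue spaces are identified
  when they agree almost everywhere with respect to \<open>rplus\<close>.\<close>

definition rplus :: "real measure" where
  "rplus = restrict_space lborel {0<..}"

definition Lp :: "real \<Rightarrow> (real \<Rightarrow> complex) set" where
  "Lp p = {f \<in> borel_measurable rplus. integrable rplus (\<lambda>t. norm (f t) powr p)}"

definition Lp_norm :: "real \<Rightarrow> (real \<Rightarrow> complex) \<Rightarrow> real" where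
  "Lp_norm p f = (LINT t|rplus. norm (f t) powr p) powr (1 / p)"

text \<open>Derivative on \<open>[0,\<infinity>)\<close>, one-sided at the endpoint.\<close>

definition dplus :: "(real \<Rightarrow> complex) \<Rightarrow> real \<Rightarrow> complex" where
  "dplus f t = vector_derivative f (at t within {0..})"

definition schwartz_plus :: "(real \<Rightarrow> complex) set" where
  "schwartz_plus = {f. (\<forall>n. \<forall>t\<ge>0. (dplus ^^ n) f differentiable (at t within {0..})) \<and>
     (\<forall>m n. bounded ((\<lambda>t. t ^ m *\<^sub>R (dplus ^^ n) f t) ` {0..}))}"

definition weyl_int :: "real \<Rightarrow> (real \<Rightarrow> complex) \<Rightarrow> real \<Rightarrow> complex" where
  "weyl_int a f t = (1 / Gamma a) *\<^sub>R (LBINT s:{t<..}. ((s - t) powr (a - 1)) *\<^sub>R f s)"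

definition weyl_deriv :: "real \<Rightarrow> (real \<Rightarrow> complex) \<Rightarrow> real \<Rightarrow> complex" where
  "weyl_deriv a f t = (if a = 0 then f t else
     (let n = nat (\<lfloor>a\<rfloor> + 1) in (-1) ^ n * (dplus ^^ n) (weyl_int (real n - a) f) t))"

definition Dplus :: "real \<Rightarrow> (real \<Rightarrow> complex) \<Rightarrow> real \<Rightarrow> complex" where
  "Dplus a f t = (1 / Gamma (a + 1) * t powr a) *\<^sub>R weyl_deriv a f t"

text \<open>The norm on the Schwartz class that is completed.\<close>

definition schwartz_norm :: "real \<Rightarrow> real \<Rightarrow> (real \<Rightarrow> complex) \<Rightarrow> real" where
  "schwartz_norm a p f = 1 / Gamma (a + 1) *
     (LINT t|rplus. norm (weyl_deriv a f t) powr p * t powr (a * p)) powr (1 / p)"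

text \<open>The completion is continuously embedded in \<open>L\<^sup>p\<close>: the class of a Cauchy sequence is identified
  with its limit in \<open>L\<^sup>p\<close>.\<close>

definition represents :: "real \<Rightarrow> real \<Rightarrow> (nat \<Rightarrow> real \<Rightarrow> complex) \<Rightarrow> (real \<Rightarrow> complex) \<Rightarrow> bool" where
  "represents a p \<phi> f \<longleftrightarrow>
     (\<forall>n. \<phi> n \<in> schwartz_plus) \<and>
     (\<forall>\<epsilon>>0. \<exists>N. \<forall>m\<ge>N. \<forall>n\<ge>N. schwartz_norm a p (\<lambda>t. \<phi> m t - \<phi> n t) < \<epsilon>) \<and>
     f \<in> Lp p \<and> (\<lambda>n. Lp_norm p (\<lambda>t. \<phi> n t - f t)) \<longlonglongrightarrow> 0"

definition Tspace :: "real \<Rightarrow> real \<Rightarrow> (real \<Rightarrow> complex) set" where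
  "Tspace a p = (if a = 0 then Lp p else {f. \<exists>\<phi>. represents a p \<phi> f})"

text \<open>The continuous extension of \<open>Dplus\<close> from the Schwartz class to the completion, with values in
  \<open>L\<^sup>p\<close>; it is determined up to null sets, and the choice of a version is irrelevant below.\<close>

definition Dext :: "real \<Rightarrow> real \<Rightarrow> (real \<Rightarrow> complex) \<Rightarrow> real \<Rightarrow> complex" where
  "Dext a p f = (SOME h. h \<in> Lp p \<and>
     (\<exists>\<phi>. represents a p \<phi> f \<and> (\<lambda>n. Lp_norm p (\<lambda>t. Dplus a (\<phi> n) t - h t)) \<longlonglongrightarrow> 0))"

text \<open>The norm of the completion: on the Schwartz class \<open>schwartz_norm a p f\<close> is the \<open>L\<^sup>p\<close> norm of
  \<open>Dplus a f\<close>, and this persists for the continuous extensions.\<close>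

definition Tnorm :: "real \<Rightarrow> real \<Rightarrow> (real \<Rightarrow> complex) \<Rightarrow> real" where
  "Tnorm a p f = Lp_norm p (Dext a p f)"

text \<open>The bilinear (not sesquilinear) pairing of \<open>Tspace a p\<close> with \<open>Tspace a q\<close>, where \<open>q\<close> is the
  conjugate exponent of \<open>p\<close>.\<close>

definition pairing ::
  "real \<Rightarrow> real \<Rightarrow> real \<Rightarrow> (real \<Rightarrow> complex) \<Rightarrow> (real \<Rightarrow> complex) \<Rightarrow> complex" where
  "pairing a p q f g = (LINT t|rplus. Dext a p f t * Dext a q g t)"

definition stieltjes :: "real \<Rightarrow> real \<Rightarrow> (real \<Rightarrow> complex) \<Rightarrow> real \<Rightarrow> complex" where
  "stieltjes b m f t = (t powr (m - b)) *\<^sub>R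
     (LINT s|rplus. (s powr (b - 1) / (s + t) powr m) *\<^sub>R f s)"

end

theory Submission
  imports Defs
begin

text \<open>
  Both the Stieltjes operator and the inverse of \<open>Dplus\<close>, \<open>h \<mapsto> a \<integral>\<^sub>t\<^sup>\<infinity> (s - t)\<^sup>a\<^sup>-\<^sup>1 s\<^sup>-\<^sup>a h(s) ds\<close>, are
  integral operators whose kernel is homogeneous of degree \<open>-1\<close>; such operators are bounded on \<open>L\<^sup>p\<close>
  and commute with each other. Hence \<open>Dplus\<close> transports the whole statement to \<open>L\<^sup>p\<close>, where the adjoint
  is found by Fubini.

  All density statements reduce to one fact: a closed subspace of \<open>L\<^sup>p\<close> containing \<open>w u\<^sup>k\<close> for all \<open>k\<close>,
  where \<open>w\<close> is a positive weight and \<open>u\<close> is strictly monotone with values in the unit interval, is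
  everything. For the range of the Stieltjes operator these functions are obtained by differentiating
  the kernel with respect to its second variable; for the transpose of the inverse of \<open>Dplus\<close> they have
  explicit preimages by Euler's beta integral; for the image of the Schwartz class under \<open>Dplus\<close> they come
  from exponentials. Injectivity of an operator follows from the density of the range of its transpose.
  The Stieltjes operator is not surjective because the functions in its range are continuous.
\<close>

text \<open>After the substitution s = t u an operator with homogeneous kernel K becomes a
  superposition of dilations, f going to the integral of K(1,u) f(t u) du; dilations commute, hence
  so do these operators. The obstacle is that \<open>Tspace\<close> and \<open>Dext\<close> are
  given by Cauchy sequences and a choice, so that nothing can be computed from them directly. They
  become tractable through three facts about the inverse operator \<open>Dplus_inv\<close>: it
  undoes \<open>Dplus\<close> on the Schwartz class (semigroup law of Weyl integrals), the image of
  the Schwartz class under \<open>Dplus\<close> is dense in \<open>L\<^sup>p\<close>, and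
  \<open>Dplus_inv\<close> is injective on \<open>L\<^sup>p\<close>. With completeness of
  \<open>L\<^sup>p\<close> the first two identify \<open>Tspace\<close> with the range of
  \<open>Dplus_inv\<close>; the third makes the function picked by \<open>Dext\<close> unique up to
  null sets. Estimates are carried out for the p-th power of the norm, with Young's inequality in
  the place of Hoelder's.\<close>

section \<open>Lebesgue measure on the half-line and its behaviour under dilations\<close>

lemma space_rplus [simp]: "space rplus = {0<..}"
  by (simp add: rplus_def space_restrict_space)

interpretation rplus: sigma_finite_measure rplus
  unfolding rplus_def by (intro sigma_finite_measure_restrict_space lborel.sigma_finite_measure_axioms) auto

interpretation rplus2: pair_sigma_finite rplus rplus ..

lemma borel_measurable_rplusI [measurable (raw)]:
  "f \<in> borel_measurable borel \<Longrightarrow> f \<in> borel_measurable rplus"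
  unfolding rplus_def by (simp add: measurable_restrict_space1)

lemma AE_rplus_iff: "(AE t in rplus. P t) \<longleftrightarrow> (AE t in lborel. 0 < t \<longrightarrow> P t)"
  unfolding rplus_def by (subst AE_restrict_space_iff) auto

lemma AE_rplus_I: "(\<And>t. t > 0 \<Longrightarrow> P t) \<Longrightarrow> AE t in rplus. P t"
  by (intro AE_I2) auto

lemma AE_rplus_pos: "AE t in rplus. t > 0"
  by (rule AE_rplus_I)

lemma integrable_rplus_cong:
  "integrable rplus f \<Longrightarrow> (\<And>t. t > 0 \<Longrightarrow> f t = g t) \<Longrightarrow> integrable rplus g"
  by (subst Bochner_Integration.integrable_cong[OF refl, of rplus g f]) auto

lemma nn_integral_rplus: "(\<integral>\<^sup>+t. f t \<partial>rplus) = (\<integral>\<^sup>+t. f t * indicator {0<..} t \<partial>lborel)"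
  unfolding rplus_def by (subst nn_integral_restrict_space) auto

lemma nn_integral_rplus_scale:
  assumes "c > 0" and [measurable]: "f \<in> borel_measurable rplus"
  shows "(\<integral>\<^sup>+t. f t \<partial>rplus) = ennreal c * (\<integral>\<^sup>+t. f (c * t) \<partial>rplus)"
proof -
  have m: "(\<lambda>t. f t * indicator {0<..} t) \<in> borel_measurable borel"
    using assms(2) unfolding rplus_def by (subst (asm) borel_measurable_restrict_space_iff_ennreal) auto
  have "(\<integral>\<^sup>+t. f t \<partial>rplus) = ennreal \<bar>c\<bar> * (\<integral>\<^sup>+t. f (0 + c * t) * indicator {0<..} (0 + c * t) \<partial>lborel)"
    unfolding nn_integral_rplus using assms m by (subst nn_integral_real_affine[where c = c and t = 0]) auto
  also have "(\<integral>\<^sup>+t. f (0 + c * t) * indicator {0<..} (0 + c * t) \<partial>lborel) = (\<integral>\<^sup>+t. f (c * t) \<partial>rplus)"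
    unfolding nn_integral_rplus using assms
    by (intro nn_integral_cong) (auto simp: indicator_def zero_less_mult_iff)
  finally show ?thesis using assms by simp
qed

lemma measurable_rplus_scale:
  assumes "c > 0" shows "(\<lambda>t. c * t) \<in> measurable rplus rplus"
proof -
  have "(\<lambda>t. c * t) \<in> borel_measurable rplus" by simp
  then show ?thesis
    using assms unfolding rplus_def by (intro measurable_restrict_space2) (auto simp: space_restrict_space)
qed

lemma AE_rplus_scale:
  assumes "c > 0" "AE t in rplus. P t" shows "AE t in rplus. P (c * t)"
proof -
  obtain N where N: "{t \<in> space rplus. \<not> P t} \<subseteq> N" "emeasure rplus N = 0" "N \<in> sets rplus"
    using assms(2) by (rule AE_E)
  define N' where "N' = (\<lambda>t. c * t) -` N \<inter> space rplus"
  have N': "N' \<in> sets rplus"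
    unfolding N'_def using measurable_rplus_scale[OF assms(1)] N(3) by (rule measurable_sets)
  have "emeasure rplus N = (\<integral>\<^sup>+t. indicator N t \<partial>rplus)" using N(3) by simp
  also have "\<dots> = ennreal c * (\<integral>\<^sup>+t. indicator N (c * t) \<partial>rplus)"
    using N(3) by (intro nn_integral_rplus_scale assms) simp
  also have "(\<integral>\<^sup>+t. indicator N (c * t) \<partial>rplus) = (\<integral>\<^sup>+t. indicator N' t \<partial>rplus)"
    using assms(1) by (intro nn_integral_cong) (auto simp: N'_def indicator_def)
  also have "\<dots> = emeasure rplus N'" using N' by simp
  finally have "emeasure rplus N' = 0" using N(2) assms(1) by simp
  moreover have "{t \<in> space rplus. \<not> P (c * t)} \<subseteq> N'"
  proof
    fix x assume "x \<in> {t \<in> space rplus. \<not> P (c * t)}"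
    then have "x > 0" "c * x \<in> {t \<in> space rplus. \<not> P t}" using assms(1) by auto
    then show "x \<in> N'" using N(1) by (auto simp: N'_def)
  qed
  ultimately show ?thesis using N' by (intro AE_I[where N = N'])
qed

lemma measurable_compose_scale:
  assumes "c > 0" "f \<in> borel_measurable rplus" shows "(\<lambda>t. f (c * t)) \<in> borel_measurable rplus"
  using measurable_compose[OF measurable_rplus_scale assms(2)] assms(1) by blast

lemma integral_rplus_scale:
  fixes f :: "real \<Rightarrow> 'a::{banach, second_countable_topology}"
  assumes "c > 0" and f: "integrable rplus f"
  shows "(LINT t|rplus. f t) = c *\<^sub>R (LINT t|rplus. f (c * t))"
    and "integrable rplus (\<lambda>t. f (c * t))"
proof -
  have i: "integrable lborel (\<lambda>t. indicator {0<..} t *\<^sub>R f t)"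
    using f unfolding rplus_def by (subst (asm) integrable_restrict_space) auto
  have eq: "indicator {0<..} (c * t) *\<^sub>R f (c * t) = indicator {0<..} t *\<^sub>R f (c * t)" for t
    using assms by (auto simp: indicator_def zero_less_mult_iff)
  have "integrable lborel (\<lambda>t. indicator {0<..} (0 + c * t) *\<^sub>R f (0 + c * t))"
    using assms i by (intro lborel_integrable_real_affine) auto
  then show "integrable rplus (\<lambda>t. f (c * t))"
    unfolding rplus_def by (subst integrable_restrict_space) (auto simp: eq)
  have "(LINT t|rplus. f t) = (LINT t|lborel. indicator {0<..} t *\<^sub>R f t)"
    unfolding rplus_def by (subst integral_restrict_space) auto
  also have "\<dots> = \<bar>c\<bar> *\<^sub>R (LINT t|lborel. indicator {0<..} (0 + c * t) *\<^sub>R f (0 + c * t))"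
    using assms by (intro lborel_integral_real_affine) auto
  also have "\<dots> = c *\<^sub>R (LINT t|rplus. f (c * t))"
    unfolding rplus_def using assms by (subst integral_restrict_space) (auto simp: eq)
  finally show "(LINT t|rplus. f t) = c *\<^sub>R (LINT t|rplus. f (c * t))" .
qed

lemma integral_rplus_scale':
  fixes f :: "real \<Rightarrow> 'a::{banach, second_countable_topology}"
  assumes "c > 0"
  shows "(LINT t|rplus. f t) = c *\<^sub>R (LINT t|rplus. f (c * t))"
proof (cases "integrable rplus f")
  case False
  \<comment> \<open>The inverse dilation would carry integrability back to f. Both sides of the
    claim are therefore 0, the default value of a divergent integral.\<close>
  have "\<not> integrable rplus (\<lambda>t. f (c * t))"
    using integral_rplus_scale(2)[of "1 / c" "\<lambda>t. f (c * t)"] assms False by auto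
  then show ?thesis using False by (simp add: not_integrable_integral_eq)
qed (use integral_rplus_scale assms in auto)

lemma ex_rplus_AE:
  assumes "AE t in rplus. P t" "0 \<le> a" "a < b"
  shows "\<exists>t. a < t \<and> t < b \<and> P t"
proof (rule ccontr)
  assume "\<not> ?thesis"
  then have n: "\<And>t. a < t \<Longrightarrow> t < b \<Longrightarrow> \<not> P t" by blast
  have "AE t in lborel. t \<notin> {a<..<b}"
    using assms(1) unfolding AE_rplus_iff by eventually_elim (use n assms in force)
  then have "emeasure lborel {a<..<b} = 0"
    by (subst (asm) AE_iff_measurable[where N = "{a<..<b}"]) auto
  then show False using assms by simp
qed

subsection \<open>Lebesgue spaces\<close>

text \<open>The p-th power of the norm keeps every estimate at the level of integrals. The triangle
  inequality then holds with the constant 2^p, from |a + b| \<le> 2 max(|a|, |b|), which is enough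
  for all limit arguments.\<close>

definition Lp_modular :: "real \<Rightarrow> (real \<Rightarrow> complex) \<Rightarrow> real" where
  "Lp_modular p f = (LINT t|rplus. norm (f t) powr p)"

lemma Lp_modular_nonneg: "Lp_modular p f \<ge> 0"
  unfolding Lp_modular_def by (intro integral_nonneg_AE) auto

lemma Lp_norm_modular: "Lp_norm p f = Lp_modular p f powr (1 / p)"
  by (simp add: Lp_norm_def Lp_modular_def)

lemma Lp_measurable: "f \<in> Lp p \<Longrightarrow> f \<in> borel_measurable rplus"
  by (simp add: Lp_def)

lemma Lp_integrable: "f \<in> Lp p \<Longrightarrow> integrable rplus (\<lambda>t. norm (f t) powr p)"
  by (simp add: Lp_def)

lemma norm_add_powr_le:
  fixes a b :: "'a::real_normed_vector"
  assumes "p \<ge> 0"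
  shows "norm (a + b) powr p \<le> 2 powr p * (norm a powr p + norm b powr p)"
proof -
  define m where "m = max (norm a) (norm b)"
  have "norm (a + b) \<le> 2 * m" using norm_triangle_ineq[of a b] unfolding m_def by linarith
  then have "norm (a + b) powr p \<le> (2 * m) powr p" using assms by (intro powr_mono2) auto
  also have "\<dots> = 2 powr p * m powr p" by (subst powr_mult) (auto simp: m_def)
  also have "m powr p \<le> norm a powr p + norm b powr p" unfolding m_def max_def by auto
  finally show ?thesis by simp
qed

lemma Lp_mono_AE:
  assumes "p \<ge> 0" "f \<in> Lp p" "g \<in> borel_measurable rplus" "AE t in rplus. norm (g t) \<le> norm (f t)"
  shows "g \<in> Lp p" and "Lp_modular p g \<le> Lp_modular p f"
proof -
  have le: "AE t in rplus. norm (g t) powr p \<le> norm (f t) powr p"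
    using assms(4) by eventually_elim (use assms(1) in \<open>auto intro: powr_mono2\<close>)
  have "integrable rplus (\<lambda>t. norm (g t) powr p)"
    by (rule Bochner_Integration.integrable_bound[OF Lp_integrable[OF assms(2)]]) (use assms le in auto)
  then show "g \<in> Lp p" using assms by (simp add: Lp_def)
  then show "Lp_modular p g \<le> Lp_modular p f" unfolding Lp_modular_def
    by (intro integral_mono_AE le Lp_integrable assms)
qed

lemma Lp_cong_AE:
  assumes "p \<ge> 0" "f \<in> Lp p" "g \<in> borel_measurable rplus" "AE t in rplus. g t = f t"
  shows "g \<in> Lp p"
  by (rule Lp_mono_AE(1)[OF assms(1-3)]) (use assms(4) in auto)

lemma Lp_modular_cong_AE:
  assumes "f \<in> borel_measurable rplus" "g \<in> borel_measurable rplus" "AE t in rplus. g t = f t"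
  shows "Lp_modular p g = Lp_modular p f"
  unfolding Lp_modular_def by (rule integral_cong_AE) (use assms in auto)

lemma Lp_modular_cong: "(\<And>t. t > 0 \<Longrightarrow> f t = g t) \<Longrightarrow> Lp_modular p f = Lp_modular p g"
  unfolding Lp_modular_def by (intro Bochner_Integration.integral_cong) auto

lemma Lp_cong: "(\<And>t. t > 0 \<Longrightarrow> f t = g t) \<Longrightarrow> f \<in> Lp p \<longleftrightarrow> g \<in> Lp p"
  unfolding Lp_def mem_Collect_eq
  by (intro conj_cong measurable_cong Bochner_Integration.integrable_cong) auto

lemma Lp_add:
  assumes "p \<ge> 0" "f \<in> Lp p" "g \<in> Lp p"
  shows "(\<lambda>t. f t + g t) \<in> Lp p" and "Lp_modular p (\<lambda>t. f t + g t) \<le> 2 powr p * (Lp_modular p f + Lp_modular p g)"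
proof -
  note [measurable] = assms(2,3)[THEN Lp_measurable]
  have i: "integrable rplus (\<lambda>t. 2 powr p * (norm (f t) powr p + norm (g t) powr p))"
    using assms(2,3)[THEN Lp_integrable] by auto
  have i2: "integrable rplus (\<lambda>t. norm (f t + g t) powr p)"
    by (rule Bochner_Integration.integrable_bound[OF i])
       (use norm_add_powr_le[OF assms(1)] in \<open>auto simp: abs_mult\<close>)
  then show "(\<lambda>t. f t + g t) \<in> Lp p" by (simp add: Lp_def)
  have "Lp_modular p (\<lambda>t. f t + g t) \<le> (LINT t|rplus. 2 powr p * (norm (f t) powr p + norm (g t) powr p))"
    unfolding Lp_modular_def by (intro integral_mono i i2 norm_add_powr_le assms(1))
  then show "Lp_modular p (\<lambda>t. f t + g t) \<le> 2 powr p * (Lp_modular p f + Lp_modular p g)"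
    using assms(2,3)[THEN Lp_integrable] by (simp add: Lp_modular_def)
qed

lemma Lp_scale:
  assumes "f \<in> Lp p"
  shows "(\<lambda>t. c * f t) \<in> Lp p" and "Lp_modular p (\<lambda>t. c * f t) = norm c powr p * Lp_modular p f"
  using assms by (auto simp: Lp_def Lp_modular_def norm_mult powr_mult)

lemma Lp_diff:
  assumes "p \<ge> 0" "f \<in> Lp p" "g \<in> Lp p"
  shows "(\<lambda>t. f t - g t) \<in> Lp p" and "Lp_modular p (\<lambda>t. f t - g t) \<le> 2 powr p * (Lp_modular p f + Lp_modular p g)"
  using Lp_add[OF assms(1,2) Lp_scale(1)[OF assms(3), of "-1"]] Lp_scale(2)[OF assms(3), of "-1"] by auto

lemma Lp_zero: "(\<lambda>t. 0) \<in> Lp p" "Lp_modular p (\<lambda>t. 0) = 0"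
  by (auto simp: Lp_def Lp_modular_def)

lemma Lp_modular_minus_commute: "Lp_modular p (\<lambda>t. f t - g t) = Lp_modular p (\<lambda>t. g t - f t)"
  unfolding Lp_modular_def by (simp add: norm_minus_commute)

lemma Lp_modular_triangle:
  assumes "p \<ge> 0" "f \<in> Lp p" "g \<in> Lp p" "h \<in> Lp p"
  shows "Lp_modular p (\<lambda>t. f t - h t) \<le> 2 powr p * (Lp_modular p (\<lambda>t. f t - g t) + Lp_modular p (\<lambda>t. g t - h t))"
  using Lp_add(2)[OF assms(1) Lp_diff(1)[OF assms(1-3)] Lp_diff(1)[OF assms(1,3,4)]] by simp

lemma Lp_modular_eq_0_AE:
  assumes "f \<in> Lp p" "Lp_modular p f = 0"
  shows "AE t in rplus. f t = 0"
proof -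
  have "AE t in rplus. norm (f t) powr p = 0"
    using assms(2) Lp_integrable[OF assms(1)] unfolding Lp_modular_def
    by (subst (asm) integral_nonneg_eq_0_iff_AE) auto
  then show ?thesis by eventually_elim simp
qed

lemma Lp_dominated:
  assumes "p > 0" "\<And>n. f n \<in> borel_measurable rplus" "w \<in> Lp p"
    and "\<And>n. AE t in rplus. norm (f n t) \<le> norm (w t)"
    and lim: "AE t in rplus. (\<lambda>n. f n t) \<longlonglongrightarrow> 0"
  shows "(\<lambda>n. Lp_modular p (f n)) \<longlonglongrightarrow> 0"
proof -
  have "(\<lambda>n. LINT t|rplus. norm (f n t) powr p) \<longlonglongrightarrow> (LINT t|rplus. 0)"
  proof (rule integral_dominated_convergence[where w = "\<lambda>t. norm (w t) powr p"])
    show "integrable rplus (\<lambda>t. norm (w t) powr p)" using assms by (intro Lp_integrable)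
    show "AE t in rplus. (\<lambda>n. norm (f n t) powr p) \<longlonglongrightarrow> 0"
      using lim
    proof eventually_elim
      case (elim t)
      have "(\<lambda>n. norm (f n t)) \<longlonglongrightarrow> 0" using elim tendsto_norm_zero by blast
      then show ?case using \<open>p > 0\<close> by (auto intro!: tendsto_zero_powrI)
    qed
    show "AE t in rplus. norm (norm (f n t) powr p) \<le> norm (w t) powr p" for n
      using assms(4)[of n] by eventually_elim (use assms(1) in \<open>auto intro: powr_mono2\<close>)
  qed (use assms in auto)
  then show ?thesis by (simp add: Lp_modular_def)
qed

text \<open>An adjustable form of Young's inequality: the weight of the first factor may be made as
  small as desired at the price of a large \<open>C\<close> on the second. This is what makes the
  pairing with a fixed function continuous with respect to \<open>Lp_modular\<close>.\<close>

lemma Young_scaled: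
  fixes p q \<delta> :: real
  assumes "p > 1" "1 / p + 1 / q = 1" "\<delta> > 0"
  obtains C where "C > 0" "\<And>a b. a \<ge> 0 \<Longrightarrow> b \<ge> 0 \<Longrightarrow> a * b \<le> \<delta> * a powr p + C * b powr q"
proof -
  have q: "q > 1"
  proof -
    have "1 / q = 1 - 1 / p" using assms by simp
    moreover have "1 / p < 1" "1 / p > 0" using assms by auto
    ultimately have "1 / q > 0" "1 / q < 1" by linarith+
    then show ?thesis by (auto simp: field_simps split: if_splits)
  qed
  \<comment> \<open>Young's inequality is applied to the factors a d and b / d, where d^p =
    \<delta>.\<close>
  define d where "d = \<delta> powr (1 / p)"
  have d: "d > 0" "d powr p = \<delta>" using assms by (auto simp: d_def powr_powr)
  define C where "C = (1 / d) powr q"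
  have "a * b \<le> \<delta> * a powr p + C * b powr q" if "a \<ge> 0" "b \<ge> 0" for a b
  proof -
    have "a * b = (a * d) * (b * (1 / d))" using d by simp
    also have "\<dots> \<le> (a * d) powr p / p + (b * (1 / d)) powr q / q"
      using that d q assms by (intro Youngs_inequality) auto
    also have "\<dots> \<le> (a * d) powr p + (b * (1 / d)) powr q"
      using assms q frac_le[of "(a * d) powr p" "(a * d) powr p" 1 p]
        frac_le[of "(b * (1 / d)) powr q" "(b * (1 / d)) powr q" 1 q] by (intro add_mono) auto
    also have "(a * d) powr p = \<delta> * a powr p" using that d by (simp add: powr_mult)
    also have "(b * (1 / d)) powr q = C * b powr q" using that d unfolding C_def by (subst powr_mult) auto
    finally show ?thesis .
  qed
  moreover have "C > 0" using d by (simp add: C_def)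
  ultimately show ?thesis using that by blast
qed

lemma Lp_pairing:
  assumes "p > 1" "1 / p + 1 / q = 1" "f \<in> Lp p" "g \<in> Lp q"
  shows "integrable rplus (\<lambda>t. f t * g t)"
    and "integrable rplus (\<lambda>t. norm (f t) * norm (g t))"
proof -
  note [measurable] = assms(3,4)[THEN Lp_measurable]
  obtain C where C: "C > 0" "\<And>a b. a \<ge> 0 \<Longrightarrow> b \<ge> 0 \<Longrightarrow> a * b \<le> 1 * a powr p + C * b powr q"
    using Young_scaled[OF assms(1,2), of 1] by auto
  have i: "integrable rplus (\<lambda>t. 1 * norm (f t) powr p + C * norm (g t) powr q)"
    using assms(3,4)[THEN Lp_integrable] by auto
  show "integrable rplus (\<lambda>t. f t * g t)"
  proof (rule Bochner_Integration.integrable_bound[OF i])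
    show "AE t in rplus. norm (f t * g t) \<le> norm (1 * norm (f t) powr p + C * norm (g t) powr q)"
    proof (intro AE_I2)
      fix t
      have "norm (f t) * norm (g t) \<le> 1 * norm (f t) powr p + C * norm (g t) powr q" by (rule C(2)) auto
      then show "norm (f t * g t) \<le> norm (1 * norm (f t) powr p + C * norm (g t) powr q)"
        by (simp add: norm_mult)
    qed
  qed auto
  show "integrable rplus (\<lambda>t. norm (f t) * norm (g t))"
  proof (rule Bochner_Integration.integrable_bound[OF i])
    show "AE t in rplus. norm (norm (f t) * norm (g t)) \<le> norm (1 * norm (f t) powr p + C * norm (g t) powr q)"
    proof (intro AE_I2)
      fix t
      have "norm (f t) * norm (g t) \<le> 1 * norm (f t) powr p + C * norm (g t) powr q" by (rule C(2)) auto
      then show "norm (norm (f t) * norm (g t)) \<le> norm (1 * norm (f t) powr p + C * norm (g t) powr q)"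
        by (simp add: norm_mult)
    qed
  qed auto
qed

lemma Lp_pairing_bound:
  assumes "p > 1" "1 / p + 1 / q = 1" "f \<in> Lp p" "g \<in> Lp q"
    and "\<And>a b. a \<ge> 0 \<Longrightarrow> b \<ge> 0 \<Longrightarrow> a * b \<le> \<delta> * a powr p + C * b powr q"
  shows "norm (LINT t|rplus. f t * g t) \<le> \<delta> * Lp_modular p f + C * Lp_modular q g"
proof -
  have n: "integrable rplus (\<lambda>t. norm (f t * g t))"
    using integrable_norm[OF Lp_pairing(1)[OF assms(1-4)]] .
  have "norm (LINT t|rplus. f t * g t) \<le> (LINT t|rplus. norm (f t * g t))"
    using Lp_pairing(1)[OF assms(1-4)] by (intro integral_norm_bound)
  also have "\<dots> \<le> (LINT t|rplus. \<delta> * norm (f t) powr p + C * norm (g t) powr q)"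
    using assms(3,4)[THEN Lp_integrable] assms(5)
    by (intro integral_mono n) (auto simp: norm_mult)
  also have "\<dots> = \<delta> * Lp_modular p f + C * Lp_modular q g"
    using assms(3,4)[THEN Lp_integrable] by (simp add: Lp_modular_def)
  finally show ?thesis .
qed

lemma conj_exponent:
  fixes p q :: real
  assumes "p > 1" "1 / p + 1 / q = 1" shows "q > 1" "1 / q + 1 / p = 1" "(p - 1) * q = p" "1 / q = 1 - 1 / p"
proof -
  show e: "1 / q = 1 - 1 / p" using assms by simp
  moreover have "1 / p < 1" "1 / p > 0" using assms by auto
  ultimately have "1 / q > 0" "1 / q < 1" by linarith+
  then show q: "q > 1" by (auto simp: field_simps split: if_splits)
  show "1 / q + 1 / p = 1" using assms by simp
  show "(p - 1) * q = p" using e q assms by (simp add: field_simps)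
qed

lemma Lp_annihilator:
  assumes "p > 1" "1 / p + 1 / q = 1" "f \<in> Lp p"
    and z: "\<And>g. g \<in> Lp q \<Longrightarrow> (LINT t|rplus. f t * g t) = 0"
  shows "AE t in rplus. f t = 0"
proof -
  note [measurable] = Lp_measurable[OF assms(3)]
  note q = conj_exponent[OF assms(1,2)]
  \<comment> \<open>The extremal function of Hoelder's inequality: it lies in \<open>Lp q\<close>
    because (p - 1) q = p, and f g = |f|^p. Where f vanishes, so does g, also for p < 2.\<close>
  define g where "g t = cnj (f t) * complex_of_real (norm (f t) powr (p - 2))" for t
  have ng: "norm (g t) = norm (f t) powr (p - 1)" for t
    by (cases "f t = 0") (auto simp: g_def norm_mult powr_mult_base)
  have "norm (g t) powr q = norm (f t) powr p" for t
    unfolding ng by (simp add: powr_powr q)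
  moreover have [measurable]: "cnj \<in> borel_measurable borel"
    by (intro borel_measurable_continuous_onI continuous_intros)
  have "g \<in> borel_measurable rplus" unfolding g_def by measurable
  ultimately have "g \<in> Lp q" using Lp_integrable[OF assms(3)] by (simp add: Lp_def)
  then have "(LINT t|rplus. f t * g t) = 0" by (rule z)
  moreover have "f t * g t = complex_of_real (norm (f t) powr p)" for t
  proof (cases "f t = 0")
    case False
    have "f t * g t = complex_of_real (norm (f t) ^ 2 * norm (f t) powr (p - 2))"
      unfolding g_def by (simp add: complex_norm_square mult.assoc del: of_real_power)
    also have "norm (f t) ^ 2 * norm (f t) powr (p - 2) = norm (f t) powr p"
    proof -
      have sq: "norm (f t) ^ 2 = norm (f t) powr 2" using False by simp
      show ?thesis unfolding sq powr_add[symmetric] by simp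
    qed
    finally show ?thesis .
  qed auto
  ultimately have "Lp_modular p f = 0" by (simp add: Lp_modular_def)
  then show ?thesis using assms(3) by (intro Lp_modular_eq_0_AE)
qed

text \<open>The theorem of Riesz and Fischer. Instead of summing norms by Minkowski's inequality,
  the increments of a fast subsequence are weighted by 2^(p k); the weighted series still has a
  finite integral, so almost everywhere its terms tend to 0 and the increments are eventually at
  most 2^(-k).\<close>

lemma Lp_complete:
  assumes p: "p > 0" and f: "\<And>n. f n \<in> Lp p"
    and cauchy: "\<And>\<epsilon>. \<epsilon> > 0 \<Longrightarrow> \<exists>N. \<forall>m\<ge>N. \<forall>n\<ge>N. Lp_modular p (\<lambda>t. f m t - f n t) < \<epsilon>"
  obtains h where "h \<in> Lp p" "(\<lambda>n. Lp_modular p (\<lambda>t. f n t - h t)) \<longlonglongrightarrow> 0"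
proof -
  note [measurable] = Lp_measurable[OF f]
  \<comment> \<open>Against the weights 2^(p k) this leaves a geometric series of ratio
    2^(-p).\<close>
  define a where "a k = 1 / (4 powr p) ^ k" for k :: nat
  have "\<exists>N. \<forall>m\<ge>N. \<forall>n\<ge>N. Lp_modular p (\<lambda>t. f m t - f n t) < a k" for k
    by (rule cauchy) (simp add: a_def)
  then obtain N where N: "\<And>k m n. m \<ge> N k \<Longrightarrow> n \<ge> N k \<Longrightarrow> Lp_modular p (\<lambda>t. f m t - f n t) < a k"
    by metis
  \<comment> \<open>Partial sums make the index sequence monotone while keeping r k \<ge> N
    k.\<close>
  define r where "r k = (\<Sum>j\<le>k. N j)" for k
  have rN: "r k \<ge> N k" for k unfolding r_def by (rule member_le_sum) auto
  have rmono: "r k \<le> r l" if "k \<le> l" for k l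
    unfolding r_def using that by (intro sum_mono2) auto
  define g where "g k t = f (r (Suc k)) t - f (r k) t" for k t
  have gLp: "g k \<in> Lp p" for k unfolding g_def using p by (intro Lp_diff f) auto
  note [measurable] = Lp_measurable[OF gLp]
  have gI: "Lp_modular p (g k) < a k" for k
    unfolding g_def using N[of k "r (Suc k)" "r k"] rN[of k] rmono[of k "Suc k"] by auto
  have eqk: "(\<integral>\<^sup>+t. ennreal ((2 powr p) ^ k * norm (g k t) powr p) \<partial>rplus)
      = ennreal ((2 powr p) ^ k * Lp_modular p (g k))" for k
    unfolding Lp_modular_def using Lp_integrable[OF gLp]
    by (subst nn_integral_eq_integral) auto
  have "(\<integral>\<^sup>+t. (\<Sum>k. ennreal ((2 powr p) ^ k * norm (g k t) powr p)) \<partial>rplus)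
      = (\<Sum>k. \<integral>\<^sup>+t. ennreal ((2 powr p) ^ k * norm (g k t) powr p) \<partial>rplus)"
    by (intro nn_integral_suminf) measurable
  also have "\<dots> = (\<Sum>k. ennreal ((2 powr p) ^ k * Lp_modular p (g k)))" by (simp only: eqk)
  also have "(\<Sum>k. ennreal ((2 powr p) ^ k * Lp_modular p (g k))) \<le> (\<Sum>k. ennreal ((1 / 2 powr p) ^ k))"
  proof (intro suminf_le ennreal_leI)
    fix k :: nat
    have f4: "(4::real) powr p = 2 powr p * 2 powr p" by (subst powr_mult[symmetric]) auto
    have "(2 powr p) ^ k * Lp_modular p (g k) \<le> (2 powr p) ^ k * a k"
      using gI[of k] by (intro mult_left_mono) auto
    also have "(2 powr p) ^ k * a k = (1 / 2 powr p) ^ k"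
      unfolding a_def f4
      by (simp add: power_mult_distrib power_divide field_simps)
    finally show "(2 powr p) ^ k * Lp_modular p (g k) \<le> (1 / 2 powr p) ^ k" .
  qed auto
  also have "\<dots> = ennreal (\<Sum>k. (1 / 2 powr p) ^ k)"
    using p by (intro suminf_ennreal2 summable_geometric) auto
  finally have "(\<integral>\<^sup>+t. (\<Sum>k. ennreal ((2 powr p) ^ k * norm (g k t) powr p)) \<partial>rplus) \<noteq> \<infinity>"
    by (auto simp: top_unique)
  then have AEfin: "AE t in rplus. (\<Sum>k. ennreal ((2 powr p) ^ k * norm (g k t) powr p)) \<noteq> \<infinity>"
    by (intro nn_integral_PInf_AE) auto
  have AEconv: "AE t in rplus. convergent (\<lambda>k. f (r k) t)"
    using AEfin
  proof eventually_elim
    case (elim t)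
    then have "summable (\<lambda>k. (2 powr p) ^ k * norm (g k t) powr p)"
      by (intro summable_suminf_not_top) auto
    then have "(\<lambda>k. (2 powr p) ^ k * norm (g k t) powr p) \<longlonglongrightarrow> 0" by (rule summable_LIMSEQ_zero)
    then have "eventually (\<lambda>k. (2 powr p) ^ k * norm (g k t) powr p < 1) sequentially"
      by (rule order_tendstoD) simp
    then have "eventually (\<lambda>k. norm (g k t) \<le> (1 / 2) ^ k) sequentially"
    proof eventually_elim
      case (elim k)
      have "((2::real) ^ k) powr p = (2 powr p) ^ k"
        by (induction k) (auto simp: powr_mult)
      then have "(2 ^ k * norm (g k t)) powr p = (2 powr p) ^ k * norm (g k t) powr p"
        by (subst powr_mult) auto
      then have lt: "(2 ^ k * norm (g k t)) powr p < 1 powr p" using elim by simp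
      have "2 ^ k * norm (g k t) < 1"
      proof (rule ccontr)
        assume "\<not> ?thesis"
        then have "1 powr p \<le> (2 ^ k * norm (g k t)) powr p" using p by (intro powr_mono2) auto
        with lt show False by simp
      qed
      then have "norm (g k t) \<le> 1 / 2 ^ k" by (simp add: pos_le_divide_eq mult.commute)
      then show ?case by (simp only: power_one_over)
    qed
    then have "summable (\<lambda>k. g k t)"
      by (rule summable_comparison_test_ev) (rule summable_geometric, simp)
    then have "convergent (\<lambda>n. \<Sum>k<n. g k t)" by (simp add: summable_iff_convergent)
    then have "convergent (\<lambda>n. f (r n) t - f (r 0) t)"
      unfolding g_def by (simp add: sum_lessThan_telescope[of "\<lambda>k. f (r k) t"])
    then have "convergent (\<lambda>n. (f (r n) t - f (r 0) t) + f (r 0) t)"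
      by (intro convergent_add convergent_const)
    then show ?case by simp
  qed
  define h where "h t = lim (\<lambda>k. f (r k) t)" for t
  have [measurable]: "h \<in> borel_measurable rplus"
    unfolding h_def by (rule borel_measurable_lim_metric) measurable
  have AElim: "AE t in rplus. (\<lambda>k. f (r k) t) \<longlonglongrightarrow> h t"
    using AEconv by eventually_elim (simp add: h_def convergent_LIMSEQ_iff)
  \<comment> \<open>Fatou's lemma along the subsequence: the Cauchy estimate between f n and f (r j)
    survives as j tends to infinity.\<close>
  have fatou: "(\<integral>\<^sup>+t. ennreal (norm (f n t - h t) powr p) \<partial>rplus) \<le> ennreal (a k)" if n: "n \<ge> r k" for n k
  proof -
    have "(\<integral>\<^sup>+t. ennreal (norm (f n t - h t) powr p) \<partial>rplus)
        = (\<integral>\<^sup>+t. liminf (\<lambda>j. ennreal (norm (f n t - f (r j) t) powr p)) \<partial>rplus)"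
    proof (rule nn_integral_cong_AE, use AElim in eventually_elim)
      case (elim t)
      have "(\<lambda>j. norm (f n t - f (r j) t) powr p) \<longlonglongrightarrow> norm (f n t - h t) powr p"
        by (rule tendsto_powr') (use elim p in \<open>auto intro!: tendsto_intros\<close>)
      then have "(\<lambda>j. ennreal (norm (f n t - f (r j) t) powr p)) \<longlonglongrightarrow> ennreal (norm (f n t - h t) powr p)"
        by (rule tendsto_ennrealI)
      then show ?case by (rule lim_imp_Liminf[OF sequentially_bot, symmetric])
    qed
    also have "\<dots> \<le> liminf (\<lambda>j. \<integral>\<^sup>+t. ennreal (norm (f n t - f (r j) t) powr p) \<partial>rplus)"
      by (rule nn_integral_liminf) measurable
    also have "\<dots> \<le> ennreal (a k)"
    proof (rule Liminf_le)
      show "\<forall>\<^sub>F j in sequentially. (\<integral>\<^sup>+t. ennreal (norm (f n t - f (r j) t) powr p) \<partial>rplus) \<le> ennreal (a k)"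
        using eventually_ge_at_top[of k]
      proof eventually_elim
        case (elim j)
        have "(\<integral>\<^sup>+t. ennreal (norm (f n t - f (r j) t) powr p) \<partial>rplus) = ennreal (Lp_modular p (\<lambda>t. f n t - f (r j) t))"
          unfolding Lp_modular_def using p by (intro nn_integral_eq_integral Lp_integrable Lp_diff f) auto
        also have "\<dots> \<le> ennreal (a k)"
          using N[of k n "r j"] rN[of k] n rmono[OF elim] by (intro ennreal_leI) auto
        finally show ?case .
      qed
    qed simp
    finally show ?thesis .
  qed
  have d: "(\<lambda>t. f n t - h t) \<in> Lp p" "Lp_modular p (\<lambda>t. f n t - h t) \<le> a k" if n: "n \<ge> r k" for n k
  proof -
    have i: "integrable rplus (\<lambda>t. norm (f n t - h t) powr p)"
      using fatou[OF n] by (intro integrableI_bounded) (auto simp: less_top[symmetric] top_unique)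
    then show "(\<lambda>t. f n t - h t) \<in> Lp p" by (simp add: Lp_def)
    have "ennreal (Lp_modular p (\<lambda>t. f n t - h t)) \<le> ennreal (a k)"
      using fatou[OF n] unfolding Lp_modular_def by (subst nn_integral_eq_integral[OF i, symmetric]) auto
    then show "Lp_modular p (\<lambda>t. f n t - h t) \<le> a k" by (subst (asm) ennreal_le_iff) (auto simp: a_def)
  qed
  have "(\<lambda>t. f (r 0) t - (f (r 0) t - h t)) \<in> Lp p"
    using p by (intro Lp_diff f d(1)[of 0]) auto
  then have "h \<in> Lp p" by simp
  moreover have "(\<lambda>n. Lp_modular p (\<lambda>t. f n t - h t)) \<longlonglongrightarrow> 0"
  proof (rule LIMSEQ_I)
    fix e :: real assume "e > 0"
    have "(\<lambda>k. (1 / 4 powr p) ^ k) \<longlonglongrightarrow> 0" using p by (intro LIMSEQ_power_zero) auto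
    then have "eventually (\<lambda>k. (1 / 4 powr p) ^ k < e) sequentially"
      using \<open>e > 0\<close> by (rule order_tendstoD)
    then obtain k where "(1 / 4 powr p) ^ k < e" by (auto simp: eventually_sequentially)
    then have "a k < e" by (simp add: a_def power_divide)
    then show "\<exists>no. \<forall>n\<ge>no. norm (Lp_modular p (\<lambda>t. f n t - h t) - 0) < e"
      using d(2)[of k] Lp_modular_nonneg by (intro exI[of _ "r k"]) fastforce
  qed
  ultimately show ?thesis using that by blast
qed

section \<open>Closed subspaces and the density of weighted powers\<close>

definition closed_subspace :: "real \<Rightarrow> (real \<Rightarrow> complex) set \<Rightarrow> bool" where
  "closed_subspace p X \<longleftrightarrow> X \<subseteq> Lp p \<and> (\<forall>f\<in>X. \<forall>g\<in>X. (\<lambda>t. f t + g t) \<in> X) \<and>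
     (\<forall>c. \<forall>f\<in>X. (\<lambda>t. c * f t) \<in> X) \<and>
     (\<forall>f\<in>Lp p. (\<forall>\<epsilon>>0. \<exists>g\<in>X. Lp_modular p (\<lambda>t. f t - g t) < \<epsilon>) \<longrightarrow> f \<in> X)"

context
  fixes p X assumes X: "closed_subspace p X"
begin

lemma closed_subspace_Lp: "f \<in> X \<Longrightarrow> f \<in> Lp p"
  using X by (auto simp: closed_subspace_def)

lemma closed_subspace_add: "f \<in> X \<Longrightarrow> g \<in> X \<Longrightarrow> (\<lambda>t. f t + g t) \<in> X"
  using X by (auto simp: closed_subspace_def)

lemma closed_subspace_scale: "f \<in> X \<Longrightarrow> (\<lambda>t. c * f t) \<in> X"
  using X by (auto simp: closed_subspace_def)

lemma closed_subspace_diff: "f \<in> X \<Longrightarrow> g \<in> X \<Longrightarrow> (\<lambda>t. f t - g t) \<in> X"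
  using closed_subspace_add[of f "\<lambda>t. (-1) * g t"] closed_subspace_scale[of g "-1"] by simp

lemma closed_subspace_closed: "f \<in> Lp p \<Longrightarrow> (\<And>\<epsilon>. \<epsilon> > 0 \<Longrightarrow> \<exists>g\<in>X. Lp_modular p (\<lambda>t. f t - g t) < \<epsilon>) \<Longrightarrow> f \<in> X"
  using X by (auto simp: closed_subspace_def)

lemma closed_subspace_limit:
  assumes "f \<in> Lp p" "\<And>n. g n \<in> X" "(\<lambda>n::nat. Lp_modular p (\<lambda>t. f t - g n t)) \<longlonglongrightarrow> 0"
  shows "f \<in> X"
proof (rule closed_subspace_closed[OF assms(1)])
  fix \<epsilon> :: real assume "\<epsilon> > 0"
  then have "eventually (\<lambda>n. Lp_modular p (\<lambda>t. f t - g n t) < \<epsilon>) sequentially"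
    using assms(3) by (intro order_tendstoD)
  then show "\<exists>g\<in>X. Lp_modular p (\<lambda>t. f t - g t) < \<epsilon>" using assms(2) by (auto simp: eventually_sequentially)
qed

lemma closed_subspace_cong_AE:
  assumes "f \<in> borel_measurable rplus" "g \<in> X" "AE t in rplus. f t = g t" "p \<ge> 0"
  shows "f \<in> X"
proof (rule closed_subspace_closed)
  show f: "f \<in> Lp p" using Lp_cong_AE[OF assms(4) closed_subspace_Lp[OF assms(2)] assms(1,3)] .
  have "Lp_modular p (\<lambda>t. f t - g t) = Lp_modular p (\<lambda>t. 0)"
    using assms f closed_subspace_Lp[THEN Lp_measurable] by (intro Lp_modular_cong_AE) auto
  then show "\<exists>g\<in>X. Lp_modular p (\<lambda>t. f t - g t) < \<epsilon>" if "\<epsilon> > 0" for \<epsilon>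
    using that assms(2) Lp_zero(2) by (intro bexI[of _ g]) auto
qed

lemma closed_subspace_sum: "finite I \<Longrightarrow> g0 \<in> X \<Longrightarrow> (\<And>i. i \<in> I \<Longrightarrow> f i \<in> X) \<Longrightarrow> (\<lambda>t. \<Sum>i\<in>I. f i t) \<in> X"
proof (induction I rule: finite_induct)
  case empty
  then show ?case using closed_subspace_scale[of g0 0] by simp
next
  case (insert i I)
  then show ?case using closed_subspace_add[of "f i" "\<lambda>t. \<Sum>i\<in>I. f i t"] by simp
qed

text \<open>The subspace is enlarged step by step: products w u^i (1 - u)^j; w \<phi>(u) for
  continuous \<phi>, by Bernstein polynomials; w times indicators of rays; of Borel sets, by
  Dynkin's lemma; of simple functions; finally f = w (f / w). Strict monotonicity of
  \<open>u\<close> makes the rays in t preimages of rays under \<open>u\<close>, so that composing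
  with \<open>u\<close> loses no sets. The disjunction admits both shapes that occur: powers of u
  from exponentials and kernel sections, powers of 1 - u from beta integrals.\<close>

lemma weighted_powers_dense:
  fixes w u :: "real \<Rightarrow> real"
  assumes p: "p > 0" and [measurable]: "w \<in> borel_measurable rplus" "u \<in> borel_measurable rplus"
    and w: "\<And>t. t > 0 \<Longrightarrow> w t > 0" "(\<lambda>t. complex_of_real (w t)) \<in> Lp p"
    and u: "\<And>t. t > 0 \<Longrightarrow> 0 \<le> u t \<and> u t \<le> 1" "\<And>s t. 0 < s \<Longrightarrow> s < t \<Longrightarrow> u t < u s"
    and mono: "(\<forall>k. (\<lambda>t. complex_of_real (w t * u t ^ k)) \<in> X) \<or> (\<forall>k. (\<lambda>t. complex_of_real (w t * (1 - u t) ^ k)) \<in> X)"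
    and f: "f \<in> Lp p"
  shows "f \<in> X"
proof -
  let ?c = complex_of_real
  have wX: "(\<lambda>t. ?c (w t)) \<in> X"
    using mono by (elim disjE) (drule spec[of _ 0], simp)+
  \<comment> \<open>A further factor 1 - u is the difference of two members with neighbouring powers
    of u, and in the second case the roles are exchanged. These products are the terms of the
    Bernstein polynomials.\<close>
  have monom: "(\<lambda>t. ?c (w t * (u t ^ i * (1 - u t) ^ j))) \<in> X" for i j
    using mono
  proof
    assume a: "\<forall>k. (\<lambda>t. ?c (w t * u t ^ k)) \<in> X"
    show ?thesis
    proof (induction j arbitrary: i)
      case (Suc j)
      from closed_subspace_diff[OF Suc[of i] Suc[of "Suc i"]] show ?case by (simp add: algebra_simps)
    qed (use a in simp)
  next
    assume a: "\<forall>k. (\<lambda>t. ?c (w t * (1 - u t) ^ k)) \<in> X"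
    show ?thesis
    proof (induction i arbitrary: j)
      case (Suc i)
      from closed_subspace_diff[OF Suc[of j] Suc[of "Suc j"]] show ?case by (simp add: algebra_simps)
    qed (use a in simp)
  qed
  have cont: "(\<lambda>t. ?c (w t * \<phi> (u t))) \<in> X" if \<phi>: "continuous_on UNIV \<phi>" for \<phi> :: "real \<Rightarrow> real"
  proof (rule closed_subspace_closed)
    have [measurable]: "\<phi> \<in> borel_measurable borel" using \<phi> by (rule borel_measurable_continuous_onI)
    have cb: "compact (\<phi> ` {0..1})" by (intro compact_continuous_image continuous_on_subset[OF \<phi>]) auto
    then obtain B where B: "\<And>x. x \<in> {0..1} \<Longrightarrow> \<bar>\<phi> x\<bar> \<le> B"
      using compact_imp_bounded[OF cb] unfolding bounded_iff by (metis imageI real_norm_def)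
    show "(\<lambda>t. ?c (w t * \<phi> (u t))) \<in> Lp p"
    proof (rule Lp_mono_AE(1))
      show "(\<lambda>t. ?c B * ?c (w t)) \<in> Lp p" by (intro Lp_scale w)
      show "AE t in rplus. norm (?c (w t * \<phi> (u t))) \<le> norm (?c B * ?c (w t))"
      proof (rule AE_rplus_I)
        fix t :: real assume "t > 0"
        then have "\<bar>\<phi> (u t)\<bar> \<le> \<bar>B\<bar>" using B[of "u t"] u(1)[of t] by auto
        then have "\<bar>w t\<bar> * \<bar>\<phi> (u t)\<bar> \<le> \<bar>w t\<bar> * \<bar>B\<bar>" by (intro mult_left_mono) auto
        then show "norm (?c (w t * \<phi> (u t))) \<le> norm (?c B * ?c (w t))"
          by (simp add: norm_mult abs_mult mult.commute)
      qed
    qed (use p in auto)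
    fix \<epsilon> :: real assume \<epsilon>: "\<epsilon> > 0"
    define I where "I = Lp_modular p (\<lambda>t. ?c (w t))"
    have I: "I \<ge> 0" by (simp add: I_def Lp_modular_nonneg)
    \<comment> \<open>The summand 1 guards against I = 0 and makes the final estimate strict: e^p I
      < e^p (I + 1) = \<epsilon>.\<close>
    define e where "e = (\<epsilon> / (I + 1)) powr (1 / p)"
    have e: "e > 0" "e powr p = \<epsilon> / (I + 1)" using \<epsilon> I p by (auto simp: e_def powr_powr)
    have "\<exists>N. \<forall>n x. N \<le> n \<and> x \<in> {0..1} \<longrightarrow> \<bar>\<phi> x - (\<Sum>k\<le>n. \<phi> (k / n) * Bernstein n k x)\<bar> < e"
      using Bernstein_Weierstrass[of \<phi> e] e continuous_on_subset[OF \<phi>] by auto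
    then obtain n where n: "\<And>x. x \<in> {0..1} \<Longrightarrow> \<bar>\<phi> x - (\<Sum>k\<le>n. \<phi> (k / n) * Bernstein n k x)\<bar> < e"
      by blast
    define P where "P x = (\<Sum>k\<le>n. \<phi> (k / n) * Bernstein n k x)" for x
    have "(\<lambda>t. \<Sum>k\<le>n. ?c (\<phi> (k / n) * (n choose k)) * ?c (w t * (u t ^ k * (1 - u t) ^ (n - k)))) \<in> X"
      by (intro closed_subspace_sum[OF _ wX] closed_subspace_scale monom) auto
    also have "(\<lambda>t. \<Sum>k\<le>n. ?c (\<phi> (k / n) * (n choose k)) * ?c (w t * (u t ^ k * (1 - u t) ^ (n - k))))
       = (\<lambda>t. ?c (w t * P (u t)))"
      by (simp add: P_def Bernstein_def sum_distrib_left mult_ac)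
    finally have PX: "(\<lambda>t. ?c (w t * P (u t))) \<in> X" .
    have "Lp_modular p (\<lambda>t. ?c (w t * \<phi> (u t)) - ?c (w t * P (u t))) \<le> Lp_modular p (\<lambda>t. ?c e * ?c (w t))"
    proof (rule Lp_mono_AE(2))
      show "(\<lambda>t. ?c e * ?c (w t)) \<in> Lp p" by (intro Lp_scale w)
      show "(\<lambda>t. ?c (w t * \<phi> (u t)) - ?c (w t * P (u t))) \<in> borel_measurable rplus"
        using Lp_measurable[OF closed_subspace_Lp[OF PX]] by measurable
      show "AE t in rplus. norm (?c (w t * \<phi> (u t)) - ?c (w t * P (u t))) \<le> norm (?c e * ?c (w t))"
      proof (rule AE_rplus_I)
        fix t :: real assume t: "t > 0"
        then have "\<bar>\<phi> (u t) - P (u t)\<bar> \<le> e" using n[of "u t"] u(1)[of t] by (auto simp: P_def)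
        then have "w t * \<bar>\<phi> (u t) - P (u t)\<bar> \<le> w t * e" using w(1)[OF t] by (intro mult_left_mono) auto
        moreover have "norm (?c (w t * \<phi> (u t)) - ?c (w t * P (u t))) = w t * \<bar>\<phi> (u t) - P (u t)\<bar>"
          unfolding of_real_diff[symmetric] norm_of_real right_diff_distrib[symmetric]
          using w(1)[OF t] by (simp add: abs_mult)
        ultimately show "norm (?c (w t * \<phi> (u t)) - ?c (w t * P (u t))) \<le> norm (?c e * ?c (w t))"
          using e w(1)[OF t] by (simp add: norm_mult mult.commute)
      qed
    qed (use p in auto)
    also have "\<dots> = e powr p * I" using e by (simp add: Lp_scale(2)[OF w(2)] I_def)
    also have "\<dots> < \<epsilon>"
    proof -
      have "e powr p > 0" "e powr p * I + e powr p = \<epsilon>" using e I by (auto simp: field_simps)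
      then show ?thesis by linarith
    qed
    finally show "\<exists>g\<in>X. Lp_modular p (\<lambda>t. ?c (w t * \<phi> (u t)) - g t) < \<epsilon>"
      using PX by (rule bexI)
  qed
  have lim: "(\<lambda>t. ?c (w t * g t)) \<in> X"
    if gn: "\<And>n::nat. (\<lambda>t. ?c (w t * h n t)) \<in> X" and b: "\<And>n t. t > 0 \<Longrightarrow> \<bar>h n t\<bar> \<le> 1"
      and l: "\<And>t. t > 0 \<Longrightarrow> (\<lambda>n. h n t) \<longlonglongrightarrow> g t" and [measurable]: "g \<in> borel_measurable rplus" for h g
  proof (rule closed_subspace_limit[OF _ gn])
    have gb: "\<bar>g t\<bar> \<le> 1" if "t > 0" for t
      using l[OF that] by (rule tendsto_upperbound[OF tendsto_rabs]) (use b that in auto)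
    show "(\<lambda>t. ?c (w t * g t)) \<in> Lp p"
    proof (rule Lp_mono_AE(1)[OF _ w(2)])
      show "AE t in rplus. norm (?c (w t * g t)) \<le> norm (?c (w t))"
        using gb w(1) by (intro AE_rplus_I) (auto simp: norm_mult abs_mult intro: mult_left_le)
    qed (use p in auto)
    show "(\<lambda>n. Lp_modular p (\<lambda>t. ?c (w t * g t) - ?c (w t * h n t))) \<longlonglongrightarrow> 0"
    proof (rule Lp_dominated[OF p])
      show "(\<lambda>t. 2 * ?c (w t)) \<in> Lp p" by (intro Lp_scale w)
      show "(\<lambda>t. ?c (w t * g t) - ?c (w t * h n t)) \<in> borel_measurable rplus" for n
        using Lp_measurable[OF closed_subspace_Lp[OF gn]] by measurable
      show "AE t in rplus. norm (?c (w t * g t) - ?c (w t * h n t)) \<le> norm (2 * ?c (w t))" for n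
      proof (rule AE_rplus_I)
        fix t :: real assume t: "t > 0"
        have "\<bar>g t - h n t\<bar> \<le> 2" using gb[OF t] b[OF t, of n] by linarith
        then have "w t * \<bar>g t - h n t\<bar> \<le> w t * 2" using w(1)[OF t] by (intro mult_left_mono) auto
        moreover have "norm (?c (w t * g t) - ?c (w t * h n t)) = w t * \<bar>g t - h n t\<bar>"
          unfolding of_real_diff[symmetric] norm_of_real right_diff_distrib[symmetric]
          using w(1)[OF t] by (simp add: abs_mult)
        ultimately show "norm (?c (w t * g t) - ?c (w t * h n t)) \<le> norm (2 * ?c (w t))"
          using w(1)[OF t] by (simp add: norm_mult mult.commute)
      qed
      show "AE t in rplus. (\<lambda>n. ?c (w t * g t) - ?c (w t * h n t)) \<longlonglongrightarrow> 0"
      proof (rule AE_rplus_I)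
        fix t :: real assume t: "t > 0"
        have "(\<lambda>n. ?c (w t * g t) - ?c (w t * h n t)) \<longlonglongrightarrow> ?c (w t * g t) - ?c (w t * g t)"
          by (intro tendsto_intros l t)
        then show "(\<lambda>n. ?c (w t * g t) - ?c (w t * h n t)) \<longlonglongrightarrow> 0" by simp
      qed
    qed
  qed
  have ray: "(\<lambda>t. ?c (w t * indicator {x<..} t)) \<in> X" for x :: real
  proof (cases "x > 0")
    case False
    then show ?thesis
      using p by (intro closed_subspace_cong_AE[OF _ wX] AE_rplus_I) (auto simp: indicator_def)
  next
    case True
    \<comment> \<open>Ramps of slope n below the level u x. As \<open>u\<close> decreases strictly,
      u t < u x holds exactly for t > x, and there the ramps are eventually 1.\<close>
    define \<phi> where "\<phi> n y = min 1 (max 0 (real n * (u x - y)))" for n y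
    show ?thesis
    proof (rule lim[where h = "\<lambda>n t. \<phi> n (u t)"])
      show "(\<lambda>t. ?c (w t * \<phi> n (u t))) \<in> X" for n
        by (rule cont) (auto simp: \<phi>_def intro!: continuous_intros)
      show "\<bar>\<phi> n (u t)\<bar> \<le> 1" for n t by (auto simp: \<phi>_def)
      fix t :: real assume t: "t > 0"
      show "(\<lambda>n. \<phi> n (u t)) \<longlonglongrightarrow> indicator {x<..} t"
      proof (cases "t > x")
        case tx: True
        then have "u x - u t > 0" using u(2)[of x t] True by simp
        then obtain N :: nat where N: "1 < real N * (u x - u t)" using ex_less_of_nat_mult by blast
        have "\<phi> n (u t) = 1" if "n \<ge> N" for n
        proof -
          have "1 < real n * (u x - u t)"
            by (rule less_le_trans[OF N mult_right_mono]) (use that \<open>u x - u t > 0\<close> in auto)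
          then show ?thesis by (simp add: \<phi>_def)
        qed
        then show ?thesis using tx by (intro tendsto_eventually) (auto simp: eventually_sequentially)
      next
        case tx: False
        then have "u x \<le> u t" using u(2)[of t x] t by (cases "t = x") auto
        then have "\<phi> n (u t) = 0" for n
          by (simp add: \<phi>_def max_def mult_le_0_iff) (use mult_nonneg_nonpos[of "real n" "u x - u t"] in auto)
        then show ?thesis using tx by simp
      qed
    qed measurable
  qed
  have ind: "(\<lambda>t. ?c (w t * indicator B t)) \<in> X" if "B \<in> sets borel" for B :: "real set"
  proof -
    have sb: "sets borel = sigma_sets UNIV (range (\<lambda>x::real. {x<..}))"
      by (subst borel_Ioi) (rule sets_measure_of, simp)
    have st: "Int_stable (range (\<lambda>x::real. {x<..}))"
    proof (rule Int_stableI)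
      fix A B :: "real set" assume "A \<in> range (\<lambda>x. {x<..})" "B \<in> range (\<lambda>x. {x<..})"
      then obtain x y where "A = {x<..}" "B = {y<..}" by auto
      then have "A \<inter> B = {max x y<..}" by auto
      then show "A \<inter> B \<in> range (\<lambda>x. {x<..})" by blast
    qed
    have pw: "range (\<lambda>x::real. {x<..}) \<subseteq> Pow UNIV" by simp
    from st pw that[unfolded sb] show ?thesis
    proof (induction rule: sigma_sets_induct_disjoint)
      case (basic A)
      then show ?case using ray by auto
    next
      case empty
      then show ?case using closed_subspace_scale[OF wX, of 0] by simp
    next
      case (compl A)
      have "(\<lambda>t. ?c (w t * indicator (UNIV - A) t)) = (\<lambda>t. ?c (w t) - ?c (w t * indicator A t))"
        by (auto simp: indicator_def fun_eq_iff)
      then show ?case using closed_subspace_diff[OF wX compl(2)] by simp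
    next
      case (union A)
      then have Am: "A i \<in> sets borel" for i unfolding sb by auto
      then have [measurable]: "(\<Union>i. A i) \<in> sets borel" by auto
      show ?case
      \<comment> \<open>Disjointness makes each partial sum the indicator of a finite union, hence
        bounded by 1 as \<open>lim\<close> demands.\<close>
      proof (rule lim[where h = "\<lambda>n t. \<Sum>i<n. indicator (A i) t"])
        have "(\<lambda>t. \<Sum>i<n. ?c (w t * indicator (A i) t)) \<in> X" for n
          by (intro closed_subspace_sum[OF _ wX] union) auto
        then show "(\<lambda>t. ?c (w t * (\<Sum>i<n. indicator (A i) t))) \<in> X" for n
          by (simp only: sum_distrib_left of_real_sum)
        have su: "(\<Sum>i<n. indicator (A i) t) = (indicator (\<Union>i<n. A i) t :: real)" for n t
          using union(1) by (subst indicator_UN_disjoint) (auto intro: disjoint_family_on_mono)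
        show "\<bar>\<Sum>i<n. indicator (A i) t\<bar> \<le> (1::real)" for n t
          unfolding su by (auto simp: indicator_def)
        show "(\<lambda>n. \<Sum>i<n. indicator (A i) t) \<longlonglongrightarrow> (indicator (\<Union>i. A i) t :: real)" for t
          unfolding su by (rule LIMSEQ_indicator_UN)
      qed measurable
    qed
  qed
  have simple: "(\<lambda>t. ?c (w t) * s t) \<in> X" if s: "simple_function rplus s" for s :: "real \<Rightarrow> complex"
  proof -
    define A where "A y = s -` {y} \<inter> space rplus" for y
    have "A y \<in> sets rplus" for y unfolding A_def using s by (rule simple_functionD)
    then have "A y \<in> sets borel" for y
      unfolding rplus_def by (subst (asm) sets_restrict_space_iff) auto
    then have "(\<lambda>t. \<Sum>y\<in>s ` space rplus. y * ?c (w t * indicator (A y) t)) \<in> X"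
      using simple_functionD(1)[OF s] by (intro closed_subspace_sum[OF _ wX] closed_subspace_scale ind) auto
    moreover have "(\<lambda>t. ?c (w t) * s t) \<in> borel_measurable rplus"
      using borel_measurable_simple_function[OF s] by measurable
    moreover have "?c (w t) * s t = (\<Sum>y\<in>s ` space rplus. y * ?c (w t * indicator (A y) t))" if "t > 0" for t
    proof -
      have "s t = (\<Sum>y\<in>s ` space rplus. indicator (A y) t *\<^sub>R y)"
        unfolding A_def using that by (intro simple_function_indicator_representation_banach s) auto
      then show ?thesis
        by (simp add: sum_distrib_left scaleR_conv_of_real mult_ac)
    qed
    ultimately show ?thesis using p by (elim closed_subspace_cong_AE[rotated]) (auto intro: AE_rplus_I)
  qed
  have fm [measurable]: "f \<in> borel_measurable rplus" by (rule Lp_measurable[OF f])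
  \<comment> \<open>Simple approximants of f / w can be taken with norm at most 2 |f / w|.
    Multiplied by w they are dominated by 2 |f|, which explains the majorant 3 f below.\<close>
  have "(\<lambda>t. f t / ?c (w t)) \<in> borel_measurable rplus" by measurable
  from borel_measurable_implies_sequence_metric[OF this, of 0]
  obtain s where s': "\<forall>i. simple_function rplus (s i)"
    "\<forall>t\<in>space rplus. (\<lambda>i. s i t) \<longlonglongrightarrow> f t / ?c (w t)"
    "\<forall>i. \<forall>t\<in>space rplus. dist (s i t) 0 \<le> 2 * dist (f t / ?c (w t)) 0" by blast
  then have s: "\<And>i. simple_function rplus (s i)"
    "\<And>t. t > 0 \<Longrightarrow> (\<lambda>i. s i t) \<longlonglongrightarrow> f t / ?c (w t)"
    "\<And>i t. t > 0 \<Longrightarrow> norm (s i t) \<le> 2 * norm (f t / ?c (w t))"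
    by (simp_all only: dist_0_norm dist_commute[of _ "0::complex"] space_rplus greaterThan_iff Ball_def)
  show ?thesis
  proof (rule closed_subspace_limit[OF f simple[OF s(1)]], rule Lp_dominated[OF p])
    show "(\<lambda>t. 3 * f t) \<in> Lp p" by (intro Lp_scale f)
    show "(\<lambda>t. f t - ?c (w t) * s n t) \<in> borel_measurable rplus" for n
      using borel_measurable_simple_function[OF s(1)] by measurable
    show "AE t in rplus. norm (f t - ?c (w t) * s n t) \<le> norm (3 * f t)" for n
    proof (rule AE_rplus_I)
      fix t :: real assume t: "t > 0"
      have "norm (f t - ?c (w t) * s n t) \<le> norm (f t) + norm (?c (w t) * s n t)"
        by (rule norm_triangle_ineq4)
      also have "norm (?c (w t) * s n t) \<le> w t * (2 * norm (f t / ?c (w t)))"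
        using s(3)[OF t, of n] w(1)[OF t] by (simp add: norm_mult)
      also have "\<dots> = 2 * norm (f t)" using w(1)[OF t] by (simp add: norm_divide)
      finally show "norm (f t - ?c (w t) * s n t) \<le> norm (3 * f t)" by (simp add: norm_mult)
    qed
    show "AE t in rplus. (\<lambda>n. f t - ?c (w t) * s n t) \<longlonglongrightarrow> 0"
    proof (rule AE_rplus_I)
      fix t :: real assume t: "t > 0"
      have "(\<lambda>n. f t - ?c (w t) * s n t) \<longlonglongrightarrow> f t - ?c (w t) * (f t / ?c (w t))"
        by (intro tendsto_intros s t)
      then show "(\<lambda>n. f t - ?c (w t) * s n t) \<longlonglongrightarrow> 0" using w(1)[OF t] by simp
    qed
  qed
qed

end

subsection \<open>Integral operators with homogeneous kernels\<close>

lemma measurable_rplus_pair: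
  "f \<in> borel_measurable (borel \<Otimes>\<^sub>M borel) \<Longrightarrow> f \<in> borel_measurable (rplus \<Otimes>\<^sub>M rplus)"
proof -
  assume f: "f \<in> borel_measurable (borel \<Otimes>\<^sub>M borel)"
  have [measurable]: "(\<lambda>t. t) \<in> measurable rplus borel" by simp
  have "(\<lambda>x. (fst x, snd x)) \<in> measurable (rplus \<Otimes>\<^sub>M rplus) (borel \<Otimes>\<^sub>M borel)"
    by (intro measurable_Pair measurable_compose[OF measurable_fst] measurable_compose[OF measurable_snd]) auto
  from measurable_compose[OF this f] show ?thesis by simp
qed

lemma fst_snd_rplus_borel [measurable]:
  "fst \<in> borel_measurable (rplus \<Otimes>\<^sub>M rplus)" "snd \<in> borel_measurable (rplus \<Otimes>\<^sub>M rplus)"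
  by (auto intro: measurable_rplus_pair)

lemma measurable_mult_rplus: "(\<lambda>x. fst x * snd x) \<in> measurable (rplus \<Otimes>\<^sub>M rplus) rplus"
proof -
  have "(\<lambda>x. fst x * snd x) \<in> borel_measurable (rplus \<Otimes>\<^sub>M rplus)"
    by (rule measurable_rplus_pair) measurable
  then show ?thesis
    unfolding rplus_def
    by (intro measurable_restrict_space2)
       (auto simp: space_pair_measure space_restrict_space)
qed

definition kernel_op :: "(real \<Rightarrow> real \<Rightarrow> real) \<Rightarrow> (real \<Rightarrow> complex) \<Rightarrow> real \<Rightarrow> complex" where
  "kernel_op K f t = (LINT s|rplus. K t s *\<^sub>R f s)"

text \<open>Jensen's inequality for t^p and the measure with density w, not normalised, whence the
  factor of total mass to the power p - 1.\<close>

lemma integral_power_Jensen: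
  fixes w x :: "'a \<Rightarrow> real"
  assumes p: "p > 1" and w: "integrable M w" "\<And>u. u \<in> space M \<Longrightarrow> w u \<ge> 0"
    and x: "x \<in> borel_measurable M" "\<And>u. u \<in> space M \<Longrightarrow> x u \<ge> 0"
    and i: "integrable M (\<lambda>u. w u * x u powr p)"
  shows "integrable M (\<lambda>u. w u * x u)"
    and "(LINT u|M. w u * x u) powr p \<le> (LINT u|M. w u) powr (p - 1) * (LINT u|M. w u * x u powr p)"
proof -
  have le: "x \<le> x powr p + 1" if "x \<ge> 0" for x :: real
  proof (cases "x \<le> 1")
    case False
    then have "x powr 1 \<le> x powr p" using p by (intro powr_mono) auto
    then show ?thesis using False by simp
  qed (use powr_ge_zero[of x p] in linarith)
  show ix: "integrable M (\<lambda>u. w u * x u)"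
  proof (rule Bochner_Integration.integrable_bound)
    show "integrable M (\<lambda>u. w u * x u powr p + w u)" using w i by auto
    show "AE u in M. norm (w u * x u) \<le> norm (w u * x u powr p + w u)"
    proof (rule AE_I2)
      fix u assume u: "u \<in> space M"
      have "w u * x u \<le> w u * (x u powr p + 1)" using le[of "x u"] w(2)[OF u] x(2)[OF u] by (intro mult_left_mono) auto
      then show "norm (w u * x u) \<le> norm (w u * x u powr p + w u)"
        using w(2)[OF u] x(2)[OF u] by (simp add: algebra_simps)
    qed
  qed (use w x in measurable)
  define J where "J = (LINT u|M. w u * x u)"
  define K where "K = (LINT u|M. w u * x u powr p)"
  define N where "N = (LINT u|M. w u)"
  have nn: "J \<ge> 0" "K \<ge> 0" "N \<ge> 0"
    unfolding J_def K_def N_def using w x by (auto intro!: integral_nonneg_AE)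
  show "J powr p \<le> N powr (p - 1) * K"
  proof (cases "J = 0")
    case False
    then have J: "J > 0" using nn by simp
    have N: "N > 0"
    proof (rule ccontr)
      assume "\<not> N > 0"
      then have "N = 0" using nn by simp
      then have "AE u in M. w u = 0"
        unfolding N_def using w by (subst (asm) integral_nonneg_eq_0_iff_AE) auto
      then have "J = (LINT u|M. 0)"
        unfolding J_def by (intro integral_cong_AE) (use w x in auto)
      with J show False by simp
    qed
    define q where "q = p / (p - 1)"
    have pq: "1 / p + 1 / q = 1" "q > 1" using p by (auto simp: q_def field_simps)
    \<comment> \<open>The weighted mean of x. Young's inequality for x u and d = c^(p-1) is the
      tangent line inequality of t^p at c, so integrating it loses nothing.\<close>
    define c where "c = J / N"
    have c: "c > 0" using J N by (simp add: c_def)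
    define d where "d = c powr (p - 1)"
    have d: "d > 0" "d powr q = c powr p" using c p by (auto simp: d_def powr_powr q_def)
    have "x u * d \<le> x u powr p / p + c powr p / q" if "u \<in> space M" for u
      using Youngs_inequality[OF p pq(2,1), of "x u" d] x(2)[OF that] d by simp
    then have "(LINT u|M. w u * x u * d) \<le> (LINT u|M. w u * x u powr p / p + w u * (c powr p / q))"
    proof (intro integral_mono)
      fix u assume a: "\<And>u. u \<in> space M \<Longrightarrow> x u * d \<le> x u powr p / p + c powr p / q" "u \<in> space M"
      have "w u * (x u * d) \<le> w u * (x u powr p / p + c powr p / q)"
        using a w(2) by (intro mult_left_mono) auto
      then show "w u * x u * d \<le> w u * x u powr p / p + w u * (c powr p / q)"
        by (simp add: algebra_simps)
    qed (use ix i w in auto)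
    also have "\<dots> = K / p + N * (c powr p / q)"
      using i w by (simp add: K_def N_def)
    finally have "J * d \<le> K / p + N * (c powr p / q)" by (simp add: J_def)
    moreover have "c powr p = c * d" using c by (simp add: d_def powr_diff)
    moreover have "N * (c * d / q) = J * d / q"
    proof -
      have "N * (c * d / q) = N * c * d / q" by simp
      also have "N * c = J" using N by (simp add: c_def)
      finally show ?thesis .
    qed
    ultimately have "J * d \<le> K / p + J * d / q" by metis
    then have "J * d * (1 - 1 / q) \<le> K / p" by (simp add: algebra_simps)
    moreover have "1 - 1 / q = 1 / p" using pq by simp
    ultimately have "J * d \<le> K" using p by (simp add: divide_right_mono field_simps)
    moreover have "J powr p = J * d * N powr (p - 1)"
    proof -
      have "J powr p = J powr 1 * J powr (p - 1)" unfolding powr_add[symmetric] by simp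
      also have "J = c * N" using N by (simp add: c_def)
      then have "J powr (p - 1) = d * N powr (p - 1)" using c N by (simp add: powr_mult d_def)
      finally show ?thesis using J by simp
    qed
    ultimately show ?thesis
      using mult_right_mono[of "J * d" K "N powr (p - 1)"] by (simp add: mult.commute)
  qed (use nn p in auto)
qed

text \<open>Dilation by u, taking f to t |-> f(t u), multiplies the norm of \<open>L\<^sup>p\<close>
  by u^(-1/p). The last assumption therefore says that the superposition of dilations with weights
  K(1,u) converges absolutely in operator norm.\<close>

locale hom_kernel =
  fixes p :: real and K :: "real \<Rightarrow> real \<Rightarrow> real"
  assumes p: "p > 1"
    and meas: "(\<lambda>x. K (fst x) (snd x)) \<in> borel_measurable (rplus \<Otimes>\<^sub>M rplus)"
    and nonneg: "\<And>s t. s > 0 \<Longrightarrow> t > 0 \<Longrightarrow> K s t \<ge> 0"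
    and hom: "\<And>c s t. c > 0 \<Longrightarrow> s > 0 \<Longrightarrow> t > 0 \<Longrightarrow> K (c * s) (c * t) = K s t / c"
    and int: "integrable rplus (\<lambda>u. K 1 u * u powr (- 1 / p))"
begin

lemma meas_section [measurable]: "t > 0 \<Longrightarrow> K t \<in> borel_measurable rplus"
  using measurable_compose[OF measurable_Pair1' meas, of t] by simp

lemma K_scale: "t > 0 \<Longrightarrow> u > 0 \<Longrightarrow> t * K t (t * u) = K 1 u"
  using hom[of t 1 u] by simp

text \<open>The form of the operator in which boundedness and commutation become visible. A
  divergent integral is covered as well, both sides then being 0.\<close>

lemma kernel_op_dilation:
  assumes t: "t > 0"
  shows "kernel_op K f t = (LINT u|rplus. K 1 u *\<^sub>R f (t * u))"
proof -
  have "kernel_op K f t = t *\<^sub>R (LINT u|rplus. K t (t * u) *\<^sub>R f (t * u))"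
    unfolding kernel_op_def by (rule integral_rplus_scale'[OF t])
  also have "\<dots> = (LINT u|rplus. t *\<^sub>R (K t (t * u) *\<^sub>R f (t * u)))" by (simp only: integral_scaleR_right)
  also have "\<dots> = (LINT u|rplus. K 1 u *\<^sub>R f (t * u))"
    using K_scale[OF t] by (intro Bochner_Integration.integral_cong) auto
  finally show ?thesis .
qed

lemma kernel_op_measurable:
  assumes [measurable]: "f \<in> borel_measurable rplus"
  shows "kernel_op K f \<in> borel_measurable rplus"
proof -
  have "(\<lambda>x. K (fst x) (snd x) *\<^sub>R f (snd x)) \<in> borel_measurable (rplus \<Otimes>\<^sub>M rplus)"
    using meas by measurable
  then show ?thesis
    unfolding kernel_op_def by (intro rplus.borel_measurable_lebesgue_integral) (simp add: case_prod_beta')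
qed

definition bnd :: real where "bnd = (LINT u|rplus. K 1 u * u powr (- 1 / p))"

text \<open>Minkowski's integral inequality in substance: dilation by u divides the modular by u,
  and Jensen's inequality with the weight \<open>w\<close> replaces the triangle inequality for a
  superposition. The constant is the p-th power of \<open>bnd\<close>.\<close>

lemma bounded:
  assumes f: "f \<in> Lp p"
  shows kernel_op_AE_integrable: "AE t in rplus. integrable rplus (\<lambda>u. K 1 u *\<^sub>R f (t * u))"
    and kernel_op_Lp: "kernel_op K f \<in> Lp p"
    and kernel_op_modular_le: "Lp_modular p (kernel_op K f) \<le> bnd powr (p - 1) * bnd * Lp_modular p f"
proof -
  have fm [measurable]: "f \<in> borel_measurable rplus" by (rule Lp_measurable[OF f])
  note [measurable] = meas_section[of 1, simplified] measurable_mult_rplus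
  define w where "w u = K 1 u * u powr (- 1 / p)" for u
  have [measurable]: "w \<in> borel_measurable rplus" unfolding w_def by measurable
  have wnn: "w u \<ge> 0" if "u > 0" for u using nonneg[of 1 u] that by (simp add: w_def)
  have wi: "integrable rplus w" using int by (simp add: w_def[abs_def])
  have fm2 [measurable]: "(\<lambda>z. f (fst z * snd z)) \<in> borel_measurable (rplus \<Otimes>\<^sub>M rplus)"
    by (rule measurable_compose[OF measurable_mult_rplus fm])
  \<comment> \<open>A majorant, up to a constant, of the p-th power of the operator at t. Tonelli
    computes its integral; where it is finite, the defining integral converges.\<close>
  define \<Phi> where "\<Phi> t = (\<integral>\<^sup>+u. ennreal (w u * u * norm (f (t * u)) powr p) \<partial>rplus)" for t
  have [measurable]: "\<Phi> \<in> borel_measurable rplus"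
    unfolding \<Phi>_def by (rule rplus.borel_measurable_nn_integral) (simp add: case_prod_beta')
  have "(\<integral>\<^sup>+t. \<Phi> t \<partial>rplus) = (\<integral>\<^sup>+u. \<integral>\<^sup>+t. ennreal (w u * u * norm (f (t * u)) powr p) \<partial>rplus \<partial>rplus)"
    unfolding \<Phi>_def by (rule rplus2.Fubini'[symmetric]) (simp add: case_prod_beta')
  also have "\<dots> = (\<integral>\<^sup>+u. ennreal (w u * Lp_modular p f) \<partial>rplus)"
  proof (rule nn_integral_cong)
    fix u assume "u \<in> space rplus"
    then have u: "u > 0" by simp
    have "(\<integral>\<^sup>+t. ennreal (w u * u * norm (f (t * u)) powr p) \<partial>rplus)
        = (\<integral>\<^sup>+t. ennreal (w u) * (ennreal u * ennreal (norm (f (u * t)) powr p)) \<partial>rplus)"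
      using u wnn[OF u] by (intro nn_integral_cong) (simp add: ennreal_mult[symmetric] mult_ac)
    also have "\<dots> = ennreal (w u) * (ennreal u * (\<integral>\<^sup>+t. ennreal (norm (f (u * t)) powr p) \<partial>rplus))"
      using measurable_compose_scale[OF u fm] by (simp add: nn_integral_cmult)
    also have "ennreal u * (\<integral>\<^sup>+t. ennreal (norm (f (u * t)) powr p) \<partial>rplus)
        = (\<integral>\<^sup>+t. ennreal (norm (f t) powr p) \<partial>rplus)"
      using u by (intro nn_integral_rplus_scale[symmetric]) auto
    also have "\<dots> = ennreal (Lp_modular p f)"
      unfolding Lp_modular_def using Lp_integrable[OF f] by (intro nn_integral_eq_integral) auto
    finally show "(\<integral>\<^sup>+t. ennreal (w u * u * norm (f (t * u)) powr p) \<partial>rplus) = ennreal (w u * Lp_modular p f)"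
      using wnn[OF u] by (simp add: ennreal_mult Lp_modular_nonneg)
  qed
  also have "\<dots> = ennreal (bnd * Lp_modular p f)"
  proof -
    have "(\<integral>\<^sup>+u. ennreal (w u * Lp_modular p f) \<partial>rplus) = ennreal (LINT u|rplus. w u * Lp_modular p f)"
      using wi wnn Lp_modular_nonneg by (intro nn_integral_eq_integral) auto
    then show ?thesis by (simp add: bnd_def w_def)
  qed
  finally have I\<Phi>: "(\<integral>\<^sup>+t. \<Phi> t \<partial>rplus) = ennreal (bnd * Lp_modular p f)" .
  then have AE\<Phi>: "AE t in rplus. \<Phi> t \<noteq> \<infinity>" by (intro nn_integral_PInf_AE) auto
  have pt: "integrable rplus (\<lambda>u. K 1 u *\<^sub>R f (t * u)) \<and>
      ennreal (norm (kernel_op K f t) powr p) \<le> ennreal (bnd powr (p - 1)) * \<Phi> t"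
    if t: "t > 0" and fin: "\<Phi> t \<noteq> \<infinity>" for t
  proof -
    note [measurable] = measurable_compose_scale[OF t fm]
    \<comment> \<open>This takes back the factor u^(-1/p) put into \<open>w\<close>, so that w x =
      K(1,u) |f(t u)|. Its p-th power u |f(t u)|^p has the same integral over t for every u.\<close>
    define x where "x u = u powr (1 / p) * norm (f (t * u))" for u
    have [measurable]: "x \<in> borel_measurable rplus" unfolding x_def by measurable
    have xp: "x u powr p = u * norm (f (t * u)) powr p" if "u > 0" for u
      using that p by (simp add: x_def powr_mult powr_powr)
    have wx: "w u * x u = K 1 u * norm (f (t * u))" if "u > 0" for u
    proof -
      have "u powr (- 1 / p) * u powr (1 / p) = 1"
        using that unfolding powr_add[symmetric] by simp
      then show ?thesis by (simp add: w_def x_def)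
    qed
    have \<Phi>x: "\<Phi> t = (\<integral>\<^sup>+u. ennreal (w u * x u powr p) \<partial>rplus)"
      unfolding \<Phi>_def using xp by (intro nn_integral_cong) (auto simp: mult.assoc)
    have ip: "integrable rplus (\<lambda>u. w u * x u powr p)"
      using fin wnn unfolding \<Phi>x by (intro integrableI_nonneg) (auto simp: less_top[symmetric] intro!: AE_rplus_I)
    have J: "integrable rplus (\<lambda>u. w u * x u)"
      "(LINT u|rplus. w u * x u) powr p \<le> (LINT u|rplus. w u) powr (p - 1) * (LINT u|rplus. w u * x u powr p)"
      using integral_power_Jensen[OF p wi _ _ _ ip] wnn by (auto simp: x_def)
    have "integrable rplus (\<lambda>u. K 1 u * norm (f (t * u)))"
      using J(1) by (rule integrable_rplus_cong) (use wx in auto)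
    then have ik: "integrable rplus (\<lambda>u. K 1 u *\<^sub>R f (t * u))"
      by (rule Bochner_Integration.integrable_bound) (use nonneg in \<open>auto intro!: AE_rplus_I simp: abs_mult\<close>)
    have "norm (kernel_op K f t) \<le> (LINT u|rplus. norm (K 1 u *\<^sub>R f (t * u)))"
      unfolding kernel_op_dilation[OF t] by (rule integral_norm_bound)
    also have "\<dots> = (LINT u|rplus. w u * x u)"
      using wx nonneg by (intro Bochner_Integration.integral_cong) auto
    finally have "norm (kernel_op K f t) powr p \<le> (LINT u|rplus. w u * x u) powr p"
      using p by (intro powr_mono2) auto
    also note J(2)
    also have "(LINT u|rplus. w u) = bnd" by (simp add: bnd_def w_def)
    finally have "ennreal (norm (kernel_op K f t) powr p) \<le> ennreal (bnd powr (p - 1) * (LINT u|rplus. w u * x u powr p))"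
      by (intro ennreal_leI)
    also have "\<dots> = ennreal (bnd powr (p - 1)) * \<Phi> t"
      unfolding \<Phi>x using wnn by (subst nn_integral_eq_integral[OF ip])
        (auto intro!: AE_rplus_I ennreal_mult integral_nonneg_AE)
    finally show ?thesis using ik by blast
  qed
  have AEpos: "AE t in rplus. t > 0" by (rule AE_rplus_I)
  show "AE t in rplus. integrable rplus (\<lambda>u. K 1 u *\<^sub>R f (t * u))"
    using AEpos AE\<Phi> by eventually_elim (use pt in blast)
  have bnn: "bnd \<ge> 0" unfolding bnd_def using nonneg by (intro integral_nonneg_AE AE_rplus_I) auto
  have "(\<integral>\<^sup>+t. ennreal (norm (kernel_op K f t) powr p) \<partial>rplus) \<le> (\<integral>\<^sup>+t. ennreal (bnd powr (p - 1)) * \<Phi> t \<partial>rplus)"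
    by (rule nn_integral_mono_AE, use AEpos AE\<Phi> in eventually_elim) (use pt in blast)
  also have "\<dots> = ennreal (bnd powr (p - 1) * bnd * Lp_modular p f)"
    by (simp add: nn_integral_cmult I\<Phi> ennreal_mult[symmetric] Lp_modular_nonneg bnn mult.assoc)
  finally have le: "(\<integral>\<^sup>+t. ennreal (norm (kernel_op K f t) powr p) \<partial>rplus) \<le> ennreal (bnd powr (p - 1) * bnd * Lp_modular p f)" .
  note [measurable] = kernel_op_measurable[OF fm]
  have i: "integrable rplus (\<lambda>t. norm (kernel_op K f t) powr p)"
    using le by (intro integrableI_nonneg) (auto simp: less_top[symmetric] top_unique)
  then show "kernel_op K f \<in> Lp p" using kernel_op_measurable[OF fm] by (simp add: Lp_def)
  have "ennreal (Lp_modular p (kernel_op K f)) \<le> ennreal (bnd powr (p - 1) * bnd * Lp_modular p f)"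
    using le unfolding Lp_modular_def[of p "kernel_op K f"] by (subst nn_integral_eq_integral[OF i, symmetric]) auto
  then show "Lp_modular p (kernel_op K f) \<le> bnd powr (p - 1) * bnd * Lp_modular p f"
    using bnn Lp_modular_nonneg by (subst (asm) ennreal_le_iff) auto
qed

lemma kernel_op_AE_integrable':
  assumes f: "f \<in> Lp p"
  shows "AE t in rplus. integrable rplus (\<lambda>s. K t s *\<^sub>R f s)"
  using kernel_op_AE_integrable[OF f] AE_rplus_pos
proof eventually_elim
  case (elim t)
  have "integrable rplus (\<lambda>s. K 1 (1 / t * s) *\<^sub>R f (t * (1 / t * s)))"
    by (rule integral_rplus_scale(2)) (use elim in auto)
  then have "integrable rplus (\<lambda>s. (1 / t) *\<^sub>R (K 1 (1 / t * s) *\<^sub>R f (t * (1 / t * s))))" by (rule integrable_scaleR_right)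
  then show ?case
    by (rule integrable_rplus_cong)
       (use elim K_scale[of t "s / t" for s] in \<open>auto simp: field_simps\<close>)
qed

lemma kernel_op_cong_AE:
  assumes "AE t in rplus. f t = g t" "t > 0" "f \<in> borel_measurable rplus" "g \<in> borel_measurable rplus"
  shows "kernel_op K f t = kernel_op K g t"
  unfolding kernel_op_def
proof (rule integral_cong_AE)
  show "AE s in rplus. K t s *\<^sub>R f s = K t s *\<^sub>R g s" using assms(1) by eventually_elim simp
qed (use assms meas_section in auto)

lemma kernel_op_diff_AE:
  assumes "f \<in> Lp p" "g \<in> Lp p"
  shows "AE t in rplus. kernel_op K (\<lambda>s. f s - g s) t = kernel_op K f t - kernel_op K g t"
  using kernel_op_AE_integrable'[OF assms(1)] kernel_op_AE_integrable'[OF assms(2)]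
  by eventually_elim (simp add: kernel_op_def algebra_simps)

lemma kernel_op_add_AE:
  assumes "f \<in> Lp p" "g \<in> Lp p"
  shows "AE t in rplus. kernel_op K (\<lambda>s. f s + g s) t = kernel_op K f t + kernel_op K g t"
  using kernel_op_AE_integrable'[OF assms(1)] kernel_op_AE_integrable'[OF assms(2)]
  by eventually_elim (simp add: kernel_op_def algebra_simps)

lemma kernel_op_scale: "kernel_op K (\<lambda>s. c * f s) t = c * kernel_op K f t"
  by (simp add: kernel_op_def flip: integral_mult_right_zero)

lemma kernel_op_limit:
  assumes f: "f \<in> Lp p" "\<And>n::nat. g n \<in> Lp p" and l: "(\<lambda>n. Lp_modular p (\<lambda>t. g n t - f t)) \<longlonglongrightarrow> 0"
  shows "(\<lambda>n. Lp_modular p (\<lambda>t. kernel_op K (g n) t - kernel_op K f t)) \<longlonglongrightarrow> 0"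
proof (rule tendsto_sandwich[OF _ _ tendsto_const])
  have d: "(\<lambda>t. g n t - f t) \<in> Lp p" for n using p by (intro Lp_diff f) auto
  show "(\<lambda>n. bnd powr (p - 1) * bnd * Lp_modular p (\<lambda>t. g n t - f t)) \<longlonglongrightarrow> 0"
    using tendsto_mult_right_zero[OF l] by simp
  have "Lp_modular p (\<lambda>t. kernel_op K (g n) t - kernel_op K f t) = Lp_modular p (kernel_op K (\<lambda>t. g n t - f t))" for n
  proof (rule Lp_modular_cong_AE)
    show "AE t in rplus. kernel_op K (g n) t - kernel_op K f t = kernel_op K (\<lambda>t. g n t - f t) t"
      using kernel_op_diff_AE[OF f(2,1), of n] by eventually_elim simp
    show "kernel_op K (\<lambda>t. g n t - f t) \<in> borel_measurable rplus"
      by (intro kernel_op_measurable Lp_measurable[OF d])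
    show "(\<lambda>t. kernel_op K (g n) t - kernel_op K f t) \<in> borel_measurable rplus"
      using kernel_op_measurable f[THEN Lp_measurable] by (intro borel_measurable_diff) auto
  qed
  then show "\<forall>\<^sub>F n in sequentially. Lp_modular p (\<lambda>t. kernel_op K (g n) t - kernel_op K f t) \<le> bnd powr (p - 1) * bnd * Lp_modular p (\<lambda>t. g n t - f t)"
    using kernel_op_modular_le[OF d] by simp
qed (auto simp: Lp_modular_nonneg)

lemma Lp_norm_fun: "f \<in> Lp p \<Longrightarrow> (\<lambda>t. complex_of_real (norm (f t))) \<in> Lp p"
  by (auto simp: Lp_def)

text \<open>Absolute convergence for f is expressed through the operator applied to |f|, which is
  again in \<open>Lp p\<close>. This supplies the finiteness needed in the two applications of
  Fubini below.\<close>

lemma kernel_op_norm: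
  fixes f :: "real \<Rightarrow> complex"
  assumes "t > 0" "integrable rplus (\<lambda>u. K 1 u *\<^sub>R f (t * u))"
  shows "(\<integral>\<^sup>+u. ennreal (K 1 u * norm (f (t * u))) \<partial>rplus) = ennreal (norm (kernel_op K (\<lambda>t. complex_of_real (norm (f t))) t))"
proof -
  have e: "norm (K 1 u *\<^sub>R f (t * u)) = K 1 u * norm (f (t * u))" if "u > 0" for u
    using nonneg[of 1 u] that by simp
  have i: "integrable rplus (\<lambda>u. K 1 u * norm (f (t * u)))"
    using integrable_norm[OF assms(2)] by (rule integrable_rplus_cong) (use e in auto)
  have nn: "0 \<le> (LINT u|rplus. K 1 u * norm (f (t * u)))"
    using nonneg by (intro integral_nonneg_AE AE_rplus_I) auto
  have "kernel_op K (\<lambda>t. complex_of_real (norm (f t))) t = (LINT u|rplus. complex_of_real (K 1 u * norm (f (t * u))))"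
    unfolding kernel_op_dilation[OF assms(1)] by (simp add: scaleR_conv_of_real)
  also have "\<dots> = complex_of_real (LINT u|rplus. K 1 u * norm (f (t * u)))"
    by (rule integral_complex_of_real)
  finally have "norm (kernel_op K (\<lambda>t. complex_of_real (norm (f t))) t) = (LINT u|rplus. K 1 u * norm (f (t * u)))"
    using nn by simp
  then show ?thesis using nonneg by (subst nn_integral_eq_integral[OF i]) (auto intro!: AE_rplus_I)
qed

text \<open>Fubini. The double integral converges absolutely because the operator applied to |f|
  lies in \<open>Lp p\<close> and hence pairs with g.\<close>

lemma kernel_op_adjoint:
  assumes f: "f \<in> Lp p" and g: "g \<in> Lp q" and q: "1 / p + 1 / q = 1"
  shows "(LINT t|rplus. kernel_op K f t * g t) = (LINT s|rplus. f s * kernel_op (\<lambda>s t. K t s) g s)"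
proof -
  note [measurable] = Lp_measurable[OF f] Lp_measurable[OF g] meas
  define F where "F t s = (K t s *\<^sub>R f s) * g t" for t s
  have m: "(\<lambda>x. F (fst x) (snd x)) \<in> borel_measurable (rplus \<Otimes>\<^sub>M rplus)"
    unfolding F_def by measurable
  let ?G = "kernel_op K (\<lambda>t. complex_of_real (norm (f t)))"
  have G: "?G \<in> Lp p" by (intro kernel_op_Lp Lp_norm_fun f)
  have "(\<integral>\<^sup>+x. ennreal (norm (F (fst x) (snd x))) \<partial>(rplus \<Otimes>\<^sub>M rplus)) = (\<integral>\<^sup>+t. \<integral>\<^sup>+s. ennreal (norm (F t s)) \<partial>rplus \<partial>rplus)"
    using m by (subst rplus.nn_integral_fst[symmetric]) auto
  also have "\<dots> = (\<integral>\<^sup>+t. ennreal (norm (?G t) * norm (g t)) \<partial>rplus)"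
  proof (rule nn_integral_cong_AE, use AE_rplus_pos kernel_op_AE_integrable[OF f] in eventually_elim)
    case (elim t)
    note [measurable] = meas_section[OF elim(1)]
      measurable_compose_scale[OF elim(1) meas_section[OF elim(1)]]
      measurable_compose_scale[OF elim(1) Lp_measurable[OF f]]
    have "(\<integral>\<^sup>+s. ennreal (norm (F t s)) \<partial>rplus) = (\<integral>\<^sup>+s. ennreal (norm (g t)) * ennreal (K t s * norm (f s)) \<partial>rplus)"
      using nonneg elim by (intro nn_integral_cong) (auto simp: F_def norm_mult ennreal_mult[symmetric] mult_ac)
    also have "\<dots> = ennreal (norm (g t)) * (\<integral>\<^sup>+s. ennreal (K t s * norm (f s)) \<partial>rplus)"
      by (rule nn_integral_cmult) measurable
    also have "(\<integral>\<^sup>+s. ennreal (K t s * norm (f s)) \<partial>rplus) = ennreal t * (\<integral>\<^sup>+u. ennreal (K t (t * u) * norm (f (t * u))) \<partial>rplus)"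
      using elim by (intro nn_integral_rplus_scale) auto
    also have "\<dots> = (\<integral>\<^sup>+u. ennreal t * ennreal (K t (t * u) * norm (f (t * u))) \<partial>rplus)"
      by (rule nn_integral_cmult[symmetric]) measurable
    also have "\<dots> = (\<integral>\<^sup>+u. ennreal (K 1 u * norm (f (t * u))) \<partial>rplus)"
    proof (rule nn_integral_cong)
      fix u assume "u \<in> space rplus"
      then have u: "u > 0" by simp
      show "ennreal t * ennreal (K t (t * u) * norm (f (t * u))) = ennreal (K 1 u * norm (f (t * u)))"
        using K_scale[OF elim(1) u] elim(1) nonneg u by (simp add: ennreal_mult'[symmetric] mult.assoc[symmetric])
    qed
    also have "\<dots> = ennreal (norm (?G t))" by (rule kernel_op_norm[OF elim])
    finally show ?case by (simp add: ennreal_mult mult.commute)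
  qed
  also have "\<dots> < \<infinity>"
    using Lp_pairing(2)[OF p q G g] by (subst nn_integral_eq_integral) auto
  finally have i: "integrable (rplus \<Otimes>\<^sub>M rplus) (\<lambda>x. F (fst x) (snd x))"
    using m by (intro integrableI_bounded) auto
  then have i': "integrable (rplus \<Otimes>\<^sub>M rplus) (case_prod F)" by (simp add: case_prod_beta')
  have "(LINT s|rplus. LINT t|rplus. F t s) = (LINT t|rplus. LINT s|rplus. F t s)"
    by (rule rplus2.Fubini_integral[OF i'])
  moreover have "(LINT s|rplus. F t s) = kernel_op K f t * g t" for t
    unfolding F_def kernel_op_def by (rule integral_mult_left_zero)
  moreover have "(LINT t|rplus. F t s) = f s * kernel_op (\<lambda>s t. K t s) g s" for s
  proof -
    have "(LINT t|rplus. F t s) = (LINT t|rplus. f s * (K t s *\<^sub>R g t))"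
      by (intro Bochner_Integration.integral_cong) (auto simp: F_def mult_ac)
    then show ?thesis unfolding kernel_op_def by (simp only: integral_mult_right_zero)
  qed
  ultimately show ?thesis by simp
qed

end

text \<open>At a fixed t both compositions are iterated integrals of K(1,u) L(1,v) f(t u v), in the
  two orders. Fubini applies at each t where the integral of K against L applied to |f| converges,
  that is, almost everywhere.\<close>

lemma kernel_op_commute:
  assumes "hom_kernel p K" "hom_kernel p L" and f: "f \<in> Lp p"
  shows "AE t in rplus. kernel_op K (kernel_op L f) t = kernel_op L (kernel_op K f) t"
proof -
  interpret K: hom_kernel p K by fact
  interpret L: hom_kernel p L by fact
  have fm [measurable]: "f \<in> borel_measurable rplus" by (rule Lp_measurable[OF f])
  note [measurable] = K.meas_section[of 1, simplified] L.meas_section[of 1, simplified]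
  let ?G = "kernel_op L (\<lambda>t. complex_of_real (norm (f t)))"
  have G: "?G \<in> Lp p" by (intro L.kernel_op_Lp L.Lp_norm_fun f)
  show ?thesis
    using AE_rplus_pos K.kernel_op_AE_integrable[OF G]
  proof eventually_elim
    case (elim t)
    note t = elim(1)
    define F where "F u v = (K 1 u * L 1 v) *\<^sub>R f (t * (u * v))" for u v
    have "(\<lambda>x. f (t * (fst x * snd x))) \<in> borel_measurable (rplus \<Otimes>\<^sub>M rplus)"
      by (rule measurable_compose[OF measurable_mult_rplus measurable_compose_scale[OF t fm]])
    then have m: "(\<lambda>x. F (fst x) (snd x)) \<in> borel_measurable (rplus \<Otimes>\<^sub>M rplus)"
      unfolding F_def by measurable
    have "(\<integral>\<^sup>+x. ennreal (norm (F (fst x) (snd x))) \<partial>(rplus \<Otimes>\<^sub>M rplus)) = (\<integral>\<^sup>+u. \<integral>\<^sup>+v. ennreal (norm (F u v)) \<partial>rplus \<partial>rplus)"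
      using m by (subst rplus.nn_integral_fst[symmetric]) auto
    also have "\<dots> = (\<integral>\<^sup>+u. ennreal (norm (K 1 u *\<^sub>R ?G (t * u))) \<partial>rplus)"
    \<comment> \<open>The L-integral converges at almost every point, and dilations preserve null
      sets, so it converges at t u for almost every u.\<close>
    proof (rule nn_integral_cong_AE,
        use AE_rplus_pos AE_rplus_scale[OF t L.kernel_op_AE_integrable[OF f]] in eventually_elim)
      case (elim u)
      note u = elim(1)
      have tu: "t * u > 0" using t u by simp
      have "(\<integral>\<^sup>+v. ennreal (norm (F u v)) \<partial>rplus) = (\<integral>\<^sup>+v. ennreal (K 1 u) * ennreal (L 1 v * norm (f ((t * u) * v))) \<partial>rplus)"
        using K.nonneg L.nonneg u
        by (intro nn_integral_cong) (auto simp: F_def abs_mult ennreal_mult[symmetric] mult_ac)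
      also have "\<dots> = ennreal (K 1 u) * (\<integral>\<^sup>+v. ennreal (L 1 v * norm (f ((t * u) * v))) \<partial>rplus)"
        using measurable_compose_scale[OF tu fm]
        by (intro nn_integral_cmult measurable_compose[OF _ measurable_ennreal] borel_measurable_times) auto
      also have "(\<integral>\<^sup>+v. ennreal (L 1 v * norm (f ((t * u) * v))) \<partial>rplus) = ennreal (norm (?G (t * u)))"
        by (rule L.kernel_op_norm[OF tu elim(2)])
      finally show ?case using K.nonneg u by (simp add: ennreal_mult[symmetric])
    qed
    also have "\<dots> < \<infinity>" using elim(2) by (simp add: integrable_iff_bounded)
    finally have i: "integrable (rplus \<Otimes>\<^sub>M rplus) (\<lambda>x. F (fst x) (snd x))"
      using m by (intro integrableI_bounded) auto
    then have i': "integrable (rplus \<Otimes>\<^sub>M rplus) (case_prod F)" by (simp add: case_prod_beta')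
    have "(LINT v|rplus. LINT u|rplus. F u v) = (LINT u|rplus. LINT v|rplus. F u v)"
      by (rule rplus2.Fubini_integral[OF i'])
    moreover have "(LINT u|rplus. LINT v|rplus. F u v) = kernel_op K (kernel_op L f) t"
    proof -
      have "(LINT v|rplus. F u v) = K 1 u *\<^sub>R kernel_op L f (t * u)" if "u > 0" for u
      proof -
        have "(LINT v|rplus. F u v) = (LINT v|rplus. K 1 u *\<^sub>R (L 1 v *\<^sub>R f ((t * u) * v)))"
          by (intro Bochner_Integration.integral_cong) (auto simp: F_def mult_ac)
        also have "\<dots> = K 1 u *\<^sub>R kernel_op L f (t * u)"
          using t that by (subst L.kernel_op_dilation) (auto simp only: integral_scaleR_right mult_pos_pos)
        finally show ?thesis .
      qed
      then have "(LINT u|rplus. LINT v|rplus. F u v) = (LINT u|rplus. K 1 u *\<^sub>R kernel_op L f (t * u))"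
        by (intro Bochner_Integration.integral_cong) auto
      then show ?thesis by (simp add: K.kernel_op_dilation[OF t])
    qed
    moreover have "(LINT v|rplus. LINT u|rplus. F u v) = kernel_op L (kernel_op K f) t"
    proof -
      have "(LINT u|rplus. F u v) = L 1 v *\<^sub>R kernel_op K f (t * v)" if "v > 0" for v
      proof -
        have "(LINT u|rplus. F u v) = (LINT u|rplus. L 1 v *\<^sub>R (K 1 u *\<^sub>R f ((t * v) * u)))"
          by (intro Bochner_Integration.integral_cong) (auto simp: F_def mult_ac)
        also have "\<dots> = L 1 v *\<^sub>R kernel_op K f (t * v)"
          using t that by (subst K.kernel_op_dilation) (auto simp only: integral_scaleR_right mult_pos_pos)
        finally show ?thesis .
      qed
      then have "(LINT v|rplus. LINT u|rplus. F u v) = (LINT v|rplus. L 1 v *\<^sub>R kernel_op K f (t * v))"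
        by (intro Bochner_Integration.integral_cong) auto
      then show ?thesis by (simp add: L.kernel_op_dilation[OF t])
    qed
    ultimately show ?case by simp
  qed
qed

subsection \<open>The generalized Stieltjes operator on Lebesgue spaces\<close>

lemma has_bochner_integral_rplus:
  fixes f :: "real \<Rightarrow> real"
  assumes [measurable]: "f \<in> borel_measurable borel" "A \<in> sets borel" and A: "A \<subseteq> {0..}"
    and nn: "\<And>x. x \<in> A \<Longrightarrow> 0 \<le> f x" and I: "(f has_integral I) A"
  shows "has_bochner_integral rplus (\<lambda>t. indicator A t * f t) I"
proof (rule has_bochner_integral_nn_integral)
  have "(\<integral>\<^sup>+t. ennreal (indicator A t * f t) \<partial>rplus) = (\<integral>\<^sup>+t. ennreal (indicator A t * f t) \<partial>lborel)"
    unfolding nn_integral_rplus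
  proof (rule nn_integral_cong_AE, use AE_lborel_singleton[of 0] in eventually_elim)
    case (elim t)
    then show ?case using A by (cases "t \<in> A") (auto simp: indicator_def)
  qed
  then show "(\<integral>\<^sup>+t. ennreal (indicator A t * f t) \<partial>rplus) = ennreal I"
    using nn_integral_has_integral_lebesgue[OF nn I] by simp
  show "0 \<le> I" using I nn by (rule has_integral_nonneg)
  show "AE t in rplus. 0 \<le> indicator A t * f t" using nn by (auto simp: indicator_def)
qed measurable

lemma integrable_rplus_lborel:
  fixes f :: "real \<Rightarrow> 'a::{banach, second_countable_topology}"
  shows "integrable lborel f \<Longrightarrow> integrable rplus f"
  unfolding rplus_def by (subst integrable_restrict_space) (auto intro: integrable_mult_indicator)

text \<open>Comparison with u^(x-1) near 0 and with u^(x-1-m) near infinity. The membership in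
  \<open>Lp\<close> of products of powers of t and 1 + t is reduced to this below.\<close>

lemma integrable_rplus_beta:
  assumes x: "0 < x" "x < m"
  shows "integrable rplus (\<lambda>u. u powr (x - 1) / (1 + u) powr m)"
proof (rule Bochner_Integration.integrable_bound)
  have 1: "integrable rplus (\<lambda>u. indicator {0..1} u * u powr (x - 1))"
    using has_bochner_integral_rplus[OF _ _ _ _ has_integral_powr_from_0[of "x - 1" 1], THEN integrable.intros] x by auto
  have 2: "integrable rplus (\<lambda>u. indicator {1..} u * u powr (x - 1 - m))"
    using has_bochner_integral_rplus[OF _ _ _ _ has_integral_powr_to_inf[of "x - 1 - m" 1], THEN integrable.intros] x by auto
  show "integrable rplus (\<lambda>u. indicator {0..1} u * u powr (x - 1) + indicator {1..} u * u powr (x - 1 - m))"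
    using 1 2 by simp
  show "AE u in rplus. norm (u powr (x - 1) / (1 + u) powr m)
      \<le> norm (indicator {0..1} u * u powr (x - 1) + indicator {1..} u * u powr (x - 1 - m))"
  proof (rule AE_rplus_I)
    fix u :: real assume u: "u > 0"
    have *: "u powr (x - 1) / (1 + u) powr m \<le> indicator {0..1} u * u powr (x - 1) + indicator {1..} u * u powr (x - 1 - m)"
    proof (cases "u \<le> 1")
      case True
      have "1 \<le> (1 + u) powr m" using u x by (intro ge_one_powr_ge_zero) auto
      then have "u powr (x - 1) / (1 + u) powr m \<le> u powr (x - 1) / 1" by (intro divide_left_mono) auto
      also have "\<dots> \<le> indicator {0..1} u * u powr (x - 1) + indicator {1..} u * u powr (x - 1 - m)"
        using True u by (auto simp: indicator_def)
      finally show ?thesis .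
    next
      case False
      have "u powr m \<le> (1 + u) powr m" using u x by (intro powr_mono2) auto
      then have "u powr (x - 1) / (1 + u) powr m \<le> u powr (x - 1) / u powr m" using u by (intro divide_left_mono) auto
      then show ?thesis using False u by (auto simp: powr_diff)
    qed
    then show "norm (u powr (x - 1) / (1 + u) powr m)
      \<le> norm (indicator {0..1} u * u powr (x - 1) + indicator {1..} u * u powr (x - 1 - m))"
      by (auto simp: abs_of_nonneg)
  qed
qed measurable

text \<open>The mean value theorem turns the difference quotient into z^(-a-1) with z between y and
  y + r. The third bound is then the second one for the exponent a + 1; it controls the
  differentiation of kernel sections.\<close>

lemma powr_diff_bounds:
  fixes a y r :: real
  assumes "a > 0" "y > 0" "r > 0"
  shows "0 \<le> y powr (- a) - (y + r) powr (- a)"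
    and "y powr (- a) - (y + r) powr (- a) \<le> a * r * y powr (- a - 1)"
    and "\<bar>(y powr (- a) - (y + r) powr (- a)) / (r * a) - y powr (- a - 1)\<bar> \<le> (a + 1) * r * y powr (- a - 2)"
proof -
  have mvt: "\<exists>z. y < z \<and> z < y + r \<and> y powr (- a) - (y + r) powr (- a) = a * r * z powr (- a - 1)"
    if "a > 0" "y > 0" "r > 0" for a y r :: real
  proof -
    have "\<exists>z. y < z \<and> z < y + r \<and> (y + r) powr (- a) - y powr (- a) = (y + r - y) * (- a * z powr (- a - 1))"
      using that by (intro MVT2) (auto intro!: derivative_eq_intros simp: field_simps powr_diff powr_add powr_minus)
    then show ?thesis by (auto simp: algebra_simps)
  qed
  have b2: "y powr (- a) - (y + r) powr (- a) \<le> a * r * y powr (- a - 1)" if pos: "a > 0" "y > 0" "r > 0" for a y r :: real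
  proof -
    obtain z where z: "y < z" "y powr (- a) - (y + r) powr (- a) = a * r * z powr (- a - 1)"
      using mvt[OF pos] by blast
    have "z powr (- a - 1) \<le> y powr (- a - 1)" using z pos by (intro powr_mono2') auto
    then show ?thesis unfolding z(2) using pos by (intro mult_left_mono) auto
  qed
  show "y powr (- a) - (y + r) powr (- a) \<le> a * r * y powr (- a - 1)" by (rule b2[OF assms])
  obtain z where z: "y < z" "z < y + r" "y powr (- a) - (y + r) powr (- a) = a * r * z powr (- a - 1)"
    using mvt[OF assms] by blast
  show "0 \<le> y powr (- a) - (y + r) powr (- a)" unfolding z(3) using assms by auto
  have e: "(y powr (- a) - (y + r) powr (- a)) / (r * a) = z powr (- a - 1)" unfolding z(3) using assms by simp
  have e1: "- (a + 1) = - a - 1" "- a - 1 - 1 = - a - 2" "y + (z - y) = z" by simp_all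
  have "y powr (- (a + 1)) - (y + (z - y)) powr (- (a + 1)) \<le> (a + 1) * (z - y) * y powr (- (a + 1) - 1)"
    using assms z by (intro b2) auto
  also have "\<dots> \<le> (a + 1) * r * y powr (- (a + 1) - 1)"
    using assms z by (intro mult_right_mono mult_left_mono) auto
  finally have "y powr (- a - 1) - z powr (- a - 1) \<le> (a + 1) * r * y powr (- a - 2)"
    by (simp only: e1)
  moreover have "z powr (- a - 1) \<le> y powr (- a - 1)" using z assms by (intro powr_mono2') auto
  ultimately show "\<bar>(y powr (- a) - (y + r) powr (- a)) / (r * a) - y powr (- a - 1)\<bar> \<le> (a + 1) * r * y powr (- a - 2)"
    unfolding e by linarith
qed

section \<open>Closures, annihilators and weighted approximation\<close>

lemma closure_closed_subspace:
  assumes p: "p > 0" and R: "R \<subseteq> Lp p" and add: "\<And>f g. f \<in> R \<Longrightarrow> g \<in> R \<Longrightarrow> (\<lambda>t. f t + g t) \<in> R"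
    and scale: "\<And>c f. f \<in> R \<Longrightarrow> (\<lambda>t. c * f t) \<in> R"
  shows "closed_subspace p {f \<in> Lp p. \<forall>\<epsilon>>0. \<exists>g\<in>R. Lp_modular p (\<lambda>t. f t - g t) < \<epsilon>}" (is "closed_subspace p ?X")
  unfolding closed_subspace_def
proof (intro conjI ballI allI impI)
  show "?X \<subseteq> Lp p" by auto
next
  fix f g assume f: "f \<in> ?X" and g: "g \<in> ?X"
  have "\<exists>h\<in>R. Lp_modular p (\<lambda>t. (f t + g t) - h t) < \<epsilon>" if "\<epsilon> > 0" for \<epsilon>
  proof -
    \<comment> \<open>2^p is the constant of the triangle inequality for the modular, 2 the number
      of errors.\<close>
    define e where "e = \<epsilon> / (2 powr p * 2)"
    have e: "e > 0" using that by (simp add: e_def)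
    obtain h k where h: "h \<in> R" "Lp_modular p (\<lambda>t. f t - h t) < e" and k: "k \<in> R" "Lp_modular p (\<lambda>t. g t - k t) < e"
      using f g e by blast
    have "Lp_modular p (\<lambda>t. (f t - h t) + (g t - k t)) \<le> 2 powr p * (Lp_modular p (\<lambda>t. f t - h t) + Lp_modular p (\<lambda>t. g t - k t))"
      using f g h k R p by (intro Lp_add(2) Lp_diff(1)) auto
    also have "\<dots> < 2 powr p * (e + e)" using h k by (intro mult_strict_left_mono add_strict_mono) auto
    also have "\<dots> = \<epsilon>" by (simp add: e_def)
    finally have "Lp_modular p (\<lambda>t. (f t + g t) - (h t + k t)) < \<epsilon>" by (simp add: algebra_simps)
    then show ?thesis using add[OF h(1) k(1)] by (intro bexI)
  qed
  then show "(\<lambda>t. f t + g t) \<in> ?X" using f g p by (auto intro: Lp_add(1))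
next
  fix c f assume f: "f \<in> ?X"
  have "\<exists>h\<in>R. Lp_modular p (\<lambda>t. c * f t - h t) < \<epsilon>" if "\<epsilon> > 0" for \<epsilon>
  proof -
    define e where "e = \<epsilon> / (norm c powr p + 1)"
    have e: "e > 0" using that by (simp add: e_def add_nonneg_pos)
    obtain h where h: "h \<in> R" "Lp_modular p (\<lambda>t. f t - h t) < e" using f e by blast
    have "Lp_modular p (\<lambda>t. c * (f t - h t)) = norm c powr p * Lp_modular p (\<lambda>t. f t - h t)"
      using f h R p by (intro Lp_scale(2) Lp_diff(1)) auto
    also have "\<dots> \<le> norm c powr p * e" using h by (intro mult_left_mono) auto
    also have "\<dots> < (norm c powr p + 1) * e" using e by simp
    also have "\<dots> = \<epsilon>" using powr_ge_zero[of "norm c" p] by (simp add: e_def add_nonneg_eq_0_iff)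
    finally have "Lp_modular p (\<lambda>t. c * f t - c * h t) < \<epsilon>" by (simp add: algebra_simps)
    then show ?thesis using scale[OF h(1)] by (intro bexI)
  qed
  then show "(\<lambda>t. c * f t) \<in> ?X" using f by (auto intro: Lp_scale(1))
next
  fix f assume f: "f \<in> Lp p" "\<forall>\<epsilon>>0. \<exists>g\<in>?X. Lp_modular p (\<lambda>t. f t - g t) < \<epsilon>"
  have "\<exists>h\<in>R. Lp_modular p (\<lambda>t. f t - h t) < \<epsilon>" if "\<epsilon> > 0" for \<epsilon>
  proof -
    define e where "e = \<epsilon> / (2 powr p * 2)"
    have e: "e > 0" using that by (simp add: e_def)
    obtain g where g: "g \<in> ?X" "Lp_modular p (\<lambda>t. f t - g t) < e" using f e by blast
    obtain h where h: "h \<in> R" "Lp_modular p (\<lambda>t. g t - h t) < e" using g e by blast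
    have "Lp_modular p (\<lambda>t. f t - h t) \<le> 2 powr p * (Lp_modular p (\<lambda>t. f t - g t) + Lp_modular p (\<lambda>t. g t - h t))"
      using f g h R p by (intro Lp_modular_triangle) auto
    also have "\<dots> < 2 powr p * (e + e)" using g h by (intro mult_strict_left_mono add_strict_mono) auto
    also have "\<dots> = \<epsilon>" by (simp add: e_def)
    finally show ?thesis using h by blast
  qed
  then show "f \<in> ?X" using f by auto
qed

lemma closure_superset:
  assumes "R \<subseteq> Lp p"
  shows "R \<subseteq> {f \<in> Lp p. \<forall>\<epsilon>>0. \<exists>g\<in>R. Lp_modular p (\<lambda>t. f t - g t) < \<epsilon>}"
proof
  fix g assume g: "g \<in> R"
  have "Lp_modular p (\<lambda>t. g t - g t) = 0" using Lp_zero(2)[of p] by simp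
  then have "\<forall>\<epsilon>>0. \<exists>k\<in>R. Lp_modular p (\<lambda>t. g t - k t) < \<epsilon>"
    by (intro allI impI bexI[OF _ g]) linarith
  then show "g \<in> {f \<in> Lp p. \<forall>\<epsilon>>0. \<exists>g\<in>R. Lp_modular p (\<lambda>t. f t - g t) < \<epsilon>}" using assms g by auto
qed

text \<open>Continuity of the pairing with h: first \<delta> is chosen so that the term of h in
  Young's inequality is at most e / 2, then the approximation so close that it outweighs the
  resulting \<open>C\<close>.\<close>

lemma annihilator_closed_subspace:
  assumes pq: "p > 1" "1 / p + 1 / q = 1" and h: "h \<in> Lp p"
  shows "closed_subspace q {g \<in> Lp q. (LINT t|rplus. h t * g t) = 0}" (is "closed_subspace q ?X")
  unfolding closed_subspace_def
proof (intro conjI ballI allI impI)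
  note q = conj_exponent[OF pq]
  note i = Lp_pairing(1)[OF pq h]
  show "?X \<subseteq> Lp q" by auto
  show "(\<lambda>t. f t + g t) \<in> ?X" if "f \<in> ?X" "g \<in> ?X" for f g
    using that q i[of f] i[of g] by (auto simp: distrib_left intro: Lp_add(1))
  show "(\<lambda>t. c * f t) \<in> ?X" if "f \<in> ?X" for c f
    using that by (auto simp: mult.left_commute intro: Lp_scale(1))
  fix f assume f: "f \<in> Lp q" and ap: "\<forall>\<epsilon>>0. \<exists>g\<in>?X. Lp_modular q (\<lambda>t. f t - g t) < \<epsilon>"
  have "norm (LINT t|rplus. h t * f t) \<le> e" if e: "e > 0" for e
  proof -
    define I where "I = Lp_modular p h + 1"
    have I: "I > 0" "Lp_modular p h \<le> I" using Lp_modular_nonneg[of p h] by (auto simp: I_def)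
    define \<delta> where "\<delta> = e / (2 * I)"
    have \<delta>: "\<delta> > 0" using e I by (simp add: \<delta>_def)
    obtain C where C: "C > 0" "\<And>a b. a \<ge> 0 \<Longrightarrow> b \<ge> 0 \<Longrightarrow> a * b \<le> \<delta> * a powr p + C * b powr q"
      using Young_scaled[OF pq \<delta>] by blast
    have "e / (2 * C) > 0" using e C by simp
    then obtain g where g: "g \<in> ?X" "Lp_modular q (\<lambda>t. f t - g t) < e / (2 * C)" using ap by blast
    have "(LINT t|rplus. h t * f t) = (LINT t|rplus. h t * (f t - g t))"
      using g i[of g] i[OF f] by (simp add: right_diff_distrib)
    also have "norm \<dots> \<le> \<delta> * Lp_modular p h + C * Lp_modular q (\<lambda>t. f t - g t)"
      using g q by (intro Lp_pairing_bound pq h Lp_diff f C) auto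
    also have "\<dots> \<le> e / 2 + e / 2"
    proof (rule add_mono)
      have "\<delta> * Lp_modular p h \<le> \<delta> * I" using \<delta> I by (intro mult_left_mono) auto
      also have "\<dots> = e / 2" using I by (simp add: \<delta>_def)
      finally show "\<delta> * Lp_modular p h \<le> e / 2" .
      have "C * Lp_modular q (\<lambda>t. f t - g t) \<le> C * (e / (2 * C))" using g C by (intro mult_left_mono) auto
      then show "C * Lp_modular q (\<lambda>t. f t - g t) \<le> e / 2" using C by simp
    qed
    finally show ?thesis by simp
  qed
  then have "norm (LINT t|rplus. h t * f t) \<le> 0" by (rule field_le_epsilon) simp
  then show "f \<in> ?X" using f by simp
qed

text \<open>Tailored to averages and difference quotients of step 1 / (n + 1), whose pointwise
  errors are of that order relative to one fixed function of \<open>Lp p\<close>.\<close>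

lemma closed_subspace_limit_weighted:
  assumes X: "closed_subspace p X" and p: "p > 0" and f: "f \<in> Lp p" and g: "\<And>n. g n \<in> X" and w: "w \<in> Lp p"
    and C: "\<And>n t. t > 0 \<Longrightarrow> norm (f t - g n t) \<le> C / real (Suc n) * norm (w t)"
  shows "f \<in> X"
proof (rule closed_subspace_limit[OF X f g], rule Lp_dominated[OF p])
  have gm: "g n \<in> borel_measurable rplus" for n by (rule Lp_measurable[OF closed_subspace_Lp[OF X g]])
  then show "(\<lambda>t. f t - g n t) \<in> borel_measurable rplus" for n
    using Lp_measurable[OF f] by measurable
  show "(\<lambda>t. complex_of_real C * w t) \<in> Lp p" by (intro Lp_scale w)
  show "AE t in rplus. norm (f t - g n t) \<le> norm (complex_of_real C * w t)" for n
  proof (rule AE_rplus_I)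
    fix t :: real assume t: "t > 0"
    have "norm (f t - g n t) \<le> C / real (Suc n) * norm (w t)" by (rule C[OF t])
    also have "\<dots> \<le> \<bar>C\<bar> / real (Suc n) * norm (w t)" by (intro mult_right_mono divide_right_mono) auto
    also have "\<dots> \<le> \<bar>C\<bar> / 1 * norm (w t)" by (intro mult_right_mono divide_left_mono) auto
    finally show "norm (f t - g n t) \<le> norm (complex_of_real C * w t)" by (simp add: norm_mult)
  qed
  show "AE t in rplus. (\<lambda>n. f t - g n t) \<longlonglongrightarrow> 0"
  proof (rule AE_rplus_I, rule Lim_null_comparison)
    fix t :: real assume t: "t > 0"
    show "\<forall>\<^sub>F n in sequentially. norm (f t - g n t) \<le> C * norm (w t) * (1 / real (Suc n))"
      using C[OF t] by (intro always_eventually) (auto simp: field_simps)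
    have "(\<lambda>n. C * norm (w t) * (1 / real (Suc n))) \<longlonglongrightarrow> C * norm (w t) * 0"
      by (intro tendsto_mult tendsto_const LIMSEQ_inverse_real_of_nat[unfolded inverse_eq_divide])
    then show "(\<lambda>n. C * norm (w t) * (1 / real (Suc n))) \<longlonglongrightarrow> 0" by simp
  qed
qed

lemma Lp_indicator_cbox:
  fixes g :: "real \<Rightarrow> real"
  assumes p: "p > 0" and [measurable]: "g \<in> borel_measurable borel" and g: "continuous_on {c..d} g" and c: "c > 0"
  shows "(\<lambda>t. complex_of_real (indicator {c..d} t * g t)) \<in> Lp p"
proof -
  have cg: "compact (g ` {c..d})" by (intro compact_continuous_image g) auto
  obtain B where B: "\<And>x. x \<in> {c..d} \<Longrightarrow> \<bar>g x\<bar> \<le> B"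
    using compact_imp_bounded[OF cg] unfolding bounded_iff by (metis imageI real_norm_def)
  have "integrable rplus (indicator {c..d} :: real \<Rightarrow> real)"
    by (intro integrable_rplus_lborel integrable_real_indicator) (auto simp: emeasure_lborel_Icc_eq)
  then have "integrable rplus (\<lambda>t. indicator {c..d} t * \<bar>B\<bar> powr p)" by simp
  then have "integrable rplus (\<lambda>t. norm (complex_of_real (indicator {c..d} t * g t)) powr p)"
  proof (rule Bochner_Integration.integrable_bound)
    show "AE t in rplus. norm (norm (complex_of_real (indicator {c..d} t * g t)) powr p)
        \<le> norm (indicator {c..d} t * \<bar>B\<bar> powr p)"
    proof (rule AE_rplus_I)
      fix t
      show "norm (norm (complex_of_real (indicator {c..d} t * g t)) powr p) \<le> norm (indicator {c..d} t * \<bar>B\<bar> powr p)"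
      proof (cases "t \<in> {c..d}")
        case True
        then have "\<bar>g t\<bar> powr p \<le> \<bar>B\<bar> powr p" using B[OF True] p by (intro powr_mono2) auto
        then show ?thesis using True by simp
      qed (use p in simp)
    qed
  qed measurable
  then show ?thesis by (auto simp: Lp_def)
qed

section \<open>The Stieltjes kernel, its transpose and the closure of its range\<close>

definition stieltjes_kernel :: "real \<Rightarrow> real \<Rightarrow> real \<Rightarrow> real \<Rightarrow> real" where
  "stieltjes_kernel b m t s = t powr (m - b) * (s powr (b - 1) / (s + t) powr m)"

lemma stieltjes_kernel_op: "stieltjes b m f = kernel_op (stieltjes_kernel b m) f"
proof
  fix t
  have "kernel_op (stieltjes_kernel b m) f t = (LINT s|rplus. t powr (m - b) *\<^sub>R ((s powr (b - 1) / (s + t) powr m) *\<^sub>R f s))"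
    unfolding kernel_op_def stieltjes_kernel_def by simp
  then show "stieltjes b m f t = kernel_op (stieltjes_kernel b m) f t"
    unfolding stieltjes_def by (simp only: integral_scaleR_right)
qed

text \<open>Exchanging t and s exchanges the exponents m - b and b - 1, which amounts to replacing b
  by m - b + 1. This is the origin of the parameter of the adjoint.\<close>

lemma stieltjes_kernel_transpose: "(\<lambda>s t. stieltjes_kernel b m t s) = stieltjes_kernel (m - b + 1) m"
  by (auto simp: stieltjes_kernel_def fun_eq_iff add.commute)

text \<open>The integrability condition is a beta integral with x = b - 1/p; the two inequalities on
  b give its convergence at 0 and at infinity.\<close>

lemma hom_kernel_stieltjes:
  assumes "p > 1" "0 < b - 1 / p" "b - 1 / p < m"
  shows "hom_kernel p (stieltjes_kernel b m)"
proof
  show "p > 1" by fact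
  show "(\<lambda>x. stieltjes_kernel b m (fst x) (snd x)) \<in> borel_measurable (rplus \<Otimes>\<^sub>M rplus)"
    unfolding stieltjes_kernel_def by measurable
  show "0 \<le> stieltjes_kernel b m s t" if "s > 0" "t > 0" for s t using that by (simp add: stieltjes_kernel_def)
  show "stieltjes_kernel b m (c * s) (c * t) = stieltjes_kernel b m s t / c" if "c > 0" "s > 0" "t > 0" for c s t
  proof -
    have "c powr (m - b) * c powr (b - 1) / c powr m = c powr (- 1)"
      unfolding powr_add[symmetric] powr_diff[symmetric] by simp
    then have e: "c powr (m - b) * c powr (b - 1) / c powr m = 1 / c" using that by (simp add: powr_minus_divide)
    have "c * t + c * s = c * (t + s)" by (simp add: algebra_simps)
    then have "stieltjes_kernel b m (c * s) (c * t) = (c powr (m - b) * c powr (b - 1) / c powr m) * stieltjes_kernel b m s t"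
      unfolding stieltjes_kernel_def using that by (simp add: powr_mult)
    then show ?thesis unfolding e by simp
  qed
  have "integrable rplus (\<lambda>u. u powr ((b - 1 / p) - 1) / (1 + u) powr m)"
    by (rule integrable_rplus_beta) (use assms in auto)
  then show "integrable rplus (\<lambda>u. stieltjes_kernel b m 1 u * u powr (- 1 / p))"
  proof (rule integrable_rplus_cong)
    fix u :: real assume "u > 0"
    have "u powr (b - 1 / p - 1) = u powr (b - 1) * u powr (- 1 / p)"
      unfolding powr_add[symmetric] by (simp add: algebra_simps)
    then show "u powr (b - 1 / p - 1) / (1 + u) powr m = stieltjes_kernel b m 1 u * u powr (- 1 / p)"
      by (simp add: stieltjes_kernel_def add.commute)
  qed
qed

context
  fixes p b m :: real
  assumes p: "p > 1" and b: "0 < b - 1 / p" "b - 1 / p < m"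
begin

interpretation S: hom_kernel p "stieltjes_kernel b m"
  by (rule hom_kernel_stieltjes[OF p b])

lemma m_pos: "m > 0" using b by linarith

text \<open>Up to a nonzero constant, t^(m-b) times the k-th derivative of (s + t)^(-m) with respect
  to s at s = c. For k = 0 it is the section of the kernel at s = c without its power of s.\<close>

definition shifted_power :: "real \<Rightarrow> nat \<Rightarrow> real \<Rightarrow> real" where
  "shifted_power c k t = t powr (m - b) * (c + t) powr (- (m + real k))"

lemma shifted_power_measurable [measurable]: "shifted_power c k \<in> borel_measurable borel"
  unfolding shifted_power_def by measurable

lemma shifted_power_Lp:
  assumes c: "c > 0" shows "(\<lambda>t. complex_of_real (shifted_power c k t)) \<in> Lp p"
proof -
  have "integrable rplus (\<lambda>u. u powr (((m - b) * p + 1) - 1) / (1 + u) powr (m * p))"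
  proof (rule integrable_rplus_beta)
    have "0 < (m - b + 1 / p) * p" using b p by (intro mult_pos_pos) auto
    also have "(m - b + 1 / p) * p = (m - b) * p + 1" using p by (simp add: algebra_simps)
    finally show "0 < (m - b) * p + 1" .
    have "1 < b * p" using b p by (simp add: field_simps)
    then show "(m - b) * p + 1 < m * p" by (simp add: algebra_simps)
  qed
  then have "integrable rplus (\<lambda>t. norm (complex_of_real (shifted_power 1 0 t)) powr p)"
    by (rule integrable_rplus_cong) (auto simp: shifted_power_def norm_mult norm_divide powr_mult powr_divide powr_powr powr_minus_divide)
  then have v1: "(\<lambda>t. complex_of_real (shifted_power 1 0 t)) \<in> Lp p" by (simp add: Lp_def)
  \<comment> \<open>c + t \<ge> d (1 + t) compares every shift with the shift 1, and the k further
    powers are bounded by c^(-k).\<close>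
  define d where "d = min c 1"
  have d: "d > 0" "d \<le> c" "d \<le> 1" using c by (auto simp: d_def)
  show ?thesis
  proof (rule Lp_mono_AE(1))
    show "(\<lambda>t. complex_of_real (d powr (- m) * c powr (- real k)) * complex_of_real (shifted_power 1 0 t)) \<in> Lp p"
      by (intro Lp_scale v1)
    show "AE t in rplus. norm (complex_of_real (shifted_power c k t)) \<le> norm (complex_of_real (d powr (- m) * c powr (- real k)) * complex_of_real (shifted_power 1 0 t))"
    proof (rule AE_rplus_I)
      fix t :: real assume t: "t > 0"
      have "d * t \<le> 1 * t" using d t by (intro mult_right_mono) auto
      then have "d * (1 + t) \<le> c + t" using d by (simp add: algebra_simps)
      then have "(c + t) powr (- m) \<le> (d * (1 + t)) powr (- m)" using d t m_pos by (intro powr_mono2') auto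
      moreover have "(c + t) powr (- real k) \<le> c powr (- real k)" using c t by (intro powr_mono2') auto
      ultimately have "(c + t) powr (- m) * (c + t) powr (- real k) \<le> (d * (1 + t)) powr (- m) * c powr (- real k)"
        by (intro mult_mono) auto
      also have "(c + t) powr (- m) * (c + t) powr (- real k) = (c + t) powr (- (m + real k))"
        unfolding powr_add[symmetric] by simp
      also have "(d * (1 + t)) powr (- m) = d powr (- m) * (1 + t) powr (- m)" using d t by (simp add: powr_mult)
      finally have "t powr (m - b) * (c + t) powr (- (m + real k)) \<le> t powr (m - b) * (d powr (- m) * (1 + t) powr (- m) * c powr (- real k))"
        by (intro mult_left_mono) auto
      then show "norm (complex_of_real (shifted_power c k t)) \<le> norm (complex_of_real (d powr (- m) * c powr (- real k)) * complex_of_real (shifted_power 1 0 t))"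
        using t c unfolding shifted_power_def norm_mult norm_of_real by (simp add: mult_ac)
    qed
  qed (use p in auto)
qed

text \<open>Equality only up to null sets, because the operator is additive only almost
  everywhere.\<close>

definition stieltjes_range :: "(real \<Rightarrow> complex) set" where
  "stieltjes_range = {g \<in> Lp p. \<exists>h\<in>Lp p. AE t in rplus. g t = kernel_op (stieltjes_kernel b m) h t}"

lemma stieltjes_range_closure:
  "closed_subspace p {f \<in> Lp p. \<forall>\<epsilon>>0. \<exists>g\<in>stieltjes_range. Lp_modular p (\<lambda>t. f t - g t) < \<epsilon>}"
proof (rule closure_closed_subspace)
  show "(\<lambda>t. f t + g t) \<in> stieltjes_range" if fg: "f \<in> stieltjes_range" "g \<in> stieltjes_range" for f g
  proof -
    obtain h k where h: "h \<in> Lp p" "AE t in rplus. f t = kernel_op (stieltjes_kernel b m) h t"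
      and k: "k \<in> Lp p" "AE t in rplus. g t = kernel_op (stieltjes_kernel b m) k t"
      using fg by (auto simp: stieltjes_range_def)
    have "AE t in rplus. f t + g t = kernel_op (stieltjes_kernel b m) (\<lambda>t. h t + k t) t"
      using h(2) k(2) S.kernel_op_add_AE[OF h(1) k(1)] by eventually_elim simp
    moreover have "(\<lambda>t. h t + k t) \<in> Lp p" using p h k by (intro Lp_add) auto
    moreover have "(\<lambda>t. f t + g t) \<in> Lp p" using p fg by (intro Lp_add) (auto simp: stieltjes_range_def)
    ultimately show ?thesis unfolding stieltjes_range_def by blast
  qed
  show "(\<lambda>t. c * f t) \<in> stieltjes_range" if f: "f \<in> stieltjes_range" for c f
  proof -
    obtain h where h: "h \<in> Lp p" "AE t in rplus. f t = kernel_op (stieltjes_kernel b m) h t"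
      using f by (auto simp: stieltjes_range_def)
    have "AE t in rplus. c * f t = kernel_op (stieltjes_kernel b m) (\<lambda>t. c * h t) t"
      using h(2) by eventually_elim (simp add: S.kernel_op_scale)
    moreover have "(\<lambda>t. c * h t) \<in> Lp p" using h by (intro Lp_scale)
    moreover have "(\<lambda>t. c * f t) \<in> Lp p" using f by (intro Lp_scale) (auto simp: stieltjes_range_def)
    ultimately show ?thesis unfolding stieltjes_range_def by blast
  qed
qed (use p in \<open>auto simp: stieltjes_range_def\<close>)

text \<open>Averages of the kernel over \<open>{c..c + r}\<close> converge to its section at \<open>c\<close> as \<open>r\<close> tends to \<open>0\<close>.\<close>

lemma stieltjes_kernel_average:
  assumes c: "c > 0" and r: "r > 0" and t: "t > 0"
  shows "norm (complex_of_real (shifted_power c 0 t) - kernel_op (stieltjes_kernel b m) (\<lambda>s. complex_of_real (indicator {c..c + r} s * (s powr (1 - b) / r))) t)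
      \<le> m / c * r * shifted_power c 0 t"
proof -
  let ?A = "{c..c + r}"
  have int: "integrable lborel (\<lambda>s. indicator ?A s * g s)" if "continuous_on ?A g" for g :: "real \<Rightarrow> real"
    using borel_integrable_atLeastAtMost'[OF that] by (simp add: set_integrable_def)
  have lb: "(LINT s|rplus. indicator ?A s * g s) = (LINT s|lborel. indicator ?A s * g s)" for g :: "real \<Rightarrow> real"
    unfolding rplus_def using c
    by (subst integral_restrict_space) (auto intro!: Bochner_Integration.integral_cong simp: indicator_def)
  define g where "g s = (s + t) powr (- m)" for s
  have gc: "continuous_on ?A g" unfolding g_def using c t by (intro continuous_intros) auto
  have const: "(LINT s|lborel. indicator ?A s * k) = r * k" for k :: real
    using r by simp
  have "kernel_op (stieltjes_kernel b m) (\<lambda>s. complex_of_real (indicator ?A s * (s powr (1 - b) / r))) t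
     = (LINT s|rplus. complex_of_real (t powr (m - b) / r * (indicator ?A s * g s)))"
    unfolding kernel_op_def
  proof (intro Bochner_Integration.integral_cong refl)
    fix s assume "s \<in> space rplus"
    then have s: "s > 0" by simp
    \<comment> \<open>The factor s^(1-b) of the input cancels the power of s in the kernel and
      leaves the plain average of (s + t)^(-m).\<close>
    have "s powr (b - 1) * s powr (1 - b) = 1" using s unfolding powr_add[symmetric] by simp
    then have "stieltjes_kernel b m t s * (indicator ?A s * (s powr (1 - b) / r)) = t powr (m - b) / r * (indicator ?A s * g s)"
      unfolding stieltjes_kernel_def g_def powr_minus_divide by (auto simp: indicator_def field_simps)
    then show "stieltjes_kernel b m t s *\<^sub>R complex_of_real (indicator ?A s * (s powr (1 - b) / r)) = complex_of_real (t powr (m - b) / r * (indicator ?A s * g s))"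
      by (simp only: scaleR_conv_of_real of_real_mult[symmetric])
  qed
  also have "\<dots> = complex_of_real (t powr (m - b) / r * (LINT s|lborel. indicator ?A s * g s))"
    unfolding integral_complex_of_real lb[symmetric] by simp
  finally have e: "kernel_op (stieltjes_kernel b m) (\<lambda>s. complex_of_real (indicator ?A s * (s powr (1 - b) / r))) t = \<dots>" .
  have v: "shifted_power c 0 t = t powr (m - b) / r * (LINT s|lborel. indicator ?A s * g c)"
    unfolding const using r by (simp add: shifted_power_def g_def)
  have D: "shifted_power c 0 t - t powr (m - b) / r * (LINT s|lborel. indicator ?A s * g s)
      = t powr (m - b) / r * (LINT s|lborel. indicator ?A s * (g c - g s))"
  proof -
    have "(LINT s|lborel. indicator ?A s * (g c - g s)) = (LINT s|lborel. indicator ?A s * g c) - (LINT s|lborel. indicator ?A s * g s)"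
      unfolding right_diff_distrib by (intro Bochner_Integration.integral_diff int gc) auto
    then show ?thesis unfolding v by (simp only: right_diff_distrib)
  qed
  have pw: "0 \<le> g c - g s \<and> g c - g s \<le> m * r * (c + t) powr (- m - 1)" if "s \<in> ?A" for s
  proof (cases "s = c")
    case False
    then have "s - c > 0" using that by auto
    from powr_diff_bounds(1,2)[OF m_pos _ this, of "c + t"] c t
    have "0 \<le> g c - g s" "g c - g s \<le> m * (s - c) * (c + t) powr (- m - 1)" by (auto simp: g_def algebra_simps)
    moreover have "m * (s - c) * (c + t) powr (- m - 1) \<le> m * r * (c + t) powr (- m - 1)"
      using that m_pos by (intro mult_right_mono mult_left_mono) auto
    ultimately show ?thesis by linarith
  qed (use m_pos r in auto)
  have "0 \<le> (LINT s|lborel. indicator ?A s * (g c - g s))"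
    using pw by (intro integral_nonneg_AE AE_I2) (auto simp: indicator_def)
  moreover have "(LINT s|lborel. indicator ?A s * (g c - g s)) \<le> (LINT s|lborel. indicator ?A s * (m * r * (c + t) powr (- m - 1)))"
    using pw gc by (intro integral_mono int continuous_intros) (auto simp: indicator_def)
  \<comment> \<open>One power of c + t is traded for c, so that the error becomes a multiple of the
    section at c itself.\<close>
  moreover have "m * r * (c + t) powr (- m - 1) \<le> m * r * ((c + t) powr (- m) / c)"
  proof -
    have "(c + t) powr (- m - 1) = (c + t) powr (- m) / (c + t)" using c t by (simp add: powr_diff)
    also have "\<dots> \<le> (c + t) powr (- m) / c" using c t by (intro divide_left_mono) auto
    finally show ?thesis using m_pos r by (intro mult_left_mono) auto
  qed
  ultimately have L: "0 \<le> (LINT s|lborel. indicator ?A s * (g c - g s))"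
    "(LINT s|lborel. indicator ?A s * (g c - g s)) \<le> r * (m * r * ((c + t) powr (- m) / c))"
    unfolding const using r mult_left_mono[of "m * r * (c + t) powr (- m - 1)" "m * r * ((c + t) powr (- m) / c)" r]
    by (auto intro: order_trans)
  have "\<bar>shifted_power c 0 t - t powr (m - b) / r * (LINT s|lborel. indicator ?A s * g s)\<bar>
      = t powr (m - b) / r * (LINT s|lborel. indicator ?A s * (g c - g s))"
    unfolding D using r L(1) by (intro abs_of_nonneg mult_nonneg_nonneg) auto
  also have "\<dots> \<le> t powr (m - b) / r * (r * (m * r * ((c + t) powr (- m) / c)))"
    using r L(2) by (intro mult_left_mono) auto
  also have "\<dots> = m / c * r * shifted_power c 0 t" using r by (simp add: shifted_power_def)
  finally show ?thesis unfolding e of_real_diff[symmetric] norm_of_real .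
qed

text \<open>Sections of the kernel are limits of averages, which lie in the range; differentiating
  in c raises k by one. With c = 1 this yields w u^k for w = t^(m-b) (1 + t)^(-m) and u = 1 / (1 +
  t). The induction is over all c at once because a difference quotient at c involves neighbouring
  points.\<close>

lemma stieltjes_dense_closure:
  assumes f: "f \<in> Lp p"
  shows "f \<in> {f \<in> Lp p. \<forall>\<epsilon>>0. \<exists>g\<in>stieltjes_range. Lp_modular p (\<lambda>t. f t - g t) < \<epsilon>}" (is "f \<in> ?X")
proof -
  note X = stieltjes_range_closure
  have RX: "g \<in> ?X" if "g \<in> stieltjes_range" for g
    by (rule subsetD[OF closure_superset that]) (auto simp: stieltjes_range_def)
  have vX: "(\<lambda>t. complex_of_real (shifted_power c k t)) \<in> ?X" if "c > 0" for c k
    using that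
  proof (induction k arbitrary: c)
    case 0
    define g where "g n = kernel_op (stieltjes_kernel b m) (\<lambda>s. complex_of_real (indicator {c..c + 1 / real (Suc n)} s * (s powr (1 - b) / (1 / real (Suc n)))))" for n
    show ?case
    proof (rule closed_subspace_limit_weighted[OF X _ shifted_power_Lp[OF 0] _ shifted_power_Lp[OF 0, of 0], where g = g and C = "m / c"])
      show "g n \<in> ?X" for n
      proof (rule RX)
        have h: "(\<lambda>s. complex_of_real (indicator {c..c + 1 / real (Suc n)} s * (s powr (1 - b) / (1 / real (Suc n))))) \<in> Lp p"
          using 0 p by (intro Lp_indicator_cbox continuous_intros) auto
        then show "g n \<in> stieltjes_range"
          unfolding stieltjes_range_def g_def using S.kernel_op_Lp[OF h] by blast
      qed
      show "norm (complex_of_real (shifted_power c 0 t) - g n t) \<le> m / c / real (Suc n) * norm (complex_of_real (shifted_power c 0 t))"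
        if t: "t > 0" for n t
      proof -
        have nv: "norm (complex_of_real (shifted_power c 0 t)) = shifted_power c 0 t" unfolding norm_of_real by (simp add: shifted_power_def)
        have "m / c / real (Suc n) * shifted_power c 0 t = m / c * (1 / real (Suc n)) * shifted_power c 0 t" by simp
        then show ?thesis
          using stieltjes_kernel_average[OF 0 _ t, of "1 / real (Suc n)"] unfolding g_def nv by (simp only:) simp
      qed
    qed (use p in auto)
  next
    case (Suc k)
    note c = Suc.prems
    define a where "a = m + real k"
    have a: "a > 0" using m_pos by (simp add: a_def)
    \<comment> \<open>The difference quotient in c with step 1 / (n + 1), divided by the factor - a
      produced by differentiating (c + t)^(-a).\<close>
    define g where "g n t = complex_of_real (1 / (1 / real (Suc n) * a)) * (complex_of_real (shifted_power c k t) - complex_of_real (shifted_power (c + 1 / real (Suc n)) k t))" for n t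
    show ?case
    proof (rule closed_subspace_limit_weighted[OF X _ shifted_power_Lp[OF c] _ shifted_power_Lp[OF c, of 0], where g = g and C = "(a + 1) * c powr (- real k - 2)"])
      show "g n \<in> ?X" for n
        unfolding g_def using c
        by (intro closed_subspace_scale[OF X] closed_subspace_diff[OF X] Suc.IH) (auto intro: add_pos_pos)
      show "norm (complex_of_real (shifted_power c (Suc k) t) - g n t) \<le> (a + 1) * c powr (- real k - 2) / real (Suc n) * norm (complex_of_real (shifted_power c 0 t))"
        if t: "t > 0" for n t
      proof -
        define r where "r = 1 / real (Suc n)"
        have r: "r > 0" by (simp add: r_def)
        have "c + r + t = c + t + r" by simp
        then have vv: "shifted_power c k t - shifted_power (c + r) k t = t powr (m - b) * ((c + t) powr (- a) - (c + t + r) powr (- a))"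
          unfolding shifted_power_def a_def by (simp only: right_diff_distrib)
        have g': "g n t = complex_of_real (t powr (m - b) * (((c + t) powr (- a) - (c + t + r) powr (- a)) / (r * a)))"
          unfolding g_def r_def[symmetric] of_real_diff[symmetric] of_real_mult[symmetric] vv by simp
        have "shifted_power c (Suc k) t = t powr (m - b) * (c + t) powr (- a - 1)"
          unfolding shifted_power_def a_def by (intro arg_cong2[where f = "(*)"] arg_cong2[where f = "(powr)"] refl) simp
        then have "norm (complex_of_real (shifted_power c (Suc k) t) - g n t)
          = t powr (m - b) * \<bar>((c + t) powr (- a) - (c + t + r) powr (- a)) / (r * a) - (c + t) powr (- a - 1)\<bar>"
          unfolding g' of_real_diff[symmetric] norm_of_real
          by (simp only: right_diff_distrib[symmetric] abs_mult abs_of_nonneg[OF powr_ge_zero])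
            (simp only: abs_minus_commute)
        also have "\<dots> \<le> t powr (m - b) * ((a + 1) * r * (c + t) powr (- a - 2))"
          using c t r a by (intro mult_left_mono powr_diff_bounds) auto
        \<comment> \<open>Only the power - m is kept as a function of t; the rest is bounded by its
          value at t = 0, so that the error is relative to \<open>shifted_power c 0\<close>.\<close>
        also have "(c + t) powr (- a - 2) = (c + t) powr (- m) * (c + t) powr (- real k - 2)"
          unfolding powr_add[symmetric] by (simp add: a_def algebra_simps)
        also have "(c + t) powr (- real k - 2) \<le> c powr (- real k - 2)" using c t by (intro powr_mono2') auto
        finally have "norm (complex_of_real (shifted_power c (Suc k) t) - g n t) \<le> t powr (m - b) * ((a + 1) * r * ((c + t) powr (- m) * c powr (- real k - 2)))"
          using a r by (simp add: mult_left_mono)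
        also have "\<dots> = (a + 1) * c powr (- real k - 2) / real (Suc n) * norm (complex_of_real (shifted_power c 0 t))"
          by (simp add: shifted_power_def r_def norm_mult)
        finally show ?thesis .
      qed
    qed (use p in auto)
  qed
  show ?thesis
  proof (rule weighted_powers_dense[OF X _ _ _ _ _ _ _ _ f, where w = "shifted_power 1 0" and u = "\<lambda>t. 1 / (1 + t)"])
    show "(\<lambda>t. complex_of_real (shifted_power 1 0 t)) \<in> Lp p" by (rule shifted_power_Lp) simp
    show "0 < shifted_power 1 0 t" if "t > 0" for t using that by (simp add: shifted_power_def)
    show "1 / (1 + t) < 1 / (1 + s)" if "0 < s" "s < t" for s t :: real
      using that by (intro divide_strict_left_mono) auto
    have "(\<lambda>t. complex_of_real (shifted_power 1 0 t * (1 / (1 + t)) ^ k)) \<in> ?X" for k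
    proof (rule closed_subspace_cong_AE[OF X _ vX[of 1 k]])
      show "AE t in rplus. complex_of_real (shifted_power 1 0 t * (1 / (1 + t)) ^ k) = complex_of_real (shifted_power 1 k t)"
      proof (rule AE_rplus_I)
        fix t :: real assume t: "t > 0"
        have "(1 / (1 + t)) ^ k = (1 + t) powr (- real k)"
          using t by (simp add: powr_minus_divide powr_realpow power_one_over)
        then show "complex_of_real (shifted_power 1 0 t * (1 / (1 + t)) ^ k) = complex_of_real (shifted_power 1 k t)"
          by (simp add: shifted_power_def mult.assoc powr_add[symmetric] del: of_real_mult)
      qed
    qed (use p in auto)
    then show "(\<forall>k. (\<lambda>t. complex_of_real (shifted_power 1 0 t * (1 / (1 + t)) ^ k)) \<in> ?X) \<or>
        (\<forall>k. (\<lambda>t. complex_of_real (shifted_power 1 0 t * (1 - 1 / (1 + t)) ^ k)) \<in> ?X)" by blast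
  qed (use p in auto)
qed

lemma stieltjes_dense:
  assumes f: "f \<in> Lp p" and \<epsilon>: "\<epsilon> > 0"
  shows "\<exists>h\<in>Lp p. Lp_modular p (\<lambda>t. f t - stieltjes b m h t) < \<epsilon>"
proof -
  obtain g where g: "g \<in> stieltjes_range" "Lp_modular p (\<lambda>t. f t - g t) < \<epsilon>" using stieltjes_dense_closure[OF f] \<epsilon> by blast
  then obtain h where h: "h \<in> Lp p" "AE t in rplus. g t = kernel_op (stieltjes_kernel b m) h t" by (auto simp: stieltjes_range_def)
  have "Lp_modular p (\<lambda>t. f t - stieltjes b m h t) = Lp_modular p (\<lambda>t. f t - g t)"
    unfolding stieltjes_kernel_op
  proof (rule Lp_modular_cong_AE)
    have "g \<in> Lp p" using g by (simp add: stieltjes_range_def)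
    then show "(\<lambda>t. f t - g t) \<in> borel_measurable rplus" using f p by (intro Lp_measurable Lp_diff) auto
    show "(\<lambda>t. f t - kernel_op (stieltjes_kernel b m) h t) \<in> borel_measurable rplus"
      using f p S.kernel_op_Lp[OF h(1)] by (intro Lp_measurable[of _ p] Lp_diff) auto
    show "AE t in rplus. f t - kernel_op (stieltjes_kernel b m) h t = f t - g t" using h(2) by eventually_elim simp
  qed
  then show ?thesis using g(2) h(1) by (intro bexI[of _ h]) simp_all
qed

text \<open>Here convergence is at every t, not just almost every one: the section of the kernel
  lies in \<open>Lp q\<close>. Continuity at a given point depends on this.\<close>

lemma stieltjes_integrable:
  assumes f: "f \<in> Lp p" and t: "t > 0"
  shows "integrable rplus (\<lambda>s. (s powr (b - 1) / (s + t) powr m) *\<^sub>R f s)"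
proof -
  define q where "q = p / (p - 1)"
  have q: "1 / p + 1 / q = 1" "q > 1" using p by (auto simp: q_def field_simps)
  define d where "d = min t 1"
  have d: "d > 0" "d \<le> t" "d \<le> 1" using t by (auto simp: d_def)
  note [measurable] = Lp_measurable[OF f]
  have "integrable rplus (\<lambda>u. u powr (((b - 1) * q + 1) - 1) / (1 + u) powr (m * q))"
  proof (rule integrable_rplus_beta)
    have "1 / q = 1 - 1 / p" using q by simp
    then have "0 < (b - 1 + 1 / q) * q" "(b - 1 + 1 / q) * q < m * q" using b q by auto
    moreover have "(b - 1 + 1 / q) * q = (b - 1) * q + 1" using q by (simp add: algebra_simps)
    ultimately show "0 < (b - 1) * q + 1" "(b - 1) * q + 1 < m * q" by auto
  qed
  then have "integrable rplus (\<lambda>s. norm (complex_of_real (s powr (b - 1) / (1 + s) powr m)) powr q)"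
    by (rule integrable_rplus_cong) (auto simp: norm_divide powr_divide powr_powr)
  then have "(\<lambda>s. complex_of_real (s powr (b - 1) / (1 + s) powr m)) \<in> Lp q" by (simp add: Lp_def)
  from Lp_pairing(2)[OF p q(1) f this]
  have "integrable rplus (\<lambda>s. d powr (- m) * (norm (f s) * norm (complex_of_real (s powr (b - 1) / (1 + s) powr m))))"
    by simp
  then show ?thesis
  proof (rule Bochner_Integration.integrable_bound)
    show "AE s in rplus. norm ((s powr (b - 1) / (s + t) powr m) *\<^sub>R f s)
        \<le> norm (d powr (- m) * (norm (f s) * norm (complex_of_real (s powr (b - 1) / (1 + s) powr m))))"
    proof (rule AE_rplus_I)
      fix s :: real assume s: "s > 0"
      have "d * s \<le> 1 * s" using d s by (intro mult_right_mono) auto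
      then have "d * (1 + s) \<le> s + t" using d by (simp add: algebra_simps)
      then have "(d * (1 + s)) powr m \<le> (s + t) powr m" using d s m_pos by (intro powr_mono2) auto
      then have "s powr (b - 1) / (s + t) powr m \<le> s powr (b - 1) / (d * (1 + s)) powr m"
        using d s t by (intro divide_left_mono) auto
      also have "\<dots> = d powr (- m) * (s powr (b - 1) / (1 + s) powr m)"
        using d s by (simp add: powr_mult powr_minus_divide)
      finally have "s powr (b - 1) / (s + t) powr m * norm (f s) \<le> d powr (- m) * (s powr (b - 1) / (1 + s) powr m) * norm (f s)"
        by (intro mult_right_mono) auto
      then show "norm ((s powr (b - 1) / (s + t) powr m) *\<^sub>R f s)
        \<le> norm (d powr (- m) * (norm (f s) * norm (complex_of_real (s powr (b - 1) / (1 + s) powr m))))"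
        by (simp add: norm_divide mult_ac)
    qed
  qed measurable
qed

text \<open>Dominated convergence: the kernel factor (s + t)^(-m) decreases in t, so the integrand
  at t = 1/2 is a majorant near 1. The point 1 is where the test function of the next lemma
  jumps.\<close>

lemma stieltjes_isCont_1:
  assumes f: "f \<in> Lp p"
  shows "continuous (at 1) (stieltjes b m f)"
proof -
  note [measurable] = Lp_measurable[OF f]
  have "((\<lambda>t. LINT s|rplus. (s powr (b - 1) / (s + t) powr m) *\<^sub>R f s) \<longlongrightarrow> (LINT s|rplus. (s powr (b - 1) / (s + 1) powr m) *\<^sub>R f s)) (at 1)"
    unfolding tendsto_at_iff_sequentially comp_def
  proof (intro allI impI)
    fix X :: "nat \<Rightarrow> real" assume X: "\<forall>i. X i \<in> UNIV - {1}" "X \<longlonglongrightarrow> 1"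
    have "eventually (\<lambda>n. X n > 1 / 2) sequentially" using X(2) by (intro order_tendstoD) auto
    then obtain N where N: "\<And>n. n \<ge> N \<Longrightarrow> X n > 1 / 2" by (auto simp: eventually_sequentially)
    have X': "(\<lambda>n. X (n + N)) \<longlonglongrightarrow> 1" using X(2) by (rule LIMSEQ_ignore_initial_segment)
    have "(\<lambda>n. LINT s|rplus. (s powr (b - 1) / (s + X (n + N)) powr m) *\<^sub>R f s) \<longlonglongrightarrow> (LINT s|rplus. (s powr (b - 1) / (s + 1) powr m) *\<^sub>R f s)"
    proof (rule integral_dominated_convergence)
      show "integrable rplus (\<lambda>s. norm ((s powr (b - 1) / (s + 1 / 2) powr m) *\<^sub>R f s))"
        using stieltjes_integrable[OF f, of "1 / 2"] by (intro integrable_norm) auto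
      show "AE s in rplus. (\<lambda>n. (s powr (b - 1) / (s + X (n + N)) powr m) *\<^sub>R f s) \<longlonglongrightarrow> (s powr (b - 1) / (s + 1) powr m) *\<^sub>R f s"
        by (rule AE_rplus_I) (auto intro!: tendsto_intros X')
      show "AE s in rplus. norm ((s powr (b - 1) / (s + X (n + N)) powr m) *\<^sub>R f s) \<le> norm ((s powr (b - 1) / (s + 1 / 2) powr m) *\<^sub>R f s)" for n
      proof (rule AE_rplus_I)
        fix s :: real assume s: "s > 0"
        have "(s + 1 / 2) powr m \<le> (s + X (n + N)) powr m" using N[of "n + N"] s m_pos by (intro powr_mono2) auto
        then have "s powr (b - 1) / (s + X (n + N)) powr m \<le> s powr (b - 1) / (s + 1 / 2) powr m"
          using s N[of "n + N"] by (intro divide_left_mono) auto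
        then have "s powr (b - 1) / (s + X (n + N)) powr m * norm (f s) \<le> s powr (b - 1) / (s + 1 / 2) powr m * norm (f s)"
          by (intro mult_right_mono) auto
        then show "norm ((s powr (b - 1) / (s + X (n + N)) powr m) *\<^sub>R f s) \<le> norm ((s powr (b - 1) / (s + 1 / 2) powr m) *\<^sub>R f s)"
          by simp
      qed
    qed measurable
    then show "(\<lambda>n. LINT s|rplus. (s powr (b - 1) / (s + X n) powr m) *\<^sub>R f s) \<longlonglongrightarrow> (LINT s|rplus. (s powr (b - 1) / (s + 1) powr m) *\<^sub>R f s)"
      by (rule LIMSEQ_offset)
  qed
  then have "continuous (at 1) (\<lambda>t. LINT s|rplus. (s powr (b - 1) / (s + t) powr m) *\<^sub>R f s)"
    by (simp add: continuous_at)
  then show ?thesis unfolding stieltjes_def[abs_def] by (intro continuous_intros) auto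
qed

text \<open>Equality almost everywhere still supplies points on either side of 1, as close as
  desired, with values 0 and 1. Continuity at 1 forbids this.\<close>

lemma stieltjes_not_indicator:
  assumes f: "f \<in> Lp p"
  shows "\<not> (AE t in rplus. stieltjes b m f t = indicator {1..2} t)"
proof
  assume ae: "AE t in rplus. stieltjes b m f t = indicator {1..2} t"
  have "isCont (stieltjes b m f) 1" by (rule stieltjes_isCont_1[OF f])
  then obtain d where d: "d > 0" "\<And>t. dist t 1 < d \<Longrightarrow> dist (stieltjes b m f t) (stieltjes b m f 1) < 1 / 2"
    unfolding continuous_at_eps_delta by (metis half_gt_zero_iff zero_less_one)
  define e where "e = min d 1"
  have e: "e > 0" "e \<le> d" "e \<le> 1" using d by (auto simp: e_def)
  obtain s where s: "1 - e < s" "s < 1" "stieltjes b m f s = indicator {1..2} s"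
    using ex_rplus_AE[OF ae, of "1 - e" 1] e by auto
  obtain t where t: "1 < t" "t < 1 + e" "stieltjes b m f t = indicator {1..2} t"
    using ex_rplus_AE[OF ae, of 1 "1 + e"] e by auto
  have "dist (stieltjes b m f s) (stieltjes b m f 1) < 1 / 2" using s e by (intro d) (auto simp: dist_real_def)
  moreover have "dist (stieltjes b m f t) (stieltjes b m f 1) < 1 / 2" using t e by (intro d) (auto simp: dist_real_def)
  ultimately have "dist (stieltjes b m f s) (stieltjes b m f t) < 1 / 2 + 1 / 2"
    by (metis dist_commute dist_triangle_half_r field_sum_of_halves zero_less_one)
  moreover have "dist (stieltjes b m f s) (stieltjes b m f t) = 1" using s t e by simp
  ultimately show False by simp
qed

end

lemma stieltjes_injective:
  fixes p q b m :: real
  assumes p: "p > 1" and q: "1 / p + 1 / q = 1" and b: "0 < b - 1 / p" "b - 1 / p < m"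
    and h: "h \<in> Lp p" and z: "AE t in rplus. stieltjes b m h t = 0"
  shows "AE t in rplus. h t = 0"
proof (rule Lp_annihilator[OF p q h])
  fix g assume g: "g \<in> Lp q"
  note qq = conj_exponent[OF p q]
  interpret S: hom_kernel p "stieltjes_kernel b m" by (rule hom_kernel_stieltjes[OF p b])
  \<comment> \<open>Since 1/q = 1 - 1/p, the quantity on the left is m - (b - 1/p): the admissible
    range is symmetric under transposition.\<close>
  have b': "0 < (m - b + 1) - 1 / q" "(m - b + 1) - 1 / q < m" using b qq by auto
  interpret S': hom_kernel q "stieltjes_kernel (m - b + 1) m" by (rule hom_kernel_stieltjes[OF qq(1) b'])
  let ?X = "{g \<in> Lp q. (LINT t|rplus. h t * g t) = 0}"
  have "g \<in> ?X"
  proof (rule closed_subspace_closed[OF annihilator_closed_subspace[OF p q h] g])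
    fix \<epsilon> :: real assume "\<epsilon> > 0"
    then obtain k where k: "k \<in> Lp q" "Lp_modular q (\<lambda>t. g t - kernel_op (stieltjes_kernel (m - b + 1) m) k t) < \<epsilon>"
      using stieltjes_dense[OF qq(1) b' g] unfolding stieltjes_kernel_op by blast
    have "(LINT s|rplus. h s * kernel_op (stieltjes_kernel (m - b + 1) m) k s) = (LINT t|rplus. kernel_op (stieltjes_kernel b m) h t * k t)"
      using S.kernel_op_adjoint[OF h k(1) q] unfolding stieltjes_kernel_transpose by simp
    also have "\<dots> = (LINT t|rplus. 0)"
    proof (rule integral_cong_AE)
      show "AE t in rplus. kernel_op (stieltjes_kernel b m) h t * k t = 0"
        using z unfolding stieltjes_kernel_op by eventually_elim simp
      show "(\<lambda>t. kernel_op (stieltjes_kernel b m) h t * k t) \<in> borel_measurable rplus"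
        using Lp_measurable[OF S.kernel_op_Lp[OF h]] Lp_measurable[OF k(1)] by measurable
    qed simp
    finally have "kernel_op (stieltjes_kernel (m - b + 1) m) k \<in> ?X" using S'.kernel_op_Lp[OF k(1)] by simp
    then show "\<exists>k\<in>?X. Lp_modular q (\<lambda>t. g t - k t) < \<epsilon>" using k(2) by blast
  qed
  then show "(LINT t|rplus. h t * g t) = 0" by simp
qed

subsection \<open>The inverse of the weighted Weyl derivative\<close>

definition weyl_kernel :: "real \<Rightarrow> real \<Rightarrow> real \<Rightarrow> real" where
  "weyl_kernel a t s = (if t < s then a * (s - t) powr (a - 1) * s powr (- a) else 0)"

lemma hom_kernel_weyl:
  assumes a: "a > 0" and p: "p > 1"
  shows "hom_kernel p (weyl_kernel a)"
proof
  show "p > 1" by fact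
  have "(\<lambda>x. weyl_kernel a (fst x) (snd x)) \<in> borel_measurable (borel \<Otimes>\<^sub>M borel)"
    unfolding weyl_kernel_def by measurable
  then show "(\<lambda>x. weyl_kernel a (fst x) (snd x)) \<in> borel_measurable (rplus \<Otimes>\<^sub>M rplus)"
    by (rule measurable_rplus_pair)
  show "0 \<le> weyl_kernel a s t" if "s > 0" "t > 0" for s t using a by (simp add: weyl_kernel_def)
  show "weyl_kernel a (c * s) (c * t) = weyl_kernel a s t / c" if "c > 0" "s > 0" "t > 0" for c s t
  proof (cases "s < t")
    case True
    have "c powr (a - 1) * c powr (- a) = c powr (- 1)" unfolding powr_add[symmetric] by simp
    then have e: "c powr (a - 1) * c powr (- a) = 1 / c" using that by (simp add: powr_minus_divide)
    have "c * t - c * s = c * (t - s)" by (simp add: algebra_simps)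
    then have "weyl_kernel a (c * s) (c * t) = (c powr (a - 1) * c powr (- a)) * weyl_kernel a s t"
      using that True by (simp add: weyl_kernel_def powr_mult)
    then show ?thesis unfolding e by simp
  qed (use that in \<open>simp add: weyl_kernel_def\<close>)
  \<comment> \<open>The translation u = 1 + v takes the condition on the kernel to this beta
    integral, which converges because a > 0 and 1/p > 0.\<close>
  have "integrable rplus (\<lambda>u. u powr (a - 1) / (1 + u) powr (a + 1 / p))"
    by (rule integrable_rplus_beta) (use a p in auto)
  then have "integrable lborel (\<lambda>u. indicator {0<..} u *\<^sub>R (u powr (a - 1) / (1 + u) powr (a + 1 / p)))"
    unfolding rplus_def by (subst (asm) integrable_restrict_space) auto
  then have "integrable lborel (\<lambda>u. indicator {0<..} (- 1 + 1 * u) *\<^sub>R ((- 1 + 1 * u) powr (a - 1) / (1 + (- 1 + 1 * u)) powr (a + 1 / p)))"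
    by (rule lborel_integrable_real_affine) simp
  then have "integrable rplus (\<lambda>u. a * (indicator {0<..} (- 1 + 1 * u) *\<^sub>R ((- 1 + 1 * u) powr (a - 1) / (1 + (- 1 + 1 * u)) powr (a + 1 / p))))"
    by (intro integrable_mult_right integrable_rplus_lborel)
  then show "integrable rplus (\<lambda>u. weyl_kernel a 1 u * u powr (- 1 / p))"
  proof (rule integrable_rplus_cong)
    fix u :: real assume "u > 0"
    have e: "u powr (- a) * u powr (- 1 / p) = 1 / u powr (a + 1 / p)"
      unfolding powr_add[symmetric] powr_minus_divide[symmetric] by simp
    show "a * (indicator {0<..} (- 1 + 1 * u) *\<^sub>R ((- 1 + 1 * u) powr (a - 1) / (1 + (- 1 + 1 * u)) powr (a + 1 / p)))
        = weyl_kernel a 1 u * u powr (- 1 / p)"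
    proof (cases "u > 1")
      case True
      then have "weyl_kernel a 1 u * u powr (- 1 / p) = a * (u - 1) powr (a - 1) * (u powr (- a) * u powr (- 1 / p))"
        by (simp add: weyl_kernel_def)
      then show ?thesis unfolding e using True by (simp add: indicator_def)
    qed (simp add: weyl_kernel_def indicator_def)
  qed
qed

text \<open>The substitution \<open>y = t (1 + s) / (s (1 + t))\<close> turns this into Euler's beta integral.\<close>

lemma weyl_kernel_transpose_power:
  assumes a: "a > 0" and s: "s > 0"
  shows "(LINT t|rplus. weyl_kernel a t s * (t powr real j * (1 + t) powr (- a - real j - 1)))
    = a * Beta (real j + 1) a * (s powr real j * (1 + s) powr (- real j - 1))"
proof -
  define f where "f y = y powr real j * (1 - y) powr (a - 1)" for y :: real
  \<comment> \<open>g increases from 0 at t = 0 to 1 at t = s, and 1 - g t = (s - t) / (s (1 + t))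
    reproduces the factor s - t of the kernel.\<close>
  define g where "g t = t * (1 + s) / (s * (1 + t))" for t
  define g' where "g' t = (1 + s) / (s * (1 + t)^2)" for t
  define B where "B = Beta (real j + 1) a"
  have B: "B > 0" using a by (auto simp: B_def Beta_def intro!: divide_pos_pos mult_pos_pos Gamma_real_pos)
  have [measurable]: "f \<in> borel_measurable borel" "g \<in> borel_measurable borel" "g' \<in> borel_measurable borel"
    unfolding f_def g_def g'_def by measurable
  have f0: "f y \<ge> 0" for y by (simp add: f_def)
  have g0: "g 0 = 0" "g s = 1" using s by (auto simp: g_def)
  have "(f has_integral B) {0..1}"
    using has_integral_Beta_real[of "real j + 1" a] a by (simp add: f_def[abs_def] B_def)
  then have "ennreal B = (\<integral>\<^sup>+y. ennreal (indicator {0..1} y * f y) \<partial>lborel)"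
    using f0 by (subst nn_integral_has_integral_lebesgue) auto
  also have "\<dots> = (\<integral>\<^sup>+y. ennreal (f y * indicator {g 0..g s} y) \<partial>lborel)" by (simp add: g0 mult.commute)
  also have "\<dots> = (\<integral>\<^sup>+t. ennreal (f (g t) * g' t * indicator {0..s} t) \<partial>lborel)"
  proof (rule nn_integral_substitution)
    show "set_borel_measurable borel {g 0..g s} f" unfolding set_borel_measurable_def by measurable
    show "(g has_real_derivative g' x) (at x)" if "x \<in> {0..s}" for x
    proof -
      have nz: "1 + x \<noteq> 0" "s \<noteq> 0" using s that by auto
      have "((\<lambda>t. t * (1 + s) / (s * (1 + t))) has_real_derivative
          ((1 + s) * (s * (1 + x)) - x * (1 + s) * s) / ((s * (1 + x)) * (s * (1 + x)))) (at x)"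
        using nz by (auto intro!: derivative_eq_intros)
      also have "(1 + s) * (s * (1 + x)) - x * (1 + s) * s = s * (1 + s)" by (simp add: algebra_simps)
      also have "s * (1 + s) / ((s * (1 + x)) * (s * (1 + x))) = g' x"
        using nz by (simp add: g'_def power2_eq_square)
      finally show ?thesis unfolding g_def .
    qed
    show "continuous_on {0..s} g'" unfolding g'_def using s by (intro continuous_intros) (auto simp: add_nonneg_eq_0_iff)
    show "g' x \<ge> 0" if "x \<in> {0..s}" for x using that s by (auto simp: g'_def)
  qed (use s in auto)
  finally have eB: "(\<integral>\<^sup>+t. ennreal (f (g t) * g' t * indicator {0..s} t) \<partial>lborel) = ennreal B" ..
  define F where "F t = weyl_kernel a t s * (t powr real j * (1 + t) powr (- a - real j - 1))" for t
  define c where "c = a * (s powr real j * (1 + s) powr (- real j - 1))"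
  have c: "c > 0" using a s by (simp add: c_def)
  have Ff: "F t = c * (f (g t) * g' t)" if t: "0 < t" "t < s" for t
  proof -
    have e1: "1 - g t = (s - t) / (s * (1 + t))" 
    proof -
      have "s * (1 + t) / (s * (1 + t)) = 1" using s t by auto
      then have "1 - g t = (s * (1 + t) - t * (1 + s)) / (s * (1 + t))" by (simp only: g_def diff_divide_distrib)
      then show ?thesis by (simp add: algebra_simps)
    qed
    have e2: "f (g t) = t powr real j * (1 + s) powr real j / (s powr real j * (1 + t) powr real j)
        * ((s - t) powr (a - 1) / (s powr (a - 1) * (1 + t) powr (a - 1)))"
      unfolding f_def e1 unfolding g_def using s t by (simp add: powr_mult powr_divide)
    \<comment> \<open>The substitution leaves the powers j, a - 1 and 2 of 1 + t in the denominator.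
      Their sum a + j + 1 dictates the exponent of the test function.\<close>
    have "(1 + t) powr real j * (1 + t) powr (a - 1) * (1 + t)\<^sup>2 = (1 + t) powr (a + real j + 1)"
    proof -
      have "(1 + t)\<^sup>2 = (1 + t) powr 2" using t by simp
      then show ?thesis by (simp only: powr_add[symmetric]) (simp add: algebra_simps)
    qed
    moreover have "- a - real j - 1 = - (a + real j + 1)" by simp
    ultimately have p1: "(1 + t) powr (- a - real j - 1) = 1 / ((1 + t) powr real j * (1 + t) powr (a - 1) * (1 + t)\<^sup>2)"
      by (simp only: powr_minus_divide)
    have p2: "(1 + s) powr (- real j - 1) = 1 / ((1 + s) powr real j * (1 + s))"
    proof -
      have "(1 + s) powr real j * (1 + s) = (1 + s) powr (real j + 1)" using s by (simp add: powr_add)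
      moreover have "- real j - 1 = - (real j + 1)" by simp
      ultimately show ?thesis by (simp only: powr_minus_divide)
    qed
    have p3: "s powr (- a) = 1 / (s powr (a - 1) * s)"
    proof -
      have "s powr (a - 1) * s = s powr a" using s by (simp add: powr_diff)
      then show ?thesis by (simp add: powr_minus_divide)
    qed
    have nz: "s powr real j \<noteq> 0" "(1 + s) powr real j \<noteq> 0" "1 + s \<noteq> 0" using s by auto
    have "F t = a * (s - t) powr (a - 1) * s powr (- a) * (t powr real j * (1 + t) powr (- a - real j - 1))"
      using t by (simp add: F_def weyl_kernel_def)
    also have "\<dots> = c * (f (g t) * g' t)"
      unfolding c_def e2 g'_def p1 p2 p3 using nz by (simp add: divide_simps)
    finally show ?thesis .
  qed
  have "has_bochner_integral rplus F (c * B)"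
  proof (rule has_bochner_integral_nn_integral)
    show "F \<in> borel_measurable rplus" unfolding F_def weyl_kernel_def by measurable
    show "AE t in rplus. 0 \<le> F t" using a by (intro AE_rplus_I) (auto simp: F_def weyl_kernel_def)
    have "(\<integral>\<^sup>+t. ennreal (F t) \<partial>rplus) = (\<integral>\<^sup>+t. ennreal c * ennreal (f (g t) * g' t * indicator {0..s} t) \<partial>lborel)"
      unfolding nn_integral_rplus
    proof (rule nn_integral_cong_AE, use AE_lborel_singleton[of 0] AE_lborel_singleton[of s] in eventually_elim)
      case (elim t)
      show ?case
      proof (cases "0 < t \<and> t < s")
        case True
        then have "ennreal (F t) = ennreal c * ennreal (f (g t) * g' t)"
          using Ff[of t] c by (simp add: ennreal_mult')
        then show ?thesis using True by simp
      qed (use elim in \<open>auto simp: F_def weyl_kernel_def indicator_def\<close>)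
    qed
    also have "\<dots> = ennreal (c * B)"
      using c B by (subst nn_integral_cmult) (auto simp: eB ennreal_mult)
    finally show "(\<integral>\<^sup>+t. ennreal (F t) \<partial>rplus) = ennreal (c * B)" .
  qed (use c B in auto)
  then have "(LINT t|rplus. F t) = c * B" by (rule has_bochner_integral_integral_eq)
  then show ?thesis unfolding F_def c_def B_def by (simp add: mult_ac)
qed

lemma weyl_kernel_injective:
  fixes p q a :: real
  assumes p: "p > 1" and q: "1 / p + 1 / q = 1" and a: "a > 0"
    and h: "h \<in> Lp p" and z: "AE t in rplus. kernel_op (weyl_kernel a) h t = 0"
  shows "AE t in rplus. h t = 0"
proof (rule Lp_annihilator[OF p q h])
  fix g assume g: "g \<in> Lp q"
  note qq = conj_exponent[OF p q]
  interpret A: hom_kernel p "weyl_kernel a" by (rule hom_kernel_weyl[OF a p])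
  let ?X = "{g \<in> Lp q. (LINT t|rplus. h t * g t) = 0}"
  note X = annihilator_closed_subspace[OF p q h]
  let ?w = "\<lambda>s::real. (1 + s) powr (- 1)" and ?u = "\<lambda>s::real. 1 / (1 + s)"
  \<comment> \<open>The case b = a serves the preimages \<open>k\<close> and b = 0 their images
    \<open>v\<close> under the transposed operator.\<close>
  have Lq: "(\<lambda>t. complex_of_real (t powr real j * (1 + t) powr (- b - real j - 1))) \<in> Lp q" if b: "b \<ge> 0" for j b
  proof -
    have "integrable rplus (\<lambda>u. u powr ((real j * q + 1) - 1) / (1 + u) powr ((b + real j + 1) * q))"
    proof (rule integrable_rplus_beta)
      show "0 < real j * q + 1" using qq(1) by (intro add_nonneg_pos) auto
      have "0 \<le> b * q" using b qq(1) by simp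
      then show "real j * q + 1 < (b + real j + 1) * q" using qq(1) by (simp add: algebra_simps)
    qed
    then have "integrable rplus (\<lambda>t. norm (complex_of_real (t powr real j * (1 + t) powr (- b - real j - 1))) powr q)"
    proof (rule integrable_rplus_cong)
      fix t :: real assume t: "t > 0"
      have "norm (complex_of_real (t powr real j * (1 + t) powr (- b - real j - 1))) powr q
          = t powr (real j * q) * (1 + t) powr (- ((b + real j + 1) * q))"
      proof -
        have "(- b - real j - 1) * q = - ((b + real j + 1) * q)" by (simp add: algebra_simps)
        then show ?thesis unfolding norm_of_real by (simp add: abs_mult powr_mult powr_powr)
      qed
      then show "t powr ((real j * q + 1) - 1) / (1 + t) powr ((b + real j + 1) * q)
          = norm (complex_of_real (t powr real j * (1 + t) powr (- b - real j - 1))) powr q"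
        by (simp add: powr_minus_divide)
    qed
    then show ?thesis by (simp add: Lp_def)
  qed
  \<comment> \<open>h pairs to 0 with the transposed operator applied to \<open>k\<close>, because
    the operator kills h. By the beta integral that function is B v with B > 0, and v = w (1 -
    u)^j.\<close>
  have sX: "(\<lambda>s. complex_of_real (?w s * (1 - ?u s) ^ j)) \<in> ?X" for j
  proof -
    define k where "k t = complex_of_real (t powr real j * (1 + t) powr (- a - real j - 1))" for t
    define v where "v s = complex_of_real (s powr real j * (1 + s) powr (- real j - 1))" for s
    define B where "B = a * Beta (real j + 1) a"
    have B: "B > 0" using a by (auto simp: B_def Beta_def intro!: divide_pos_pos mult_pos_pos Gamma_real_pos)
    have k: "k \<in> Lp q" unfolding k_def using Lq[of a j] a by simp
    have v: "v \<in> Lp q" unfolding v_def using Lq[of 0 j] by simp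
    have kv: "kernel_op (\<lambda>s t. weyl_kernel a t s) k s = complex_of_real B * v s" if s: "s > 0" for s
    proof -
      have "kernel_op (\<lambda>s t. weyl_kernel a t s) k s = (LINT t|rplus. complex_of_real (weyl_kernel a t s * (t powr real j * (1 + t) powr (- a - real j - 1))))"
        by (simp add: kernel_op_def k_def scaleR_conv_of_real)
      also have "\<dots> = complex_of_real (LINT t|rplus. weyl_kernel a t s * (t powr real j * (1 + t) powr (- a - real j - 1)))"
        by (rule integral_complex_of_real)
      finally show ?thesis unfolding weyl_kernel_transpose_power[OF a s] by (simp add: B_def v_def)
    qed
    have "complex_of_real B * (LINT s|rplus. h s * v s) = (LINT s|rplus. complex_of_real B * (h s * v s))"
      by (simp only: integral_mult_right_zero)
    also have "\<dots> = (LINT s|rplus. h s * kernel_op (\<lambda>s t. weyl_kernel a t s) k s)"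
      using kv by (intro Bochner_Integration.integral_cong) (auto simp: mult_ac)
    also have "\<dots> = (LINT t|rplus. kernel_op (weyl_kernel a) h t * k t)"
      by (rule A.kernel_op_adjoint[OF h k q, symmetric])
    also have "\<dots> = (LINT t|rplus. 0)"
    proof (rule integral_cong_AE)
      show "AE t in rplus. kernel_op (weyl_kernel a) h t * k t = 0" using z by eventually_elim simp
      show "(\<lambda>t. kernel_op (weyl_kernel a) h t * k t) \<in> borel_measurable rplus"
        using Lp_measurable[OF A.kernel_op_Lp[OF h]] Lp_measurable[OF k] by measurable
    qed simp
    finally have "v \<in> ?X" using B v by simp
    then show ?thesis
    proof (rule closed_subspace_cong_AE[OF X, rotated])
      show "AE s in rplus. complex_of_real (?w s * (1 - ?u s) ^ j) = v s"
      proof (rule AE_rplus_I)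
        fix s :: real assume s: "s > 0"
        have "1 - ?u s = s / (1 + s)" using s by (simp add: field_simps)
        then have "(1 - ?u s) ^ j = s powr real j * (1 + s) powr (- real j)"
          using s by (simp add: power_divide powr_minus_divide powr_realpow)
        then have "?w s * (1 - ?u s) ^ j = s powr real j * ((1 + s) powr (- real j) * (1 + s) powr (- 1))"
          by simp
        also have "(1 + s) powr (- real j) * (1 + s) powr (- 1) = (1 + s) powr (- real j - 1)"
          unfolding powr_add[symmetric] by simp
        finally show "complex_of_real (?w s * (1 - ?u s) ^ j) = v s" by (simp add: v_def)
      qed
    qed (use qq in auto)
  qed
  have "g \<in> ?X"
  proof (rule weighted_powers_dense[OF X _ _ _ _ _ _ _ _ g, where w = ?w and u = ?u])
    show "(\<lambda>s. complex_of_real (?w s)) \<in> Lp q"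
      by (rule iffD1[OF Lp_cong Lq[of 0 0]]) auto
    show "?u t < ?u s" if "0 < s" "s < t" for s t :: real
      using that by (intro divide_strict_left_mono) auto
    show "(\<forall>k. (\<lambda>t. complex_of_real (?w t * ?u t ^ k)) \<in> ?X) \<or> (\<forall>k. (\<lambda>t. complex_of_real (?w t * (1 - ?u t) ^ k)) \<in> ?X)"
      using sX by blast
  qed (use qq in auto)
  then show "(LINT t|rplus. h t * g t) = 0" by simp
qed

subsection \<open>Weyl fractional calculus on the Schwartz class\<close>

lemma at_within_halfline: "t \<ge> 0 \<Longrightarrow> at t within {0::real..} \<noteq> bot"
proof -
  assume t: "t \<ge> 0"
  have "t islimpt {t<..<t + 1}" by (rule islimpt_greaterThanLessThan1) simp
  then have "t islimpt {0..}" using t by (rule_tac islimpt_subset) auto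
  then show ?thesis by (simp add: trivial_limit_within)
qed

lemma dplus_eq: "t \<ge> 0 \<Longrightarrow> (f has_vector_derivative y) (at t within {0..}) \<Longrightarrow> dplus f t = y"
  unfolding dplus_def by (rule vector_derivative_within[OF at_within_halfline])

text \<open>\<open>dplus\<close> picks a derivative by description, so its iterates are computed by
  exhibiting candidates for all derivatives at once.\<close>

lemma dplus_iter:
  assumes "\<And>t. t \<ge> 0 \<Longrightarrow> F 0 t = f t"
    and F: "\<And>n t. t \<ge> 0 \<Longrightarrow> (F n has_vector_derivative F (Suc n) t) (at t within {0..})"
  shows "t \<ge> 0 \<Longrightarrow> (dplus ^^ n) f t = F n t"
proof (induction n arbitrary: t)
  case (Suc n)
  have "((dplus ^^ n) f has_vector_derivative F (Suc n) t) (at t within {0..})"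
    by (rule has_vector_derivative_transform[OF _ _ F]) (use Suc in auto)
  then show ?case using dplus_eq[OF Suc.prems] by simp
qed (use assms in simp)

section \<open>Rapid decay and the algebra of the Schwartz class\<close>

text \<open>The class on which Weyl integrals of every order converge. Powers of 1 + t instead of t
  make a single bound control the behaviour both near 0 and at infinity.\<close>

definition rapid :: "(real \<Rightarrow> complex) \<Rightarrow> bool" where
  "rapid g \<longleftrightarrow> continuous_on {0..} g \<and> (\<forall>N::nat. \<exists>C\<ge>0. \<forall>t\<ge>0. norm (g t) \<le> C / (1 + t) ^ N)"

lemma rapidE:
  assumes "rapid g"
  obtains C where "C \<ge> 0" "\<And>t. t \<ge> 0 \<Longrightarrow> norm (g t) \<le> C / (1 + t) ^ N"
  using assms unfolding rapid_def by meson

lemma schwartz_deriv: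
  assumes "f \<in> schwartz_plus" "t \<ge> 0"
  shows "((dplus ^^ n) f has_vector_derivative (dplus ^^ Suc n) f t) (at t within {0..})"
proof -
  have "(dplus ^^ n) f differentiable (at t within {0..})"
    using assms by (auto simp: schwartz_plus_def)
  then show ?thesis by (simp add: dplus_def vector_derivative_works)
qed

lemma schwartz_rapid:
  assumes f: "f \<in> schwartz_plus"
  shows "rapid ((dplus ^^ n) f)"
  unfolding rapid_def
proof (intro conjI allI)
  show "continuous_on {0..} ((dplus ^^ n) f)"
    unfolding continuous_on_eq_continuous_within
    using schwartz_deriv[OF f] has_vector_derivative_continuous by blast
  fix N :: nat
  have b: "\<exists>B. \<forall>t\<ge>0. t ^ m * norm ((dplus ^^ n) f t) \<le> B" for m
  proof -
    have "bounded ((\<lambda>t. t ^ m *\<^sub>R (dplus ^^ n) f t) ` {0..})" using f by (auto simp: schwartz_plus_def)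
    then obtain B where "\<forall>x\<in>(\<lambda>t. t ^ m *\<^sub>R (dplus ^^ n) f t) ` {0..}. norm x \<le> B" by (auto simp: bounded_iff)
    then show ?thesis by (intro exI[of _ B]) auto
  qed
  obtain B0 where B0: "\<And>t. t \<ge> 0 \<Longrightarrow> norm ((dplus ^^ n) f t) \<le> B0" using b[of 0] by auto
  obtain BN where BN: "\<And>t. t \<ge> 0 \<Longrightarrow> t ^ N * norm ((dplus ^^ n) f t) \<le> BN" using b[of N] by auto
  have B: "B0 \<ge> 0" "BN \<ge> 0"
    using order_trans[OF norm_ge_zero B0[of 0]] order_trans[OF _ BN[of 1]] by auto
  show "\<exists>C\<ge>0. \<forall>t\<ge>0. norm ((dplus ^^ n) f t) \<le> C / (1 + t) ^ N"
  proof (intro exI conjI allI impI)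
    show "0 \<le> 2 ^ N * (B0 + BN)" using B by simp
    fix t :: real assume t: "t \<ge> 0"
    have "(1 + t) ^ N \<le> (2 * max 1 t) ^ N" using t by (intro power_mono) auto
    also have "\<dots> = 2 ^ N * (max 1 t) ^ N" by (simp add: power_mult_distrib)
    also have "(max 1 t) ^ N \<le> 1 + t ^ N" using t by (auto simp: max_def)
    finally have "(1 + t) ^ N * norm ((dplus ^^ n) f t) \<le> 2 ^ N * (1 + t ^ N) * norm ((dplus ^^ n) f t)"
      by (intro mult_right_mono) auto
    also have "\<dots> = 2 ^ N * (norm ((dplus ^^ n) f t) + t ^ N * norm ((dplus ^^ n) f t))"
      by (simp add: algebra_simps)
    also have "\<dots> \<le> 2 ^ N * (B0 + BN)" using B0[OF t] BN[OF t] by (intro mult_left_mono add_mono) auto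
    finally show "norm ((dplus ^^ n) f t) \<le> 2 ^ N * (B0 + BN) / (1 + t) ^ N"
      using t by (simp add: pos_le_divide_eq mult.commute)
  qed
qed

lemma schwartzI:
  assumes F0: "\<And>t. t \<ge> 0 \<Longrightarrow> F 0 t = f t"
    and F: "\<And>n t. t \<ge> 0 \<Longrightarrow> (F n has_vector_derivative F (Suc n) t) (at t within {0..})"
    and r: "\<And>n. rapid (F n)"
  shows "f \<in> schwartz_plus"
proof -
  have it: "(dplus ^^ n) f t = F n t" if "t \<ge> 0" for n t
    by (rule dplus_iter[where F = F]) (use F0 F that in auto)
  show ?thesis
    unfolding schwartz_plus_def mem_Collect_eq
  proof (intro conjI allI impI)
  fix n and t :: real assume t: "t \<ge> 0"
  have "((dplus ^^ n) f has_vector_derivative F (Suc n) t) (at t within {0..})"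
    by (rule has_vector_derivative_transform[OF _ _ F]) (use t it in auto)
  then show "(dplus ^^ n) f differentiable (at t within {0..})"
    by (auto simp: has_vector_derivative_def differentiable_def)
next
  fix m n
  obtain C where C: "C \<ge> 0" "\<And>t. t \<ge> 0 \<Longrightarrow> norm (F n t) \<le> C / (1 + t) ^ m" using rapidE[OF r] by blast
  have "norm (t ^ m *\<^sub>R (dplus ^^ n) f t) \<le> C" if t: "t \<ge> 0" for t
  proof -
    have "norm (t ^ m *\<^sub>R (dplus ^^ n) f t) = t ^ m * norm (F n t)" using t it[OF t] by simp
    also have "\<dots> \<le> (1 + t) ^ m * (C / (1 + t) ^ m)" using t C by (intro mult_mono power_mono) auto
    also have "\<dots> = C" using t by simp
    finally show ?thesis .
  qed
  then show "bounded ((\<lambda>t. t ^ m *\<^sub>R (dplus ^^ n) f t) ` {0..})" by (auto simp: bounded_iff)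
qed
qed

lemma rapid_add: "rapid f \<Longrightarrow> rapid g \<Longrightarrow> rapid (\<lambda>t. f t + g t)"
  unfolding rapid_def
proof (intro conjI allI)
  assume f: "continuous_on {0..} f \<and> (\<forall>N. \<exists>C\<ge>0. \<forall>t\<ge>0. norm (f t) \<le> C / (1 + t) ^ N)"
    and g: "continuous_on {0..} g \<and> (\<forall>N. \<exists>C\<ge>0. \<forall>t\<ge>0. norm (g t) \<le> C / (1 + t) ^ N)"
  then show "continuous_on {0..} (\<lambda>t. f t + g t)" by (intro continuous_on_add) auto
  fix N
  obtain C where C: "C \<ge> 0" "\<forall>t\<ge>0. norm (f t) \<le> C / (1 + t) ^ N" using f by meson
  obtain D where D: "D \<ge> 0" "\<forall>t\<ge>0. norm (g t) \<le> D / (1 + t) ^ N" using g by meson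
  show "\<exists>C\<ge>0. \<forall>t\<ge>0. norm (f t + g t) \<le> C / (1 + t) ^ N"
  proof (intro exI[of _ "C + D"] conjI allI impI)
    fix t :: real assume "t \<ge> 0"
    then have "norm (f t) + norm (g t) \<le> C / (1 + t) ^ N + D / (1 + t) ^ N" using C D by (intro add_mono) auto
    then show "norm (f t + g t) \<le> (C + D) / (1 + t) ^ N"
      unfolding add_divide_distrib by (rule order_trans[OF norm_triangle_ineq])
  qed (use C D in auto)
qed

lemma rapid_scale: "rapid f \<Longrightarrow> rapid (\<lambda>t. c * f t)"
  unfolding rapid_def
proof (intro conjI allI)
  assume f: "continuous_on {0..} f \<and> (\<forall>N. \<exists>C\<ge>0. \<forall>t\<ge>0. norm (f t) \<le> C / (1 + t) ^ N)"
  then show "continuous_on {0..} (\<lambda>t. c * f t)" by (intro continuous_on_mult continuous_on_const) auto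
  fix N
  obtain C where C: "C \<ge> 0" "\<forall>t\<ge>0. norm (f t) \<le> C / (1 + t) ^ N" using f by meson
  show "\<exists>C\<ge>0. \<forall>t\<ge>0. norm (c * f t) \<le> C / (1 + t) ^ N"
  proof (intro exI[of _ "norm c * C"] conjI allI impI)
    fix t :: real assume "t \<ge> 0"
    then have "norm c * norm (f t) \<le> norm c * (C / (1 + t) ^ N)" using C by (intro mult_left_mono) auto
    then show "norm (c * f t) \<le> norm c * C / (1 + t) ^ N" by (simp add: norm_mult)
  qed (use C in auto)
qed

lemma schwartz_add:
  assumes f: "f \<in> schwartz_plus" and g: "g \<in> schwartz_plus"
  shows "(\<lambda>t. f t + g t) \<in> schwartz_plus"
    and "t \<ge> 0 \<Longrightarrow> (dplus ^^ n) (\<lambda>t. f t + g t) t = (dplus ^^ n) f t + (dplus ^^ n) g t"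
proof -
  define F where "F n t = (dplus ^^ n) f t + (dplus ^^ n) g t" for n t
  have F: "(F n has_vector_derivative F (Suc n) t) (at t within {0..})" if "t \<ge> 0" for n t
    unfolding F_def by (intro has_vector_derivative_add schwartz_deriv f g that)
  have F0: "F 0 t = f t + g t" for t by (simp add: F_def)
  show "(\<lambda>t. f t + g t) \<in> schwartz_plus"
    by (rule schwartzI[where F = F, OF F0 F]) (auto simp: F_def[abs_def] intro: rapid_add schwartz_rapid f g)
  show "t \<ge> 0 \<Longrightarrow> (dplus ^^ n) (\<lambda>t. f t + g t) t = (dplus ^^ n) f t + (dplus ^^ n) g t"
    using dplus_iter[where F = F, OF F0 F] by (simp add: F_def)
qed

lemma schwartz_scale:
  assumes f: "f \<in> schwartz_plus"
  shows "(\<lambda>t. c * f t) \<in> schwartz_plus"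
    and "t \<ge> 0 \<Longrightarrow> (dplus ^^ n) (\<lambda>t. c * f t) t = c * (dplus ^^ n) f t"
proof -
  define F where "F n t = c * (dplus ^^ n) f t" for n t
  have F: "(F n has_vector_derivative F (Suc n) t) (at t within {0..})" if "t \<ge> 0" for n t
    unfolding F_def by (intro has_vector_derivative_mult_right schwartz_deriv f that)
  have F0: "F 0 t = c * f t" for t by (simp add: F_def)
  show "(\<lambda>t. c * f t) \<in> schwartz_plus"
    by (rule schwartzI[where F = F, OF F0 F]) (auto simp: F_def[abs_def] intro: rapid_scale schwartz_rapid f)
  show "t \<ge> 0 \<Longrightarrow> (dplus ^^ n) (\<lambda>t. c * f t) t = c * (dplus ^^ n) f t"
    using dplus_iter[where F = F, OF F0 F] by (simp add: F_def)
qed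

section \<open>Weyl integrals: decay and differentiation\<close>

text \<open>The translation s = t + u frees the weight and the domain from t, so that only f remains
  to be differentiated.\<close>

lemma weyl_int_rplus:
  "weyl_int a f t = (1 / Gamma a) *\<^sub>R (LINT u|rplus. (u powr (a - 1)) *\<^sub>R f (t + u))"
proof -
  have "(LBINT s:{t<..}. ((s - t) powr (a - 1)) *\<^sub>R f s)
     = (LINT s|lborel. indicator {t<..} (t + 1 * s) *\<^sub>R (((t + 1 * s - t) powr (a - 1)) *\<^sub>R f (t + 1 * s)))"
    unfolding set_lebesgue_integral_def by (subst lborel_integral_real_affine[of 1 _ t]) auto
  also have "\<dots> = (LINT u|rplus. (u powr (a - 1)) *\<^sub>R f (t + u))"
    unfolding rplus_def by (subst integral_restrict_space)
      (auto intro!: Bochner_Integration.integral_cong simp: indicator_def)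
  finally show ?thesis by (simp add: weyl_int_def)
qed

lemma rapid_measurable:
  assumes "rapid g" "t \<ge> 0" shows "(\<lambda>u. g (t + u)) \<in> borel_measurable rplus"
proof -
  \<comment> \<open>Values of g off the half-line are arbitrary; cutting them off gives a Borel
    function that agrees where it matters.\<close>
  have [measurable]: "(\<lambda>x. indicator {0..} x *\<^sub>R g x) \<in> borel_measurable borel"
    using assms by (intro borel_measurable_continuous_on_indicator) (auto simp: rapid_def)
  have "(\<lambda>u. indicator {0..} (t + u) *\<^sub>R g (t + u)) \<in> borel_measurable borel" by measurable
  then have "(\<lambda>u. indicator {0..} (t + u) *\<^sub>R g (t + u)) \<in> borel_measurable rplus" by (rule borel_measurable_rplusI)
  then show ?thesis
    by (rule measurable_cong[THEN iffD1, rotated]) (use assms in auto)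
qed

lemma integrable_beta_power:
  assumes "a > 0" "a < real N"
  shows "integrable rplus (\<lambda>u. u powr (a - 1) * (C / (1 + u) ^ N))"
proof -
  have "integrable rplus (\<lambda>u. C * (u powr (a - 1) / (1 + u) powr real N))"
    by (intro integrable_mult_right integrable_rplus_beta assms)
  then show ?thesis by (rule integrable_rplus_cong) (auto simp: powr_realpow)
qed

lemma weyl_integrable:
  assumes g: "rapid g" and a: "a > 0" and t: "t \<ge> 0"
  shows "integrable rplus (\<lambda>u. (u powr (a - 1)) *\<^sub>R g (t + u))"
proof -
  obtain N :: nat where N: "a < real N" using reals_Archimedean2 by blast
  obtain C where C: "C \<ge> 0" "\<And>t. t \<ge> 0 \<Longrightarrow> norm (g t) \<le> C / (1 + t) ^ N" using rapidE[OF g] by blast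
  note [measurable] = rapid_measurable[OF g t]
  show ?thesis
  proof (rule Bochner_Integration.integrable_bound[OF integrable_beta_power[OF a N, of C]])
    show "AE u in rplus. norm ((u powr (a - 1)) *\<^sub>R g (t + u)) \<le> norm (u powr (a - 1) * (C / (1 + u) ^ N))"
    proof (rule AE_rplus_I)
      fix u :: real assume u: "u > 0"
      have "norm (g (t + u)) \<le> C / (1 + (t + u)) ^ N" using t u by (intro C) auto
      also have "\<dots> \<le> C / (1 + u) ^ N" using t u C by (intro divide_left_mono power_mono mult_pos_pos) auto
      finally have "u powr (a - 1) * norm (g (t + u)) \<le> u powr (a - 1) * (C / (1 + u) ^ N)"
        by (intro mult_left_mono) auto
      then show "norm ((u powr (a - 1)) *\<^sub>R g (t + u)) \<le> norm (u powr (a - 1) * (C / (1 + u) ^ N))"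
        unfolding norm_scaleR real_norm_def abs_mult[of "u powr (a - 1)"] using C u by simp
    qed
  qed measurable
qed

lemma weyl_bound:
  assumes g: "rapid g" and a: "a > 0"
  shows "\<exists>C\<ge>0. \<forall>t\<ge>0. norm (weyl_int a g t) \<le> C / (1 + t) ^ M"
proof -
  obtain N :: nat where N: "a < real N" using reals_Archimedean2 by blast
  \<comment> \<open>(1 + t + u)^(N + M) \<ge> (1 + u)^N (1 + t)^M: the first factor makes the
    integral converge, the second is the desired decay.\<close>
  obtain C where C: "C \<ge> 0" "\<And>t. t \<ge> 0 \<Longrightarrow> norm (g t) \<le> C / (1 + t) ^ (N + M)" using rapidE[OF g] by blast
  define I where "I = (LINT u|rplus. u powr (a - 1) * (C / (1 + u) ^ N))"
  have I: "I \<ge> 0" unfolding I_def using C by (intro integral_nonneg_AE AE_rplus_I) auto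
  show ?thesis
  proof (intro exI conjI allI impI)
    show "0 \<le> I / Gamma a" using I a by simp
    fix t :: real assume t: "t \<ge> 0"
    have "norm (LINT u|rplus. (u powr (a - 1)) *\<^sub>R g (t + u)) \<le> (LINT u|rplus. norm ((u powr (a - 1)) *\<^sub>R g (t + u)))"
      by (rule integral_norm_bound)
    also have "\<dots> \<le> (LINT u|rplus. u powr (a - 1) * (C / (1 + u) ^ N) / (1 + t) ^ M)"
    proof (rule integral_mono)
      show "integrable rplus (\<lambda>u. norm ((u powr (a - 1)) *\<^sub>R g (t + u)))"
        by (intro integrable_norm weyl_integrable g a t)
      show "integrable rplus (\<lambda>u. u powr (a - 1) * (C / (1 + u) ^ N) / (1 + t) ^ M)"
        by (intro integrable_divide integrable_beta_power a N)
      fix u assume "u \<in> space rplus"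
      then have u: "u > 0" by simp
      have "norm (g (t + u)) \<le> C / (1 + (t + u)) ^ (N + M)" using t u by (intro C) auto
      also have "\<dots> \<le> C / ((1 + u) ^ N * (1 + t) ^ M)"
        unfolding power_add using t u C by (intro divide_left_mono mult_mono power_mono mult_pos_pos) auto
      finally have "u powr (a - 1) * norm (g (t + u)) \<le> u powr (a - 1) * (C / ((1 + u) ^ N * (1 + t) ^ M))"
        by (intro mult_left_mono) auto
      then show "norm ((u powr (a - 1)) *\<^sub>R g (t + u)) \<le> u powr (a - 1) * (C / (1 + u) ^ N) / (1 + t) ^ M"
        by simp
    qed
    also have "\<dots> = I / (1 + t) ^ M" unfolding I_def by (rule integral_divide_zero)
    finally have "norm (LINT u|rplus. (u powr (a - 1)) *\<^sub>R g (t + u)) / Gamma a \<le> I / (1 + t) ^ M / Gamma a"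
      using a by (intro divide_right_mono) auto
    then show "norm (weyl_int a g t) \<le> I / Gamma a / (1 + t) ^ M"
      unfolding weyl_int_rplus using a by (simp add: mult.commute)
  qed
qed

lemma weyl_add:
  assumes "rapid f" "rapid g" "a > 0" "t \<ge> 0"
  shows "weyl_int a (\<lambda>t. f t + g t) t = weyl_int a f t + weyl_int a g t"
  unfolding weyl_int_rplus using assms weyl_integrable by (simp add: scaleR_add_right)

lemma weyl_scale: "weyl_int a (\<lambda>t. c * f t) t = c * weyl_int a f t"
proof -
  have "(LINT u|rplus. (u powr (a - 1)) *\<^sub>R (c * f (t + u))) = c * (LINT u|rplus. (u powr (a - 1)) *\<^sub>R f (t + u))"
    unfolding mult_scaleR_right[symmetric] by (rule integral_mult_right_zero)
  then show ?thesis by (simp add: weyl_int_rplus)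
qed

lemma weyl_cong:
  assumes "\<And>s. s > t \<Longrightarrow> f s = g s" shows "weyl_int a f t = weyl_int a g t"
  unfolding weyl_int_rplus using assms by (intro arg_cong[where f = "(*\<^sub>R) _"] Bochner_Integration.integral_cong) auto

lemma quadratic_has_vector_derivative:
  fixes G :: "real \<Rightarrow> complex"
  assumes K: "\<And>y. y \<in> S \<Longrightarrow> norm (G y - G x - (y - x) *\<^sub>R D) \<le> K * (y - x)\<^sup>2"
  shows "(G has_vector_derivative D) (at x within S)"
  unfolding has_vector_derivative_def has_derivative_within_alt
proof (intro conjI allI impI)
  show "bounded_linear (\<lambda>x. x *\<^sub>R D)" by (rule bounded_linear_scaleR_left)
  fix e :: real assume e: "e > 0"
  show "\<exists>d>0. \<forall>y\<in>S. norm (y - x) < d \<longrightarrow> norm (G y - G x - (y - x) *\<^sub>R D) \<le> e * norm (y - x)"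
  proof (intro exI[of _ "e / (\<bar>K\<bar> + 1)"] conjI ballI impI)
    fix y assume y: "y \<in> S" "norm (y - x) < e / (\<bar>K\<bar> + 1)"
    have "norm (G y - G x - (y - x) *\<^sub>R D) \<le> K * (y - x)\<^sup>2" by (rule K[OF y(1)])
    also have "\<dots> \<le> (\<bar>K\<bar> + 1) * (y - x)\<^sup>2" by (intro mult_right_mono) auto
    also have "(y - x)\<^sup>2 = norm (y - x) * norm (y - x)" by (simp add: power2_eq_square)
    also have "(\<bar>K\<bar> + 1) * (norm (y - x) * norm (y - x)) \<le> (\<bar>K\<bar> + 1) * (e / (\<bar>K\<bar> + 1) * norm (y - x))"
      using y by (intro mult_left_mono mult_right_mono) auto
    also have "\<dots> = e * norm (y - x)" by simp
    finally show "norm (G y - G x - (y - x) *\<^sub>R D) \<le> e * norm (y - x)" .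
  qed (use e in simp)
qed

text \<open>Differentiation under the integral by integrating a Taylor remainder: it is quadratic in
  y - t with a factor decaying in u fast enough to be integrated against u^(a-1). The estimate is
  the same at the endpoint 0, where the derivative is one-sided.\<close>

lemma weyl_has_vector_derivative:
  assumes f: "f \<in> schwartz_plus" and a: "a > 0" and t: "t \<ge> 0"
  shows "(weyl_int a ((dplus ^^ n) f) has_vector_derivative weyl_int a ((dplus ^^ Suc n) f) t) (at t within {0..})"
proof -
  define F where "F k = (dplus ^^ k) f" for k
  have d: "(F k has_vector_derivative F (Suc k) t) (at t within {0..})" if "t \<ge> 0" for k t
    using schwartz_deriv[OF f that] by (simp add: F_def)
  have r: "rapid (F k)" for k unfolding F_def by (rule schwartz_rapid[OF f])
  obtain N :: nat where N: "a < real N" using reals_Archimedean2 by blast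
  obtain C where C: "C \<ge> 0" "\<And>t. t \<ge> 0 \<Longrightarrow> norm (F (n + 2) t) \<le> C / (1 + t) ^ N" using rapidE[OF r] by blast
  define I where "I = (LINT u|rplus. u powr (a - 1) * (C / (1 + u) ^ N))"
  \<comment> \<open>The second derivative is bounded by C / (1 + u)^N on the whole segment, since
    both of its endpoints are at least u. Integrating this bound twice gives the remainder.\<close>
  have rem: "norm (F n y - F n x - (y - x) *\<^sub>R F (Suc n) x) \<le> (y - x)\<^sup>2 * (C / (1 + u) ^ N)"
    if u: "u \<ge> 0" and x: "x \<ge> u" and y: "y \<ge> u" for x y u
  proof -
    define S where "S = closed_segment x y"
    have S: "S \<subseteq> {u..}" using closed_segment_subset[of x "{u..}" y] x y by (auto simp: S_def)
    have S0: "S \<subseteq> {0..}" using S u by auto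
    have sz: "norm (z - x) \<le> norm (y - x)" if "z \<in> S" for z
      using that segment_bound(1)[of z x y] by (simp add: S_def norm_minus_commute)
    have C2: "norm (F (n + 2) z) \<le> C / (1 + u) ^ N" if z: "z \<in> S" for z
    proof -
      have "norm (F (n + 2) z) \<le> C / (1 + z) ^ N" using z S0 by (intro C) auto
      also have "\<dots> \<le> C / (1 + u) ^ N" using z S u C by (intro divide_left_mono power_mono mult_pos_pos) (auto simp: add_pos_nonneg)
      finally show ?thesis .
    qed
    have lip: "norm (F (Suc n) z - F (Suc n) x) \<le> norm (y - x) * (C / (1 + u) ^ N)" if z: "z \<in> S" for z
    proof -
      have "norm (F (Suc n) z - F (Suc n) x) \<le> (C / (1 + u) ^ N) * norm (z - x)"
      proof (rule differentiable_bound[of S])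
        show "(F (Suc n) has_derivative (\<lambda>h. h *\<^sub>R F (n + 2) w)) (at w within S)" if "w \<in> S" for w
          using has_vector_derivative_within_subset[OF d S0, of w "Suc n"] that S0
          by (auto simp: has_vector_derivative_def)
        show "onorm (\<lambda>h. h *\<^sub>R F (n + 2) w) \<le> C / (1 + u) ^ N" if "w \<in> S" for w
          by (rule order_trans[OF _ C2[OF that]]) (intro onorm_le, simp add: mult.commute)
      qed (use z in \<open>auto simp: S_def\<close>)
      also have "\<dots> \<le> (C / (1 + u) ^ N) * norm (y - x)" using sz[OF z] C u by (intro mult_left_mono) auto
      finally show ?thesis by (simp only: mult.commute)
    qed
    have "norm (F n y - F n x - (y - x) *\<^sub>R F (Suc n) x) \<le> norm (y - x) * (norm (y - x) * (C / (1 + u) ^ N))"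
    proof (rule vector_differentiable_bound_linearization[of S])
      show "(F n has_vector_derivative F (Suc n) w) (at w within S)" if "w \<in> S" for w
        using has_vector_derivative_within_subset[OF d S0, of w n] that S0 by auto
    qed (use lip in \<open>auto simp: S_def\<close>)
    then show ?thesis by (simp add: power2_eq_square mult.assoc flip: abs_mult)
  qed
  have "(weyl_int a (F n) has_vector_derivative weyl_int a (F (Suc n)) t) (at t within {0..})"
  proof (rule quadratic_has_vector_derivative[where K = "I / Gamma a"])
    fix y :: real assume "y \<in> {0..}"
    then have y: "y \<ge> 0" by simp
    have i: "integrable rplus (\<lambda>u. (u powr (a - 1)) *\<^sub>R F n (y + u))" "integrable rplus (\<lambda>u. (u powr (a - 1)) *\<^sub>R F n (t + u))"
      "integrable rplus (\<lambda>u. (y - t) *\<^sub>R ((u powr (a - 1)) *\<^sub>R F (Suc n) (t + u)))"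
      by (intro integrable_scaleR_right weyl_integrable r a t y)+
    define R where "R u = (u powr (a - 1)) *\<^sub>R F n (y + u) - (u powr (a - 1)) *\<^sub>R F n (t + u)
        - (y - t) *\<^sub>R ((u powr (a - 1)) *\<^sub>R F (Suc n) (t + u))" for u
    have iR: "integrable rplus R"
      unfolding R_def by (intro Bochner_Integration.integrable_diff i)
    have IR: "(LINT u|rplus. R u) = (LINT u|rplus. (u powr (a - 1)) *\<^sub>R F n (y + u)) - (LINT u|rplus. (u powr (a - 1)) *\<^sub>R F n (t + u))
         - (y - t) *\<^sub>R (LINT u|rplus. (u powr (a - 1)) *\<^sub>R F (Suc n) (t + u))"
      unfolding R_def
      by (simp only: Bochner_Integration.integral_diff[OF Bochner_Integration.integrable_diff[OF i(1,2)] i(3)]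
          Bochner_Integration.integral_diff[OF i(1,2)] integral_scaleR_right)
    have "norm (LINT u|rplus. R u) \<le> (LINT u|rplus. norm (R u))"
      by (rule integral_norm_bound)
    also have "(LINT u|rplus. norm (R u)) \<le> (LINT u|rplus. (y - t)\<^sup>2 * (u powr (a - 1) * (C / (1 + u) ^ N)))"
    proof (rule integral_mono)
      fix u assume "u \<in> space rplus"
      then have u: "u > 0" by simp
      have "R u = (u powr (a - 1)) *\<^sub>R (F n (y + u) - F n (t + u) - ((y + u) - (t + u)) *\<^sub>R F (Suc n) (t + u))"
        unfolding R_def by (simp add: scaleR_diff_right mult.commute)
      then have "norm (R u) = u powr (a - 1) * norm (F n (y + u) - F n (t + u) - ((y + u) - (t + u)) *\<^sub>R F (Suc n) (t + u))"
        by simp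
      moreover have "u powr (a - 1) * norm (F n (y + u) - F n (t + u) - ((y + u) - (t + u)) *\<^sub>R F (Suc n) (t + u))
          \<le> u powr (a - 1) * (((y + u) - (t + u))\<^sup>2 * (C / (1 + u) ^ N))"
        using u y t by (intro mult_left_mono rem) auto
      ultimately show "norm (R u) \<le> (y - t)\<^sup>2 * (u powr (a - 1) * (C / (1 + u) ^ N))"
        by (simp add: mult.left_commute)
    qed (intro integrable_norm iR integrable_mult_right integrable_beta_power a N)+
    also have "\<dots> = (y - t)\<^sup>2 * I" unfolding I_def by (rule integral_mult_right_zero)
    finally have n: "norm (LINT u|rplus. R u) \<le> (y - t)\<^sup>2 * I" .
    have "weyl_int a (F n) y - weyl_int a (F n) t - (y - t) *\<^sub>R weyl_int a (F (Suc n)) t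
      = (1 / Gamma a) *\<^sub>R (LINT u|rplus. R u)"
      unfolding weyl_int_rplus IR by (simp add: scaleR_diff_right)
    then have "norm (weyl_int a (F n) y - weyl_int a (F n) t - (y - t) *\<^sub>R weyl_int a (F (Suc n)) t)
      = norm (LINT u|rplus. R u) / Gamma a"
      using Gamma_real_pos[OF a] by simp
    also have "\<dots> \<le> (y - t)\<^sup>2 * I / Gamma a" using a n by (intro divide_right_mono) auto
    finally show "norm (weyl_int a (F n) y - weyl_int a (F n) t - (y - t) *\<^sub>R weyl_int a (F (Suc n)) t) \<le> I / Gamma a * (y - t)\<^sup>2"
      by (simp add: mult.commute)
  qed
  then show ?thesis by (simp add: F_def)
qed

lemma weyl_schwartz_iter:
  assumes f: "f \<in> schwartz_plus" and a: "a > 0" and t: "t \<ge> 0"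
  shows "(dplus ^^ n) (weyl_int a f) t = weyl_int a ((dplus ^^ n) f) t"
  using dplus_iter[where F = "\<lambda>n. weyl_int a ((dplus ^^ n) f)", OF _ weyl_has_vector_derivative[OF f a] t, of "weyl_int a f"]
  by simp

lemma weyl_rapid:
  assumes f: "f \<in> schwartz_plus" and a: "a > 0"
  shows "rapid (weyl_int a ((dplus ^^ n) f))"
  unfolding rapid_def
proof (intro conjI allI)
  show "continuous_on {0..} (weyl_int a ((dplus ^^ n) f))"
    unfolding continuous_on_eq_continuous_within
    using weyl_has_vector_derivative[OF f a] has_vector_derivative_continuous by (metis atLeast_iff)
  show "\<exists>C\<ge>0. \<forall>t\<ge>0. norm (weyl_int a ((dplus ^^ n) f) t) \<le> C / (1 + t) ^ N" for N
    by (rule weyl_bound[OF schwartz_rapid[OF f] a])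
qed

section \<open>Weyl derivatives and the semigroup law\<close>

text \<open>For an integer a this is a + 1 and not a, so that the order of the accompanying Weyl
  integral is positive in every case.\<close>

definition weyl_order :: "real \<Rightarrow> nat" where "weyl_order a = nat (\<lfloor>a\<rfloor> + 1)"

lemma weyl_order_greater: "a \<ge> 0 \<Longrightarrow> real (weyl_order a) - a > 0"
  unfolding weyl_order_def by linarith

text \<open>The derivatives are moved through the integral onto f, which leaves an absolutely
  convergent integral of a rapidly decreasing function.\<close>

lemma weyl_deriv_eq:
  assumes f: "f \<in> schwartz_plus" and a: "a > 0" and t: "t \<ge> 0"
  shows "weyl_deriv a f t = (- 1) ^ weyl_order a * weyl_int (real (weyl_order a) - a) ((dplus ^^ weyl_order a) f) t"
  using weyl_schwartz_iter[OF f weyl_order_greater t, of a "weyl_order a"] a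
  by (simp add: weyl_deriv_def Let_def weyl_order_def)

text \<open>Fubini in the form \<open>\<integral> du \<integral> dr\<close> over \<open>0 < u < r\<close>: the inner integral over \<open>u\<close> is a scaled beta integral.\<close>

lemma weyl_semigroup:
  assumes g: "rapid g" and a: "a > 0" and b: "b > 0" and t: "t \<ge> 0"
  shows "weyl_int a (weyl_int b g) t = weyl_int (a + b) g t"
proof -
  define k where "k u r = (if u < r then u powr (a - 1) * (r - u) powr (b - 1) else 0)" for u r :: real
  define H where "H u r = k u r *\<^sub>R g (t + r)" for u r
  note [measurable] = rapid_measurable[OF g t]
  have km: "(\<lambda>x. k (fst x) (snd x)) \<in> borel_measurable (rplus \<Otimes>\<^sub>M rplus)"
    by (rule measurable_rplus_pair) (unfold k_def, measurable)
  note [measurable] = km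
  have Hm: "(\<lambda>x. H (fst x) (snd x)) \<in> borel_measurable (rplus \<Otimes>\<^sub>M rplus)"
    unfolding H_def by measurable
  have k0: "k u r \<ge> 0" for u r by (simp add: k_def)
  have beta: "has_bochner_integral rplus (\<lambda>u. k u r) (r powr (a + b - 1) * Beta a b)" if r: "r > 0" for r
  proof -
    have "has_bochner_integral rplus (\<lambda>v. indicator {0..1} v * (v powr (a - 1) * (1 - v) powr (b - 1))) (Beta a b)"
      by (rule has_bochner_integral_rplus[OF _ _ _ _ has_integral_Beta_real[OF a b]]) auto
    then have B: "integrable rplus (\<lambda>v. indicator {0..1} v * (v powr (a - 1) * (1 - v) powr (b - 1)))"
      "(LINT v|rplus. indicator {0..1} v * (v powr (a - 1) * (1 - v) powr (b - 1))) = Beta a b"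
      by (auto simp: has_bochner_integral_iff)
    have eq: "(r powr (a + b - 1) / r) * (indicator {0..1} (1 / r * u) * ((1 / r * u) powr (a - 1) * (1 - 1 / r * u) powr (b - 1))) = k u r"
      if u: "u > 0" for u
    proof (cases "u < r")
      case True
      have "1 - u / r = (r - u) / r" using r by (simp add: field_simps)
      then have e1: "(1 / r * u) powr (a - 1) * (1 - 1 / r * u) powr (b - 1) = u powr (a - 1) * (r - u) powr (b - 1) / (r powr (a - 1) * r powr (b - 1))"
        using r u True by (simp add: powr_divide)
      have e2: "r powr (a + b - 1) = r powr (a - 1) * r powr (b - 1) * r"
      proof -
        have "r powr (a - 1) * r powr (b - 1) * r powr 1 = r powr (a + b - 1)"
          unfolding powr_add[symmetric] by (simp add: algebra_simps)
        then show ?thesis using r by simp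
      qed
      have ind: "indicator {0..1} (1 / r * u) = (1::real)" using True r u by (simp add: indicator_def)
      show ?thesis unfolding ind e1 e2 using True r u by (simp add: k_def)
    next
      case False
      then show ?thesis using r u by (cases "u = r") (auto simp: k_def indicator_def)
    qed
    have rr: "1 / r > 0" using r by simp
    have "integrable rplus (\<lambda>u. (r powr (a + b - 1) / r) * (indicator {0..1} (1 / r * u) * ((1 / r * u) powr (a - 1) * (1 - 1 / r * u) powr (b - 1))))"
      by (intro integrable_mult_right integral_rplus_scale(2)[OF rr B(1)])
    then have i: "integrable rplus (\<lambda>u. k u r)" by (rule integrable_rplus_cong) (use eq in auto)
    have "(LINT u|rplus. k u r) = (LINT u|rplus. (r powr (a + b - 1) / r) * (indicator {0..1} (1 / r * u) * ((1 / r * u) powr (a - 1) * (1 - 1 / r * u) powr (b - 1))))"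
      using eq by (intro Bochner_Integration.integral_cong) auto
    also have "\<dots> = (r powr (a + b - 1) / r) * (LINT u|rplus. indicator {0..1} (1 / r * u) * ((1 / r * u) powr (a - 1) * (1 - 1 / r * u) powr (b - 1)))"
      by (rule integral_mult_right_zero)
    also have "\<dots> = r powr (a + b - 1) * Beta a b"
      using integral_rplus_scale(1)[OF rr B(1)] r unfolding B(2) by (simp add: field_simps)
    finally show ?thesis using i by (simp add: has_bochner_integral_iff)
  qed
  have Bpos: "Beta a b > 0" using a b by (auto simp: Beta_def intro!: divide_pos_pos mult_pos_pos Gamma_real_pos)
  have ig: "integrable rplus (\<lambda>r. (r powr (a + b - 1)) *\<^sub>R g (t + r))"
    using a b by (intro weyl_integrable g t) auto
  have "(\<integral>\<^sup>+x. ennreal (norm (H (fst x) (snd x))) \<partial>(rplus \<Otimes>\<^sub>M rplus)) = (\<integral>\<^sup>+r. \<integral>\<^sup>+u. ennreal (norm (H u r)) \<partial>rplus \<partial>rplus)"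
    using rplus2.nn_integral_snd[of "\<lambda>x. ennreal (norm (H (fst x) (snd x)))"] Hm by simp
  also have "\<dots> = (\<integral>\<^sup>+r. ennreal (norm (Beta a b *\<^sub>R ((r powr (a + b - 1)) *\<^sub>R g (t + r)))) \<partial>rplus)"
  proof (rule nn_integral_cong)
    fix r assume "r \<in> space rplus"
    then have r: "r > 0" by simp
    have [measurable]: "(\<lambda>u. k u r) \<in> borel_measurable rplus"
      using beta[OF r] by (simp add: has_bochner_integral_iff borel_measurable_integrable)
    have "(\<integral>\<^sup>+u. ennreal (norm (H u r)) \<partial>rplus) = (\<integral>\<^sup>+u. ennreal (norm (g (t + r))) * ennreal (k u r) \<partial>rplus)"
      using k0 by (intro nn_integral_cong) (auto simp: H_def ennreal_mult[symmetric] mult.commute)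
    also have "\<dots> = ennreal (norm (g (t + r))) * (\<integral>\<^sup>+u. ennreal (k u r) \<partial>rplus)"
      by (rule nn_integral_cmult) measurable
    also have "(\<integral>\<^sup>+u. ennreal (k u r) \<partial>rplus) = ennreal (r powr (a + b - 1) * Beta a b)"
      using beta[OF r] k0 by (subst nn_integral_eq_integral) (auto simp: has_bochner_integral_iff)
    finally show "(\<integral>\<^sup>+u. ennreal (norm (H u r)) \<partial>rplus) = ennreal (norm (Beta a b *\<^sub>R ((r powr (a + b - 1)) *\<^sub>R g (t + r))))"
      using Bpos by (simp add: ennreal_mult[symmetric] mult_ac)
  qed
  also have "\<dots> < \<infinity>"
    using integrable_scaleR_right[OF ig, of "Beta a b"] by (simp add: integrable_iff_bounded)
  finally have "integrable (rplus \<Otimes>\<^sub>M rplus) (\<lambda>x. H (fst x) (snd x))"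
    using Hm by (intro integrableI_bounded) auto
  then have iH: "integrable (rplus \<Otimes>\<^sub>M rplus) (case_prod H)" by (simp add: case_prod_beta')
  have fub: "(LINT r|rplus. LINT u|rplus. H u r) = (LINT u|rplus. LINT r|rplus. H u r)"
    by (rule rplus2.Fubini_integral[OF iH])
  have "(LINT u|rplus. H u r) = (r powr (a + b - 1) * Beta a b) *\<^sub>R g (t + r)" if "r > 0" for r
    using beta[OF that] unfolding H_def by (auto simp: has_bochner_integral_iff integral_scaleR_left)
  then have "(LINT r|rplus. LINT u|rplus. H u r) = (LINT r|rplus. Beta a b *\<^sub>R ((r powr (a + b - 1)) *\<^sub>R g (t + r)))"
    by (intro Bochner_Integration.integral_cong) (auto simp: mult.commute)
  also have "\<dots> = Beta a b *\<^sub>R (LINT r|rplus. (r powr (a + b - 1)) *\<^sub>R g (t + r))"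
    by (rule integral_scaleR_right)
  finally have L: "(LINT r|rplus. LINT u|rplus. H u r) = Beta a b *\<^sub>R (LINT r|rplus. (r powr (a + b - 1)) *\<^sub>R g (t + r))" .
  \<comment> \<open>In the other order the shift of r by u recovers the inner Weyl integral at the
    point t + u.\<close>
  have inner: "(LINT r|rplus. H u r) = (u powr (a - 1)) *\<^sub>R (Gamma b *\<^sub>R weyl_int b g (t + u))" if u: "u > 0" for u
  proof -
    have "(LINT r|rplus. H u r) = (LINT r|lborel. indicator {0<..} r *\<^sub>R H u r)"
      unfolding rplus_def by (subst integral_restrict_space) auto
    also have "\<dots> = (LINT r|lborel. indicator {0<..} (u + 1 * r) *\<^sub>R H u (u + 1 * r))"
      by (subst lborel_integral_real_affine[of 1 _ u]) auto
    also have "\<dots> = (LINT r|lborel. indicator {0<..} r *\<^sub>R ((u powr (a - 1)) *\<^sub>R ((r powr (b - 1)) *\<^sub>R g (t + u + r))))"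
      using u by (intro Bochner_Integration.integral_cong) (auto simp: H_def k_def indicator_def add.assoc)
    also have "\<dots> = (LINT r|rplus. (u powr (a - 1)) *\<^sub>R ((r powr (b - 1)) *\<^sub>R g (t + u + r)))"
      unfolding rplus_def by (subst integral_restrict_space) auto
    also have "\<dots> = (u powr (a - 1)) *\<^sub>R (LINT r|rplus. (r powr (b - 1)) *\<^sub>R g (t + u + r))"
      by (rule integral_scaleR_right)
    also have "(LINT r|rplus. (r powr (b - 1)) *\<^sub>R g (t + u + r)) = Gamma b *\<^sub>R weyl_int b g (t + u)"
    proof -
      have "Gamma b > 0" using b by (rule Gamma_real_pos)
      then show ?thesis unfolding weyl_int_rplus by simp
    qed
    finally show ?thesis .
  qed
  have "(LINT u|rplus. LINT r|rplus. H u r) = (LINT u|rplus. Gamma b *\<^sub>R ((u powr (a - 1)) *\<^sub>R weyl_int b g (t + u)))"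
    using inner by (intro Bochner_Integration.integral_cong) (auto simp: mult.commute)
  also have "\<dots> = Gamma b *\<^sub>R (LINT u|rplus. (u powr (a - 1)) *\<^sub>R weyl_int b g (t + u))"
    by (rule integral_scaleR_right)
  finally have R: "Gamma b *\<^sub>R (LINT u|rplus. (u powr (a - 1)) *\<^sub>R weyl_int b g (t + u))
      = Beta a b *\<^sub>R (LINT r|rplus. (r powr (a + b - 1)) *\<^sub>R g (t + r))"
    using fub L by simp
  have G: "Gamma a > 0" "Gamma b > 0" "Gamma (a + b) > 0" using a b by auto
  have "weyl_int a (weyl_int b g) t = (1 / (Gamma a * Gamma b)) *\<^sub>R (Gamma b *\<^sub>R (LINT u|rplus. (u powr (a - 1)) *\<^sub>R weyl_int b g (t + u)))"
    unfolding weyl_int_rplus[of a] using G by simp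
  also have "\<dots> = weyl_int (a + b) g t"
    unfolding R weyl_int_rplus[of "a + b"] using G by (simp add: Beta_def)
  finally show ?thesis .
qed

text \<open>The fundamental theorem of calculus on intervals of length k; the boundary term at
  infinity vanishes by rapid decay.\<close>

lemma weyl_int_1:
  assumes f: "f \<in> schwartz_plus" and t: "t \<ge> 0"
  shows "weyl_int 1 ((dplus ^^ Suc n) f) t = - (dplus ^^ n) f t"
proof -
  define F where "F k = (dplus ^^ k) f" for k
  have d: "(F k has_vector_derivative F (Suc k) t) (at t within {0..})" if "t \<ge> 0" for k t
    using schwartz_deriv[OF f that] by (simp add: F_def)
  have r: "rapid (F k)" for k unfolding F_def by (rule schwartz_rapid[OF f])
  have i: "integrable rplus (\<lambda>u. F (Suc n) (t + u))"
  proof -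
    have "integrable rplus (\<lambda>u. (u powr (1 - 1)) *\<^sub>R F (Suc n) (t + u))" by (intro weyl_integrable r t) simp
    then show ?thesis by (rule integrable_rplus_cong) auto
  qed
  have part: "(LINT u|rplus. indicator {..real k} u *\<^sub>R F (Suc n) (t + u)) = F n (t + real k) - F n t" for k :: nat
  proof -
    have "(LINT u|lborel. indicator {0..real k} u *\<^sub>R F (Suc n) (t + u)) = F n (t + real k) - F n (t + 0)"
    proof (rule integral_FTC_Icc)
      fix u assume u: "0 \<le> u" "u \<le> real k"
      have "((\<lambda>u. t + u) has_vector_derivative 1) (at u within {0..real k})"
        by (auto intro!: derivative_eq_intros)
      moreover have "(F n has_vector_derivative F (Suc n) (t + u)) (at (t + u) within (\<lambda>u. t + u) ` {0..real k})"
        using t u by (intro has_vector_derivative_within_subset[OF d]) auto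
      ultimately have "((F n \<circ> (\<lambda>u. t + u)) has_vector_derivative 1 *\<^sub>R F (Suc n) (t + u)) (at u within {0..real k})"
        by (rule vector_diff_chain_within)
      then show "((\<lambda>u. F n (t + u)) has_vector_derivative F (Suc n) (t + u)) (at u within {0..real k})"
        by (simp add: o_def)
    next
      have "continuous_on {0..} (F (Suc n))" using r by (simp add: rapid_def)
      then show "continuous_on {0..real k} (\<lambda>u. F (Suc n) (t + u))"
      proof (rule continuous_on_compose2)
        show "continuous_on {0..real k} (\<lambda>u. t + u)" by (intro continuous_on_add continuous_on_const continuous_on_id)
      qed (use t in auto)
    qed simp
    moreover have "(LINT u|rplus. indicator {..real k} u *\<^sub>R F (Suc n) (t + u)) = (LINT u|lborel. indicator {0<..} u *\<^sub>R (indicator {..real k} u *\<^sub>R F (Suc n) (t + u)))"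
      unfolding rplus_def by (subst integral_restrict_space) auto
    moreover have "\<dots> = (LINT u|lborel. indicator {0..real k} u *\<^sub>R F (Suc n) (t + u))"
    proof (rule integral_cong_AE)
      \<comment> \<open>F is unspecified at negative arguments. The additional cutoff gives a
        measurable function without changing any value in use, as t + u \<ge> 0 there.\<close>
      have [measurable]: "(\<lambda>x. indicator {0..} x *\<^sub>R F (Suc n) x) \<in> borel_measurable borel"
        using r by (intro borel_measurable_continuous_on_indicator) (auto simp: rapid_def)
      have "(\<lambda>u. indicator {0<..} u *\<^sub>R (indicator {..real k} u *\<^sub>R (indicator {0..} (t + u) *\<^sub>R F (Suc n) (t + u)))) \<in> borel_measurable lborel"
        by measurable
      also have "(\<lambda>u. indicator {0<..} u *\<^sub>R (indicator {..real k} u *\<^sub>R (indicator {0..} (t + u) *\<^sub>R F (Suc n) (t + u))))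
        = (\<lambda>u. indicator {0<..} u *\<^sub>R (indicator {..real k} u *\<^sub>R F (Suc n) (t + u)))"
        using t by (auto simp: fun_eq_iff indicator_def)
      finally show "(\<lambda>u. indicator {0<..} u *\<^sub>R (indicator {..real k} u *\<^sub>R F (Suc n) (t + u))) \<in> borel_measurable lborel" .
      have "(\<lambda>u. indicator {0..real k} u *\<^sub>R (indicator {0..} (t + u) *\<^sub>R F (Suc n) (t + u))) \<in> borel_measurable lborel"
        by measurable
      also have "(\<lambda>u. indicator {0..real k} u *\<^sub>R (indicator {0..} (t + u) *\<^sub>R F (Suc n) (t + u))) = (\<lambda>u. indicator {0..real k} u *\<^sub>R F (Suc n) (t + u))"
        using t by (auto simp: fun_eq_iff indicator_def)
      finally show "(\<lambda>u. indicator {0..real k} u *\<^sub>R F (Suc n) (t + u)) \<in> borel_measurable lborel" .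
      show "AE u in lborel. indicator {0<..} u *\<^sub>R (indicator {..real k} u *\<^sub>R F (Suc n) (t + u)) = indicator {0..real k} u *\<^sub>R F (Suc n) (t + u)"
        using AE_lborel_singleton[of 0] by eventually_elim (auto simp: indicator_def)
    qed
    ultimately show ?thesis by simp
  qed
  have l1: "(\<lambda>k. LINT u|rplus. indicator {..real k} u *\<^sub>R F (Suc n) (t + u)) \<longlonglongrightarrow> (LINT u|rplus. F (Suc n) (t + u))"
  proof (rule integral_dominated_convergence[where w = "\<lambda>u. norm (F (Suc n) (t + u))"])
    show "AE u in rplus. (\<lambda>k. indicator {..real k} u *\<^sub>R F (Suc n) (t + u)) \<longlonglongrightarrow> F (Suc n) (t + u)"
    proof (rule AE_rplus_I)
      fix u :: real
      have "eventually (\<lambda>k. indicator {..real k} u *\<^sub>R F (Suc n) (t + u) = F (Suc n) (t + u)) sequentially"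
        using eventually_ge_at_top[of "nat \<lceil>u\<rceil>"] by eventually_elim (auto simp: indicator_def nat_le_iff ceiling_le_iff)
      then show "(\<lambda>k. indicator {..real k} u *\<^sub>R F (Suc n) (t + u)) \<longlonglongrightarrow> F (Suc n) (t + u)" by (rule tendsto_eventually)
    qed
    show "AE u in rplus. norm (indicator {..real k} u *\<^sub>R F (Suc n) (t + u)) \<le> norm (F (Suc n) (t + u))" for k
      by (intro AE_rplus_I) (auto simp: indicator_def)
  qed (use i rapid_measurable[OF r t] in auto)
  have l2: "(\<lambda>k. F n (t + real k)) \<longlonglongrightarrow> 0"
  proof -
    obtain C where C: "C \<ge> 0" "\<And>t. t \<ge> 0 \<Longrightarrow> norm (F n t) \<le> C / (1 + t) ^ 1" using rapidE[OF r] by blast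
    show ?thesis
    proof (rule Lim_null_comparison)
      show "\<forall>\<^sub>F k in sequentially. norm (F n (t + real k)) \<le> C * (1 / real (Suc k))"
      proof (intro always_eventually allI)
        fix k :: nat
        have "norm (F n (t + real k)) \<le> C / (1 + (t + real k))" using C(2)[of "t + real k"] t by simp
        also have "\<dots> \<le> C / real (Suc k)" using C t by (intro divide_left_mono) auto
        finally show "norm (F n (t + real k)) \<le> C * (1 / real (Suc k))" by simp
      qed
      have "(\<lambda>k. C * (1 / real (Suc k))) \<longlonglongrightarrow> C * 0"
        by (intro tendsto_mult tendsto_const LIMSEQ_inverse_real_of_nat[unfolded inverse_eq_divide])
      then show "(\<lambda>k. C * (1 / real (Suc k))) \<longlonglongrightarrow> 0" by simp
    qed
  qed
  have "(\<lambda>k. F n (t + real k) - F n t) \<longlonglongrightarrow> 0 - F n t" by (intro tendsto_diff l2 tendsto_const)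
  with l1 have "(LINT u|rplus. F (Suc n) (t + u)) = - F n t" unfolding part by (simp add: LIMSEQ_unique)
  moreover have "weyl_int 1 (F (Suc n)) t = (LINT u|rplus. F (Suc n) (t + u))"
    unfolding weyl_int_rplus by (auto intro!: Bochner_Integration.integral_cong)
  ultimately show ?thesis by (simp add: F_def)
qed

text \<open>One order at a time, by \<open>weyl_semigroup\<close> and \<open>weyl_int_1\<close>,
  each order contributing a sign.\<close>

lemma weyl_int_nat:
  assumes f: "f \<in> schwartz_plus" and t: "t \<ge> 0"
  shows "weyl_int (real (Suc k)) ((dplus ^^ (n + Suc k)) f) t = (- 1) ^ Suc k * (dplus ^^ n) f t"
proof (induction k)
  case 0
  then show ?case using weyl_int_1[OF f t, of n] by simp
next
  case (Suc k)
  have "weyl_int (real (Suc k) + 1) ((dplus ^^ (n + Suc (Suc k))) f) t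
      = weyl_int (real (Suc k)) (weyl_int 1 ((dplus ^^ (n + Suc (Suc k))) f)) t"
    by (rule weyl_semigroup[symmetric, OF schwartz_rapid[OF f]]) (use t in auto)
  also have "\<dots> = weyl_int (real (Suc k)) (\<lambda>s. (- 1) * (dplus ^^ (n + Suc k)) f s) t"
    using t weyl_int_1[OF f, of _ "n + Suc k"] by (intro weyl_cong) simp
  also have "\<dots> = (- 1) * ((- 1) ^ Suc k * (dplus ^^ n) f t)" unfolding weyl_scale Suc.IH ..
  finally show ?case by (simp add: add.commute)
qed

lemma Dplus_eq:
  assumes f: "f \<in> schwartz_plus" and a: "a > 0" and t: "t \<ge> 0"
  shows "Dplus a f t = (1 / Gamma (a + 1) * t powr a) *\<^sub>R ((- 1) ^ weyl_order a * weyl_int (real (weyl_order a) - a) ((dplus ^^ weyl_order a) f) t)"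
  unfolding Dplus_def weyl_deriv_eq[OF assms] ..

lemma Dplus_0: "t > 0 \<Longrightarrow> Dplus 0 f t = f t"
  by (simp add: Dplus_def weyl_deriv_def)

lemma rapid_Lp:
  assumes g: "rapid g" and a: "a \<ge> 0" and p: "p > 1"
  shows "(\<lambda>t. complex_of_real (t powr a) * g t) \<in> Lp p"
proof -
  obtain N :: nat where N: "a + 1 < real N" using reals_Archimedean2 by blast
  obtain C where C: "C \<ge> 0" "\<And>t. t \<ge> 0 \<Longrightarrow> norm (g t) \<le> C / (1 + t) ^ N" using rapidE[OF g] by blast
  have [measurable]: "g \<in> borel_measurable rplus" using rapid_measurable[OF g, of 0] by simp
  have "integrable rplus (\<lambda>u. C powr p * (u powr ((a * p + 1) - 1) / (1 + u) powr (real N * p)))"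
  proof (intro integrable_mult_right integrable_rplus_beta)
    show "0 < a * p + 1" using a p by (intro add_nonneg_pos) auto
    have "(a + 1) * p \<le> real N * p" using N p by (intro mult_right_mono) auto
    then show "a * p + 1 < real N * p" using p by (simp add: algebra_simps)
  qed
  then have "integrable rplus (\<lambda>t. norm (complex_of_real (t powr a) * g t) powr p)"
  proof (rule Bochner_Integration.integrable_bound)
    show "AE t in rplus. norm (norm (complex_of_real (t powr a) * g t) powr p) \<le> norm (C powr p * (t powr ((a * p + 1) - 1) / (1 + t) powr (real N * p)))"
    proof (rule AE_rplus_I)
      fix t :: real assume t: "t > 0"
      have "norm (complex_of_real (t powr a) * g t) \<le> t powr a * (C / (1 + t) powr real N)"
      proof -
        have "t powr a * norm (g t) \<le> t powr a * (C / (1 + t) powr real N)"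
          using C(2)[of t] t by (intro mult_left_mono) (auto simp: powr_realpow)
        then show ?thesis by (simp add: norm_mult)
      qed
      then have "norm (complex_of_real (t powr a) * g t) powr p \<le> (t powr a * (C / (1 + t) powr real N)) powr p"
        using p by (intro powr_mono2) auto
      also have "\<dots> = C powr p * (t powr ((a * p + 1) - 1) / (1 + t) powr (real N * p))"
        using C t by (simp add: powr_mult powr_divide powr_powr)
      finally show "norm (norm (complex_of_real (t powr a) * g t) powr p) \<le> norm (C powr p * (t powr ((a * p + 1) - 1) / (1 + t) powr (real N * p)))"
        by simp
    qed
  qed measurable
  then show ?thesis by (simp add: Lp_def)
qed

lemma schwartz_Lp:
  assumes "f \<in> schwartz_plus" "p > 1" shows "f \<in> Lp p"
  by (rule iffD1[OF Lp_cong rapid_Lp[OF schwartz_rapid[OF assms(1), of 0], of 0]]) (use assms in auto)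

lemma Dplus_Lp:
  assumes f: "f \<in> schwartz_plus" and a: "a \<ge> 0" and p: "p > 1"
  shows "Dplus a f \<in> Lp p"
proof (cases "a = 0")
  case True
  then show ?thesis using iffD2[OF Lp_cong schwartz_Lp[OF f p], of "Dplus a f"] Dplus_0 by auto
next
  case False
  then have a': "a > 0" using a by simp
  have "(\<lambda>t. complex_of_real (1 / Gamma (a + 1)) * ((- 1) ^ weyl_order a * (complex_of_real (t powr a) * weyl_int (real (weyl_order a) - a) ((dplus ^^ weyl_order a) f) t))) \<in> Lp p"
    by (intro Lp_scale rapid_Lp weyl_rapid f weyl_order_greater a p)
  then show ?thesis
    by (rule iffD1[OF Lp_cong, rotated]) (use a' in \<open>simp add: Dplus_eq[OF f a'] scaleR_conv_of_real mult_ac\<close>)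
qed

lemma Dplus_add:
  assumes f: "f \<in> schwartz_plus" and g: "g \<in> schwartz_plus" and a: "a \<ge> 0" and t: "t > 0"
  shows "Dplus a (\<lambda>t. f t + g t) t = Dplus a f t + Dplus a g t"
proof (cases "a = 0")
  case False
  then have a': "a > 0" using a by simp
  have t0: "t \<ge> 0" using t by simp
  have "weyl_int (real (weyl_order a) - a) ((dplus ^^ weyl_order a) (\<lambda>t. f t + g t)) t
     = weyl_int (real (weyl_order a) - a) (\<lambda>s. (dplus ^^ weyl_order a) f s + (dplus ^^ weyl_order a) g s) t"
    using t by (intro weyl_cong schwartz_add(2) f g) auto
  also have "\<dots> = weyl_int (real (weyl_order a) - a) ((dplus ^^ weyl_order a) f) t + weyl_int (real (weyl_order a) - a) ((dplus ^^ weyl_order a) g) t"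
    by (intro weyl_add schwartz_rapid f g weyl_order_greater a t0)
  finally show ?thesis
    by (simp add: Dplus_eq[OF _ a' t0] f g schwartz_add(1) distrib_left scaleR_add_right)
qed (use t in \<open>simp add: Dplus_0\<close>)

lemma Dplus_scale:
  assumes f: "f \<in> schwartz_plus" and a: "a \<ge> 0" and t: "t > 0"
  shows "Dplus a (\<lambda>t. c * f t) t = c * Dplus a f t"
proof (cases "a = 0")
  case False
  then have a': "a > 0" using a by simp
  have t0: "t \<ge> 0" using t by simp
  have "weyl_int (real (weyl_order a) - a) ((dplus ^^ weyl_order a) (\<lambda>t. c * f t)) t
     = weyl_int (real (weyl_order a) - a) (\<lambda>s. c * (dplus ^^ weyl_order a) f s) t"
    using t by (intro weyl_cong schwartz_scale(2) f) auto
  also have "\<dots> = c * weyl_int (real (weyl_order a) - a) ((dplus ^^ weyl_order a) f) t" by (rule weyl_scale)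
  finally show ?thesis
    by (simp add: Dplus_eq[OF _ a' t0] f schwartz_scale(1) mult_ac)
qed (use t in \<open>simp add: Dplus_0\<close>)

text \<open>The weights s^(-a) and s^a cancel and a / Gamma(a + 1) = 1 / Gamma(a), so a Weyl
  integral of order a remains. By the semigroup law it combines with the one of order n - a into
  order n, which inverts the n-th derivative up to (-1)^n; this sign meets the one in
  \<open>weyl_deriv\<close>.\<close>

lemma kernel_op_Dplus:
  assumes f: "f \<in> schwartz_plus" and a: "a > 0" and t: "t > 0"
  shows "kernel_op (weyl_kernel a) (Dplus a f) t = f t"
proof -
  define n where "n = weyl_order a"
  have b: "real n - a > 0" unfolding n_def by (rule weyl_order_greater) (use a in simp)
  \<comment> \<open>The inversion formula \<open>weyl_int_nat\<close> is for positive integer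
    orders.\<close>
  have n: "n = Suc (n - 1)" using b a by (cases n) auto
  define W where "W s = (- 1) ^ n * weyl_int (real n - a) ((dplus ^^ n) f) s" for s
  have G: "Gamma (a + 1) = a * Gamma a" using a by (subst Gamma_plus1) (auto simp: nonpos_Ints_def)
  have Ga: "Gamma a > 0" using a by simp
  have "kernel_op (weyl_kernel a) (Dplus a f) t = (LINT s|rplus. (1 / Gamma a) *\<^sub>R (indicator {t<..} s *\<^sub>R (((s - t) powr (a - 1)) *\<^sub>R W s)))"
    unfolding kernel_op_def
  proof (intro Bochner_Integration.integral_cong refl)
    fix s assume "s \<in> space rplus"
    then have s: "s > 0" by simp
    have "s powr (- a) * s powr a = 1" using s unfolding powr_add[symmetric] by simp
    then have "weyl_kernel a t s * (1 / Gamma (a + 1) * s powr a) = 1 / Gamma a * (indicator {t<..} s * (s - t) powr (a - 1))"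
    proof (cases "t < s")
      case True
      then have "weyl_kernel a t s * (1 / Gamma (a + 1) * s powr a) = a * (s - t) powr (a - 1) / Gamma (a + 1) * (s powr (- a) * s powr a)"
        by (simp add: weyl_kernel_def)
      also have "\<dots> = a * (s - t) powr (a - 1) / (a * Gamma a)"
        unfolding \<open>s powr (- a) * s powr a = 1\<close> G by simp
      finally show ?thesis using True a by simp
    qed (simp add: weyl_kernel_def)
    moreover have "Dplus a f s = (1 / Gamma (a + 1) * s powr a) *\<^sub>R W s"
      using Dplus_eq[OF f a, of s] s by (simp add: W_def n_def)
    ultimately show "weyl_kernel a t s *\<^sub>R Dplus a f s = (1 / Gamma a) *\<^sub>R (indicator {t<..} s *\<^sub>R (((s - t) powr (a - 1)) *\<^sub>R W s))"
      by (simp only: scaleR_scaleR mult.assoc)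
  qed
  also have "\<dots> = (1 / Gamma a) *\<^sub>R (LINT s|rplus. indicator {t<..} s *\<^sub>R (((s - t) powr (a - 1)) *\<^sub>R W s))"
    by (rule integral_scaleR_right)
  also have "(LINT s|rplus. indicator {t<..} s *\<^sub>R (((s - t) powr (a - 1)) *\<^sub>R W s)) = (LBINT s:{t<..}. ((s - t) powr (a - 1)) *\<^sub>R W s)"
    unfolding rplus_def set_lebesgue_integral_def using t
    by (subst integral_restrict_space) (auto intro!: Bochner_Integration.integral_cong simp: indicator_def)
  finally have "kernel_op (weyl_kernel a) (Dplus a f) t = weyl_int a W t" by (simp add: weyl_int_def)
  also have "\<dots> = (- 1) ^ n * weyl_int a (weyl_int (real n - a) ((dplus ^^ n) f)) t"
    unfolding W_def by (rule weyl_scale)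
  also have "weyl_int a (weyl_int (real n - a) ((dplus ^^ n) f)) t = weyl_int (a + (real n - a)) ((dplus ^^ n) f) t"
    using t by (intro weyl_semigroup schwartz_rapid f a b) auto
  also have "\<dots> = weyl_int (real (Suc (n - 1))) ((dplus ^^ (0 + Suc (n - 1))) f) t"
    using n by simp
  also have "\<dots> = (- 1) ^ Suc (n - 1) * (dplus ^^ 0) f t" using t by (intro weyl_int_nat f) auto
  also have "(- 1) ^ n * ((- 1) ^ Suc (n - 1) * (dplus ^^ 0) f t) = f t"
    using n by (simp flip: n mult.assoc power_add power_mult_distrib)
  finally show ?thesis .
qed

section \<open>Exponentials and the density of the image of \<open>Dplus\<close>\<close>

lemma exp_decay: "c > 0 \<Longrightarrow> \<exists>C\<ge>0. \<forall>t\<ge>0. exp (- c * t) \<le> C / (1 + t) ^ N" for c :: real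
proof -
  assume c: "c > 0"
  \<comment> \<open>d \<le> 1 gives d (1 + t) \<le> 1 + d t \<le> exp(d t), and N d \<le> c turns
    the N-th power of this into exp(c t). \<open>Suc N\<close> avoids a division by 0.\<close>
  define d where "d = min 1 (c / real (Suc N))"
  have d: "d > 0" "d \<le> 1" "d * real (Suc N) \<le> c" using c by (auto simp: d_def min_def pos_le_divide_eq)
  show ?thesis
  proof (intro exI conjI allI impI)
    show "0 \<le> (1 / d) ^ N" using d by simp
    fix t :: real assume t: "t \<ge> 0"
    have "d * t \<le> 1 * t" using d t by (intro mult_right_mono) auto
    have "d * (1 + t) \<le> 1 + d * t" using d by (simp add: algebra_simps)
    also have "\<dots> \<le> exp (d * t)" by (rule exp_ge_add_one_self)
    finally have "(d * (1 + t)) ^ N \<le> exp (d * t) ^ N" using d t by (intro power_mono) auto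
    also have "\<dots> = exp (real N * (d * t))" by (simp add: exp_of_nat_mult)
    also have "\<dots> \<le> exp (c * t)"
    proof -
      have "real N * d \<le> c" using d by (simp add: algebra_simps)
      then have "real N * d * t \<le> c * t" using t by (intro mult_right_mono) auto
      then show ?thesis by (simp add: mult.assoc)
    qed
    finally have "d ^ N * (1 + t) ^ N * exp (- c * t) \<le> exp (c * t) * exp (- c * t)"
      unfolding power_mult_distrib by (intro mult_right_mono) auto
    also have "\<dots> = 1" by (simp flip: exp_add)
    finally have "exp (- c * t) \<le> 1 / (d ^ N * (1 + t) ^ N)" using d t by (simp add: pos_le_divide_eq mult_ac)
    then show "exp (- c * t) \<le> (1 / d) ^ N / (1 + t) ^ N" by (simp add: power_divide)
  qed
qed

lemma exp_schwartz:
  fixes c :: real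
  assumes c: "c > 0"
  shows "(\<lambda>t. complex_of_real (exp (- c * t))) \<in> schwartz_plus"
    and "t \<ge> 0 \<Longrightarrow> (dplus ^^ n) (\<lambda>t. complex_of_real (exp (- c * t))) t = (- c) ^ n * exp (- c * t)"
proof -
  define F where "F n t = complex_of_real ((- c) ^ n * exp (- c * t))" for n t
  have F: "(F n has_vector_derivative F (Suc n) t) (at t within {0..})" for n t
    unfolding F_def
    by (intro has_vector_derivative_of_real has_real_derivative_iff_has_vector_derivative[THEN iffD1])
       (auto intro!: derivative_eq_intros)
  have F0: "F 0 t = complex_of_real (exp (- c * t))" for t by (simp add: F_def)
  have "rapid (F n)" for n
  proof -
    have "rapid (\<lambda>t. complex_of_real (exp (- c * t)))"
      unfolding rapid_def using exp_decay[OF c] by (auto intro!: continuous_intros)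
    from rapid_scale[OF this, of "(- c) ^ n"] show ?thesis by (simp add: F_def[abs_def])
  qed
  then show "(\<lambda>t. complex_of_real (exp (- c * t))) \<in> schwartz_plus"
    by (intro schwartzI[where F = F, OF F0 F])
  show "t \<ge> 0 \<Longrightarrow> (dplus ^^ n) (\<lambda>t. complex_of_real (exp (- c * t))) t = (- c) ^ n * exp (- c * t)"
    using dplus_iter[where F = F, OF F0 F] by (simp add: F_def)
qed

lemma integral_Gamma_rplus:
  assumes a: "a > 0" and c: "c > (0::real)"
  shows "(LINT u|rplus. u powr (a - 1) * exp (- c * u)) = Gamma a * c powr (- a)"
proof -
  have "has_bochner_integral rplus (\<lambda>t. indicator {0..} t * (t powr (a - 1) / exp t)) (Gamma a)"
    using a by (intro has_bochner_integral_rplus Gamma_integral_real) auto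
  then have "Gamma a = (LINT t|rplus. indicator {0..} t * (t powr (a - 1) / exp t))"
    by (rule has_bochner_integral_integral_eq[symmetric])
  also have "\<dots> = c *\<^sub>R (LINT t|rplus. indicator {0..} (c * t) * ((c * t) powr (a - 1) / exp (c * t)))"
    by (rule integral_rplus_scale'[OF c])
  also have "(LINT t|rplus. indicator {0..} (c * t) * ((c * t) powr (a - 1) / exp (c * t)))
    = (LINT t|rplus. c powr (a - 1) * (t powr (a - 1) * exp (- c * t)))"
    using c by (intro Bochner_Integration.integral_cong) (auto simp: powr_mult exp_minus field_simps)
  also have "c *\<^sub>R \<dots> = (c * c powr (a - 1)) * (LINT t|rplus. t powr (a - 1) * exp (- c * t))" by simp
  also have "c * c powr (a - 1) = c powr a" using c by (simp add: powr_mult_base)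
  finally show ?thesis using c by (simp add: powr_minus_divide)
qed

text \<open>Exponentials are eigenfunctions: by the Gamma integral a Weyl integral of order b
  multiplies exp(- c t) by c^(-b), and n derivatives with their sign by c^n. The total is c^a, since
  n - b = a.\<close>

lemma Dplus_exp:
  assumes a: "a \<ge> 0" and c: "c > (0::real)" and t: "t > 0"
  shows "Dplus a (\<lambda>t. complex_of_real (exp (- c * t))) t
    = complex_of_real (c powr a / Gamma (a + 1)) * complex_of_real (t powr a * exp (- c * t))"
proof (cases "a = 0")
  case False
  then have a': "a > 0" using a by simp
  define n where "n = weyl_order a"
  define b where "b = real n - a"
  have b: "b > 0" unfolding b_def n_def by (rule weyl_order_greater[OF a])
  let ?e = "\<lambda>t. complex_of_real (exp (- c * t))"
  have w: "weyl_int b ?e t = complex_of_real (c powr (- b) * exp (- c * t))"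
  proof -
    have "(LINT u|rplus. (u powr (b - 1)) *\<^sub>R ?e (t + u)) = (LINT u|rplus. complex_of_real (exp (- c * t) * (u powr (b - 1) * exp (- c * u))))"
    proof (intro Bochner_Integration.integral_cong refl)
      fix u
      have "exp (- c * (t + u)) = exp (- c * t) * exp (- c * u)" unfolding exp_add[symmetric] by (simp add: algebra_simps)
      then show "(u powr (b - 1)) *\<^sub>R ?e (t + u) = complex_of_real (exp (- c * t) * (u powr (b - 1) * exp (- c * u)))"
        by (simp only: scaleR_conv_of_real of_real_mult mult_ac)
    qed
    also have "\<dots> = complex_of_real (LINT u|rplus. exp (- c * t) * (u powr (b - 1) * exp (- c * u)))"
      by (rule integral_complex_of_real)
    also have "(LINT u|rplus. exp (- c * t) * (u powr (b - 1) * exp (- c * u))) = exp (- c * t) * (Gamma b * c powr (- b))"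
      using integral_Gamma_rplus[OF b c] by simp
    moreover have "Gamma b > 0" using b by (rule Gamma_real_pos)
    ultimately show ?thesis unfolding weyl_int_rplus by (simp add: scaleR_conv_of_real)
  qed
  have "weyl_int b ((dplus ^^ n) ?e) t = weyl_int b (\<lambda>s. (- complex_of_real c) ^ n * ?e s) t"
    using t exp_schwartz(2)[OF c] by (intro weyl_cong) auto
  also have "\<dots> = (- complex_of_real c) ^ n * complex_of_real (c powr (- b) * exp (- c * t))"
    unfolding weyl_scale w ..
  finally have "(- 1) ^ n * weyl_int b ((dplus ^^ n) ?e) t = ((- 1) * (- complex_of_real c)) ^ n * complex_of_real (c powr (- b) * exp (- c * t))"
    unfolding power_mult_distrib by (simp only: mult.assoc)
  also have "\<dots> = complex_of_real (c ^ n * c powr (- b) * exp (- c * t))" by simp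
  also have "c ^ n * c powr (- b) = c powr a"
    using c by (simp add: b_def powr_realpow[symmetric] powr_add[symmetric])
  finally show ?thesis
    using Dplus_eq[OF exp_schwartz(1)[OF c] a', of t] t
    by (simp add: n_def b_def scaleR_conv_of_real mult_ac)
qed (use t c in \<open>simp add: Dplus_0\<close>)

text \<open>By \<open>Dplus_exp\<close> the images of exp(- (1 + k) t) are nonzero multiples of w
  u^k with w = t^a exp(- t) and u = exp(- t).\<close>

lemma Dplus_dense:
  assumes a: "a \<ge> 0" and p: "p > 1" and h: "h \<in> Lp p" and \<epsilon>: "\<epsilon> > 0"
  shows "\<exists>\<phi>\<in>schwartz_plus. Lp_modular p (\<lambda>t. h t - Dplus a \<phi> t) < \<epsilon>"
proof -
  define R where "R = {g \<in> Lp p. \<exists>\<phi>\<in>schwartz_plus. \<forall>t>0. g t = Dplus a \<phi> t}"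
  let ?X = "{f \<in> Lp p. \<forall>\<epsilon>>0. \<exists>g\<in>R. Lp_modular p (\<lambda>t. f t - g t) < \<epsilon>}"
  have X: "closed_subspace p ?X"
  proof (rule closure_closed_subspace)
    fix f g assume "f \<in> R" "g \<in> R"
    then obtain \<phi> \<psi> where "f \<in> Lp p" "g \<in> Lp p" "\<phi> \<in> schwartz_plus" "\<forall>t>0. f t = Dplus a \<phi> t"
      "\<psi> \<in> schwartz_plus" "\<forall>t>0. g t = Dplus a \<psi> t" by (auto simp: R_def)
    then show "(\<lambda>t. f t + g t) \<in> R"
      unfolding R_def using p
      by (auto intro!: Lp_add(1) bexI[of _ "\<lambda>t. \<phi> t + \<psi> t"] schwartz_add(1) simp: Dplus_add[OF _ _ a])
  next
    fix c f assume "f \<in> R"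
    then obtain \<phi> where "f \<in> Lp p" "\<phi> \<in> schwartz_plus" "\<forall>t>0. f t = Dplus a \<phi> t" by (auto simp: R_def)
    then show "(\<lambda>t. c * f t) \<in> R"
      unfolding R_def
      by (auto intro!: Lp_scale(1) bexI[of _ "\<lambda>t. c * \<phi> t"] schwartz_scale(1) simp: Dplus_scale[OF _ a])
  qed (use p in \<open>auto simp: R_def\<close>)
  have RX: "g \<in> ?X" if "g \<in> R" for g
    by (rule subsetD[OF closure_superset that]) (auto simp: R_def)
  define w where "w t = t powr a * exp (- 1 * t)" for t :: real
  have wk: "(\<lambda>t. complex_of_real (w t * exp (- t) ^ k)) \<in> ?X" for k
  proof -
    \<comment> \<open>The summand 1 is the share of the weight: w itself must be in
      \<open>Lp p\<close>, so the exponent may not drop to 0 at k = 0.\<close>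
    define c where "c = 1 + real k"
    have c: "c > 0" by (simp add: c_def)
    define v where "v = c powr a / Gamma (a + 1)"
    have "Gamma (a + 1) > 0" using a by (intro Gamma_real_pos) simp
    then have v: "v \<noteq> 0" using c by (simp add: v_def)
    define \<phi> where "\<phi> t = complex_of_real (exp (- c * t))" for t
    have \<phi>: "\<phi> \<in> schwartz_plus" unfolding \<phi>_def by (rule exp_schwartz(1)[OF c])
    have "Dplus a \<phi> \<in> R" unfolding R_def using Dplus_Lp[OF \<phi> a p] \<phi> by blast
    then have "(\<lambda>t. complex_of_real (1 / v) * Dplus a \<phi> t) \<in> ?X" by (intro closed_subspace_scale[OF X] RX)
    then show ?thesis
    proof (rule closed_subspace_cong_AE[OF X, rotated])
      show "AE t in rplus. complex_of_real (w t * exp (- t) ^ k) = complex_of_real (1 / v) * Dplus a \<phi> t"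
      proof (rule AE_rplus_I)
        fix t :: real assume t: "t > 0"
        have "exp (- 1 * t) * exp (- t) ^ k = exp (- 1 * t + real k * (- t))"
          unfolding exp_add exp_of_nat_mult ..
        also have "- 1 * t + real k * (- t) = - c * t" by (simp add: c_def algebra_simps)
        finally have "exp (- 1 * t) * exp (- t) ^ k = exp (- c * t)" .
        then have "w t * exp (- t) ^ k = t powr a * exp (- c * t)" by (simp only: w_def mult.assoc)
        then show "complex_of_real (w t * exp (- t) ^ k) = complex_of_real (1 / v) * Dplus a \<phi> t"
          unfolding \<phi>_def Dplus_exp[OF a c t] v_def[symmetric] using v by simp
      qed
    qed (use p in \<open>auto simp: w_def\<close>)
  qed
  have "h \<in> ?X"
  proof (rule weighted_powers_dense[OF X _ _ _ _ _ _ _ _ h, where w = w and u = "\<lambda>t. exp (- t)"])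
    show "(\<lambda>t. complex_of_real (w t)) \<in> Lp p" using closed_subspace_Lp[OF X wk[of 0]] by simp
    show "w \<in> borel_measurable rplus" unfolding w_def by measurable
    show "(\<forall>k. (\<lambda>t. complex_of_real (w t * exp (- t) ^ k)) \<in> ?X) \<or> (\<forall>k. (\<lambda>t. complex_of_real (w t * (1 - exp (- t)) ^ k)) \<in> ?X)"
      using wk by blast
  qed (use p in \<open>auto simp: w_def\<close>)
  then obtain g where g: "g \<in> R" "Lp_modular p (\<lambda>t. h t - g t) < \<epsilon>" using \<epsilon> by blast
  then obtain \<phi> where \<phi>: "\<phi> \<in> schwartz_plus" "\<forall>t>0. g t = Dplus a \<phi> t" by (auto simp: R_def)
  have "Lp_modular p (\<lambda>t. h t - Dplus a \<phi> t) = Lp_modular p (\<lambda>t. h t - g t)" using \<phi> by (intro Lp_modular_cong) auto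
  then show ?thesis using g \<phi> by (intro bexI[of _ \<phi>]) simp_all
qed

subsection \<open>The completed spaces\<close>

lemma Lp_modular_eq_norm: "p > 0 \<Longrightarrow> Lp_modular p f = Lp_norm p f powr p"
  by (simp add: Lp_norm_modular powr_powr Lp_modular_nonneg)

lemma Lp_norm_less_iff:
  assumes "p > 0" "\<epsilon> > 0"
  shows "Lp_norm p f < \<epsilon> \<longleftrightarrow> Lp_modular p f < \<epsilon> powr p"
proof
  assume "Lp_norm p f < \<epsilon>"
  then show "Lp_modular p f < \<epsilon> powr p"
    unfolding Lp_modular_eq_norm[OF assms(1)] using assms by (intro powr_less_mono2) (auto simp: Lp_norm_modular)
next
  assume "Lp_modular p f < \<epsilon> powr p"
  then have "Lp_modular p f powr (1 / p) < (\<epsilon> powr p) powr (1 / p)"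
    using assms by (intro powr_less_mono2) (auto simp: Lp_modular_nonneg)
  then show "Lp_norm p f < \<epsilon>" using assms by (simp add: Lp_norm_modular powr_powr)
qed

lemma Lp_norm_tendsto_iff:
  assumes "p > 0"
  shows "((\<lambda>n. Lp_norm p (f n)) \<longlonglongrightarrow> 0) \<longleftrightarrow> ((\<lambda>n. Lp_modular p (f n)) \<longlonglongrightarrow> 0)"
proof
  assume "(\<lambda>n. Lp_norm p (f n)) \<longlonglongrightarrow> 0"
  then show "(\<lambda>n. Lp_modular p (f n)) \<longlonglongrightarrow> 0"
    unfolding Lp_modular_eq_norm[OF assms] using assms by (intro tendsto_zero_powrI) (auto simp: Lp_norm_modular)
next
  assume "(\<lambda>n. Lp_modular p (f n)) \<longlonglongrightarrow> 0"
  then show "(\<lambda>n. Lp_norm p (f n)) \<longlonglongrightarrow> 0"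
    unfolding Lp_norm_modular using assms by (intro tendsto_zero_powrI[OF _ tendsto_const]) (auto simp: Lp_modular_nonneg)
qed

lemma schwartz_norm_eq:
  assumes a: "a \<ge> 0" and p: "p > 0"
  shows "schwartz_norm a p f = Lp_norm p (Dplus a f)"
proof -
  define G where "G = 1 / Gamma (a + 1)"
  have G: "G > 0" using a by (simp add: G_def)
  have "Lp_modular p (Dplus a f) = (LINT t|rplus. G powr p * (norm (weyl_deriv a f t) powr p * t powr (a * p)))"
    unfolding Lp_modular_def
  proof (intro Bochner_Integration.integral_cong refl)
    fix t assume "t \<in> space rplus"
    then have "norm (Dplus a f t) = G * t powr a * norm (weyl_deriv a f t)"
      using G by (simp add: Dplus_def G_def[symmetric] abs_mult)
    then show "norm (Dplus a f t) powr p = G powr p * (norm (weyl_deriv a f t) powr p * t powr (a * p))"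
      using G by (simp add: powr_mult powr_powr)
  qed
  also have "\<dots> = G powr p * (LINT t|rplus. norm (weyl_deriv a f t) powr p * t powr (a * p))"
    by (rule integral_mult_right_zero)
  finally show ?thesis
    using G p by (simp add: schwartz_norm_def Lp_norm_modular G_def[symmetric] powr_mult powr_powr integral_nonneg_AE)
qed

lemma Lp_modular_limit_unique:
  assumes p: "p > 0" and f: "f \<in> Lp p" and g: "g \<in> Lp p" and x: "\<And>n. x n \<in> Lp p"
    and lf: "(\<lambda>n. Lp_modular p (\<lambda>t. x n t - f t)) \<longlonglongrightarrow> 0" and lg: "(\<lambda>n. Lp_modular p (\<lambda>t. x n t - g t)) \<longlonglongrightarrow> 0"
  shows "AE t in rplus. f t = g t"
proof -
  have "(\<lambda>n. 2 powr p * (Lp_modular p (\<lambda>t. x n t - f t) + Lp_modular p (\<lambda>t. x n t - g t))) \<longlonglongrightarrow> 2 powr p * (0 + 0)"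
    by (intro tendsto_intros lf lg)
  then have "Lp_modular p (\<lambda>t. f t - g t) \<le> 2 powr p * (0 + 0)"
  proof (rule LIMSEQ_le_const, intro exI allI impI)
    fix n
    show "Lp_modular p (\<lambda>t. f t - g t) \<le> 2 powr p * (Lp_modular p (\<lambda>t. x n t - f t) + Lp_modular p (\<lambda>t. x n t - g t))"
      using Lp_modular_triangle[OF _ f x[of n] g] p by (simp add: Lp_modular_minus_commute[of p f])
  qed
  then have "Lp_modular p (\<lambda>t. f t - g t) = 0" using Lp_modular_nonneg[of p "\<lambda>t. f t - g t"] by simp
  then have "AE t in rplus. f t - g t = 0" 
    by (rule Lp_modular_eq_0_AE[OF Lp_diff(1)[OF less_imp_le[OF p] f g]])
  then show ?thesis by simp
qed

text \<open>At a = 0 the prefactor a would make the kernel vanish identically, whereas the inverse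
  has to be the identity.\<close>

definition Dplus_inv :: "real \<Rightarrow> (real \<Rightarrow> complex) \<Rightarrow> real \<Rightarrow> complex" where
  "Dplus_inv a h = (if a = 0 then h else kernel_op (weyl_kernel a) h)"

context
  fixes a p :: real
  assumes a: "a \<ge> 0" and p: "p > 1"
begin

lemma hom_kernel_weyl_p: "a \<noteq> 0 \<Longrightarrow> hom_kernel p (weyl_kernel a)"
  using a p by (intro hom_kernel_weyl) auto

lemma Dplus_inv_Lp: "h \<in> Lp p \<Longrightarrow> Dplus_inv a h \<in> Lp p"
  by (auto simp: Dplus_inv_def intro: hom_kernel.kernel_op_Lp[OF hom_kernel_weyl_p])

lemma Dplus_inv_diff:
  assumes "h \<in> Lp p" "k \<in> Lp p"
  shows "AE t in rplus. Dplus_inv a (\<lambda>s. h s - k s) t = Dplus_inv a h t - Dplus_inv a k t"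
  using hom_kernel.kernel_op_diff_AE[OF hom_kernel_weyl_p assms] by (auto simp: Dplus_inv_def)

lemma Dplus_inv_limit:
  assumes "h \<in> Lp p" "\<And>n::nat. g n \<in> Lp p" "(\<lambda>n. Lp_modular p (\<lambda>t. g n t - h t)) \<longlonglongrightarrow> 0"
  shows "(\<lambda>n. Lp_modular p (\<lambda>t. Dplus_inv a (g n) t - Dplus_inv a h t)) \<longlonglongrightarrow> 0"
  using hom_kernel.kernel_op_limit[OF hom_kernel_weyl_p assms] assms(3) by (cases "a = 0") (simp_all add: Dplus_inv_def)

lemma Dplus_inv_inj:
  assumes h: "h \<in> Lp p" and k: "k \<in> Lp p" and e: "AE t in rplus. Dplus_inv a h t = Dplus_inv a k t"
  shows "AE t in rplus. h t = k t"
proof (cases "a = 0")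
  case True
  then show ?thesis using e by (simp add: Dplus_inv_def)
next
  case False
  have q: "1 / p + 1 / (p / (p - 1)) = 1" using p by (simp add: field_simps)
  have z: "AE t in rplus. kernel_op (weyl_kernel a) (\<lambda>t. h t - k t) t = 0"
    using Dplus_inv_diff[OF h k] e by eventually_elim (use False in \<open>simp add: Dplus_inv_def\<close>)
  have d: "(\<lambda>t. h t - k t) \<in> Lp p" using p by (intro Lp_diff h k) auto
  have "AE t in rplus. h t - k t = 0" by (rule weyl_kernel_injective[OF p q _ d z]) (use a False in simp)
  then show ?thesis by simp
qed

lemma Dplus_inv_Dplus: "\<phi> \<in> schwartz_plus \<Longrightarrow> t > 0 \<Longrightarrow> Dplus_inv a (Dplus a \<phi>) t = \<phi> t"
  using a kernel_op_Dplus[of \<phi> a t] by (auto simp: Dplus_inv_def Dplus_0)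

lemma Lp_modular_Dplus_diff:
  assumes f: "f \<in> schwartz_plus" and g: "g \<in> schwartz_plus"
  shows "Lp_modular p (Dplus a (\<lambda>t. f t - g t)) = Lp_modular p (\<lambda>t. Dplus a f t - Dplus a g t)"
proof (rule Lp_modular_cong)
  fix t :: real assume t: "t > 0"
  have "Dplus a (\<lambda>t. f t + (- 1) * g t) t = Dplus a f t + Dplus a (\<lambda>t. (- 1) * g t) t"
    by (intro Dplus_add f schwartz_scale(1) g a t)
  also have "Dplus a (\<lambda>t. (- 1) * g t) t = (- 1) * Dplus a g t" by (intro Dplus_scale g a t)
  finally show "Dplus a (\<lambda>t. f t - g t) t = Dplus a f t - Dplus a g t" by simp
qed

lemma schwartz_norm_diff_less_iff:
  assumes "f \<in> schwartz_plus" "g \<in> schwartz_plus" "\<epsilon> > 0"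
  shows "schwartz_norm a p (\<lambda>t. f t - g t) < \<epsilon> \<longleftrightarrow> Lp_modular p (\<lambda>t. Dplus a f t - Dplus a g t) < \<epsilon> powr p"
  using assms p a by (simp add: schwartz_norm_eq Lp_norm_less_iff Lp_modular_Dplus_diff)

text \<open>\<phi> n is \<open>Dplus_inv\<close> of its own \<open>Dplus\<close>; by continuity of
  \<open>Dplus_inv\<close> the sequence tends to \<open>Dplus_inv a h\<close>, while by definition
  it tends to f.\<close>

lemma represents_limit:
  assumes r: "represents a p \<phi> f" and h: "h \<in> Lp p" and l: "(\<lambda>n. Lp_modular p (\<lambda>t. Dplus a (\<phi> n) t - h t)) \<longlonglongrightarrow> 0"
  shows "AE t in rplus. f t = Dplus_inv a h t"
proof (rule Lp_modular_limit_unique[where x = \<phi>])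
  have \<phi>: "\<phi> n \<in> schwartz_plus" for n using r by (simp add: represents_def)
  have "(\<lambda>n. Lp_modular p (\<lambda>t. Dplus_inv a (Dplus a (\<phi> n)) t - Dplus_inv a h t)) \<longlonglongrightarrow> 0"
    by (intro Dplus_inv_limit h Dplus_Lp \<phi> a p l)
  moreover have "Lp_modular p (\<lambda>t. Dplus_inv a (Dplus a (\<phi> n)) t - Dplus_inv a h t) = Lp_modular p (\<lambda>t. \<phi> n t - Dplus_inv a h t)" for n
    by (rule Lp_modular_cong) (simp add: Dplus_inv_Dplus[OF \<phi>])
  ultimately show "(\<lambda>n. Lp_modular p (\<lambda>t. \<phi> n t - Dplus_inv a h t)) \<longlonglongrightarrow> 0" by simp
  show "(\<lambda>n. Lp_modular p (\<lambda>t. \<phi> n t - f t)) \<longlonglongrightarrow> 0"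
    using r p by (simp add: represents_def Lp_norm_tendsto_iff)
  show "\<phi> n \<in> Lp p" for n by (rule schwartz_Lp[OF \<phi> p])
  show "f \<in> Lp p" using r by (simp add: represents_def)
  show "Dplus_inv a h \<in> Lp p" by (rule Dplus_inv_Lp[OF h])
qed (use p in simp)

text \<open>A Cauchy sequence for \<open>schwartz_norm\<close> is one whose images under
  \<open>Dplus\<close> are Cauchy in \<open>Lp p\<close>; their limit is the required h.\<close>

lemma represents_ex:
  assumes r: "represents a p \<phi> f"
  shows "\<exists>h\<in>Lp p. AE t in rplus. f t = Dplus_inv a h t"
proof -
  have \<phi>: "\<phi> n \<in> schwartz_plus" for n using r by (simp add: represents_def)
  obtain h where h: "h \<in> Lp p" "(\<lambda>n. Lp_modular p (\<lambda>t. Dplus a (\<phi> n) t - h t)) \<longlonglongrightarrow> 0"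
  proof (rule Lp_complete[where p = p and f = "\<lambda>n. Dplus a (\<phi> n)"])
    show "Dplus a (\<phi> n) \<in> Lp p" for n by (intro Dplus_Lp \<phi> a p)
    fix \<epsilon> :: real assume \<epsilon>: "\<epsilon> > 0"
    define e where "e = \<epsilon> powr (1 / p)"
    have e: "e > 0" "e powr p = \<epsilon>" using \<epsilon> p by (auto simp: e_def powr_powr)
    obtain N where "\<forall>m\<ge>N. \<forall>n\<ge>N. schwartz_norm a p (\<lambda>t. \<phi> m t - \<phi> n t) < e"
      using r e unfolding represents_def by blast
    then show "\<exists>N. \<forall>m\<ge>N. \<forall>n\<ge>N. Lp_modular p (\<lambda>t. Dplus a (\<phi> m) t - Dplus a (\<phi> n) t) < \<epsilon>"
      unfolding schwartz_norm_diff_less_iff[OF \<phi> \<phi> e(1)] e(2) by blast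
  qed (use p in auto)
  then show ?thesis using represents_limit[OF r] by blast
qed

text \<open>Density provides Schwartz functions whose images under \<open>Dplus\<close> tend to h.
  Convergence of the images makes the sequence Cauchy, and continuity of \<open>Dplus_inv\<close>
  makes it tend to f.\<close>

lemma Dplus_inv_represents:
  assumes h: "h \<in> Lp p" and f: "f \<in> Lp p" and e: "AE t in rplus. f t = Dplus_inv a h t"
  shows "\<exists>\<phi>. represents a p \<phi> f \<and> (\<lambda>n. Lp_modular p (\<lambda>t. Dplus a (\<phi> n) t - h t)) \<longlonglongrightarrow> 0"
proof -
  have "\<forall>n. \<exists>\<phi>\<in>schwartz_plus. Lp_modular p (\<lambda>t. h t - Dplus a \<phi> t) < 1 / real (Suc n)"
    by (intro allI Dplus_dense a p h) simp
  then obtain \<phi> where \<phi>: "\<And>n. \<phi> n \<in> schwartz_plus" "\<And>n. Lp_modular p (\<lambda>t. h t - Dplus a (\<phi> n) t) < 1 / real (Suc n)"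
    by metis
  have l: "(\<lambda>n. Lp_modular p (\<lambda>t. Dplus a (\<phi> n) t - h t)) \<longlonglongrightarrow> 0"
  proof (rule tendsto_sandwich[OF _ _ tendsto_const LIMSEQ_inverse_real_of_nat])
    show "\<forall>\<^sub>F n in sequentially. Lp_modular p (\<lambda>t. Dplus a (\<phi> n) t - h t) \<le> inverse (real (Suc n))"
      using \<phi>(2) by (intro always_eventually) (auto simp: Lp_modular_minus_commute[of p "Dplus a _"] inverse_eq_divide less_imp_le)
  qed (auto simp: Lp_modular_nonneg)
  have D: "Dplus a (\<phi> n) \<in> Lp p" for n by (intro Dplus_Lp \<phi> a p)
  have "represents a p \<phi> f"
    unfolding represents_def
  proof (intro conjI allI impI f \<phi>)
    fix \<epsilon> :: real assume \<epsilon>: "\<epsilon> > 0"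
    define e where "e = \<epsilon> powr p / (2 powr p * 2)"
    have "e > 0" using \<epsilon> by (simp add: e_def)
    with l have "eventually (\<lambda>n. Lp_modular p (\<lambda>t. Dplus a (\<phi> n) t - h t) < e) sequentially" by (intro order_tendstoD)
    then obtain N where N: "\<And>n. n \<ge> N \<Longrightarrow> Lp_modular p (\<lambda>t. Dplus a (\<phi> n) t - h t) < e" by (auto simp: eventually_sequentially)
    show "\<exists>N. \<forall>m\<ge>N. \<forall>n\<ge>N. schwartz_norm a p (\<lambda>t. \<phi> m t - \<phi> n t) < \<epsilon>"
    proof (intro exI[of _ N] allI impI)
      fix m n assume mn: "m \<ge> N" "n \<ge> N"
      have "Lp_modular p (\<lambda>t. Dplus a (\<phi> m) t - Dplus a (\<phi> n) t)
          \<le> 2 powr p * (Lp_modular p (\<lambda>t. Dplus a (\<phi> m) t - h t) + Lp_modular p (\<lambda>t. h t - Dplus a (\<phi> n) t))"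
        using p by (intro Lp_modular_triangle D h) auto
      also have "\<dots> < 2 powr p * (e + e)"
        using N[OF mn(1)] N[OF mn(2)] by (intro mult_strict_left_mono add_strict_mono) (auto simp: Lp_modular_minus_commute[of p h])
      also have "\<dots> = \<epsilon> powr p" by (simp add: e_def)
      finally show "schwartz_norm a p (\<lambda>t. \<phi> m t - \<phi> n t) < \<epsilon>"
        unfolding schwartz_norm_diff_less_iff[OF \<phi>(1) \<phi>(1) \<epsilon>] .
    qed
  next
    have "(\<lambda>n. Lp_modular p (\<lambda>t. Dplus_inv a (Dplus a (\<phi> n)) t - Dplus_inv a h t)) \<longlonglongrightarrow> 0" by (intro Dplus_inv_limit h D l)
    moreover have "Lp_modular p (\<lambda>t. Dplus_inv a (Dplus a (\<phi> n)) t - Dplus_inv a h t) = Lp_modular p (\<lambda>t. \<phi> n t - f t)" for n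
    proof (rule Lp_modular_cong_AE)
      show "AE t in rplus. Dplus_inv a (Dplus a (\<phi> n)) t - Dplus_inv a h t = \<phi> n t - f t"
        using e AE_rplus_pos by eventually_elim (simp add: Dplus_inv_Dplus[OF \<phi>(1)])
      show "(\<lambda>t. \<phi> n t - f t) \<in> borel_measurable rplus"
        using p by (intro Lp_measurable[of _ p] Lp_diff schwartz_Lp \<phi> f) auto
      show "(\<lambda>t. Dplus_inv a (Dplus a (\<phi> n)) t - Dplus_inv a h t) \<in> borel_measurable rplus"
        using p by (intro Lp_measurable[of _ p] Lp_diff Dplus_inv_Lp D h) auto
    qed
    ultimately show "(\<lambda>n. Lp_norm p (\<lambda>t. \<phi> n t - f t)) \<longlonglongrightarrow> 0"
      using p by (simp add: Lp_norm_tendsto_iff)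
  qed
  with l show ?thesis by blast
qed

text \<open>The choice in \<open>Dext\<close> is harmless: whatever it selects is sent to f by
  \<open>Dplus_inv\<close>, and injectivity leaves only h up to null sets.\<close>

lemma Dext_Dplus_inv:
  assumes h: "h \<in> Lp p" and f: "f \<in> Lp p" and e: "AE t in rplus. f t = Dplus_inv a h t"
  shows "Dext a p f \<in> Lp p" and "AE t in rplus. Dext a p f t = h t"
proof -
  let ?P = "\<lambda>h. h \<in> Lp p \<and> (\<exists>\<phi>. represents a p \<phi> f \<and> (\<lambda>n. Lp_norm p (\<lambda>t. Dplus a (\<phi> n) t - h t)) \<longlonglongrightarrow> 0)"
  have "?P h" using Dplus_inv_represents[OF assms] h p by (simp add: Lp_norm_tendsto_iff)
  then have P: "?P (Dext a p f)" unfolding Dext_def by (rule someI[where P = ?P])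
  then show D: "Dext a p f \<in> Lp p" by blast
  obtain \<phi> where "represents a p \<phi> f" "(\<lambda>n. Lp_modular p (\<lambda>t. Dplus a (\<phi> n) t - Dext a p f t)) \<longlonglongrightarrow> 0"
    using P p by (auto simp: Lp_norm_tendsto_iff)
  then have "AE t in rplus. f t = Dplus_inv a (Dext a p f) t" using D by (intro represents_limit)
  with e have "AE t in rplus. Dplus_inv a (Dext a p f) t = Dplus_inv a h t" by eventually_elim (rule trans[OF sym])
  then show "AE t in rplus. Dext a p f t = h t" by (rule Dplus_inv_inj[OF D h])
qed

text \<open>From here on representing sequences no longer appear: elements are handled through their
  h.\<close>

lemma Tspace_iff: "f \<in> Tspace a p \<longleftrightarrow> f \<in> Lp p \<and> (\<exists>h\<in>Lp p. AE t in rplus. f t = Dplus_inv a h t)"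
proof (cases "a = 0")
  case True
  then show ?thesis by (auto simp: Tspace_def Dplus_inv_def intro!: bexI[of _ f])
next
  case False
  moreover have "f \<in> Lp p" if "represents a p \<phi> f" for \<phi> using that by (simp add: represents_def)
  ultimately show ?thesis
    unfolding Tspace_def using represents_ex Dplus_inv_represents by (simp only: if_False mem_Collect_eq) blast
qed

text \<open>Commutation of the two homogeneous kernels. Replacing f by its version
  \<open>Dplus_inv a h\<close> is allowed at every t > 0, the operator being blind to null sets of
  its input.\<close>

lemma stieltjes_Dplus_inv:
  assumes b: "0 < b - 1 / p" "b - 1 / p < m"
    and h: "h \<in> Lp p" and f: "f \<in> Lp p" and e: "AE t in rplus. f t = Dplus_inv a h t"
  shows "stieltjes b m h \<in> Lp p" "stieltjes b m f \<in> Lp p"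
    and "AE t in rplus. stieltjes b m f t = Dplus_inv a (stieltjes b m h) t"
proof -
  interpret S: hom_kernel p "stieltjes_kernel b m" by (rule hom_kernel_stieltjes[OF p b])
  show "stieltjes b m h \<in> Lp p" "stieltjes b m f \<in> Lp p"
    unfolding stieltjes_kernel_op by (intro S.kernel_op_Lp h f)+
  have "AE t in rplus. kernel_op (stieltjes_kernel b m) (Dplus_inv a h) t = Dplus_inv a (kernel_op (stieltjes_kernel b m) h) t"
    using kernel_op_commute[OF S.hom_kernel_axioms hom_kernel_weyl_p h] by (auto simp: Dplus_inv_def)
  then show "AE t in rplus. stieltjes b m f t = Dplus_inv a (stieltjes b m h) t"
    unfolding stieltjes_kernel_op using AE_rplus_pos
  proof eventually_elim
    case (elim t)
    have "kernel_op (stieltjes_kernel b m) f t = kernel_op (stieltjes_kernel b m) (Dplus_inv a h) t"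
      by (rule S.kernel_op_cong_AE[OF e elim(2)]) (use Lp_measurable[OF f] Lp_measurable[OF Dplus_inv_Lp[OF h]] in auto)
    then show ?case using elim(1) by simp
  qed
qed

lemma stieltjes_Tspace:
  assumes b: "0 < b - 1 / p" "b - 1 / p < m" and f: "f \<in> Tspace a p"
  shows "stieltjes b m f \<in> Tspace a p"
    and "AE t in rplus. Dext a p (stieltjes b m f) t = stieltjes b m (Dext a p f) t"
    and "Dext a p f \<in> Lp p"
proof -
  interpret S: hom_kernel p "stieltjes_kernel b m" by (rule hom_kernel_stieltjes[OF p b])
  obtain h where h: "f \<in> Lp p" "h \<in> Lp p" "AE t in rplus. f t = Dplus_inv a h t" using f Tspace_iff by blast
  note S = stieltjes_Dplus_inv[OF b h(2,1,3)]
  show "stieltjes b m f \<in> Tspace a p" using S Tspace_iff by blast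
  show D: "Dext a p f \<in> Lp p" by (rule Dext_Dplus_inv(1)[OF h(2,1,3)])
  show "AE t in rplus. Dext a p (stieltjes b m f) t = stieltjes b m (Dext a p f) t"
    using Dext_Dplus_inv(2)[OF S] AE_rplus_pos
  proof eventually_elim
    case (elim t)
    have "kernel_op (stieltjes_kernel b m) (Dext a p f) t = kernel_op (stieltjes_kernel b m) h t"
      by (rule S.kernel_op_cong_AE[OF Dext_Dplus_inv(2)[OF h(2,1,3)] elim(2)]) (use Lp_measurable[OF D] Lp_measurable[OF h(2)] in auto)
    then show ?case using elim(1) by (simp add: stieltjes_kernel_op)
  qed
qed

end

section \<open>Transport of the four assertions to the completed spaces\<close>

theorem theorem7:
  fixes \<alpha> p p' \<beta> \<mu> :: real
  assumes "\<alpha> \<ge> 0" and "1 < p" and "1 / p + 1 / p' = 1"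
    and "0 < \<beta> - 1 / p" and "\<beta> - 1 / p < \<mu>"
  shows "(\<forall>f\<in>Tspace \<alpha> p. stieltjes \<beta> \<mu> f \<in> Tspace \<alpha> p) \<and>
    (\<forall>g\<in>Tspace \<alpha> p'. stieltjes (\<mu> - \<beta> + 1) \<mu> g \<in> Tspace \<alpha> p') \<and>
    (\<forall>f\<in>Tspace \<alpha> p. \<forall>g\<in>Tspace \<alpha> p'.
       pairing \<alpha> p p' (stieltjes \<beta> \<mu> f) g =
       pairing \<alpha> p p' f (stieltjes (\<mu> - \<beta> + 1) \<mu> g)) \<and>
    (\<forall>f\<in>Tspace \<alpha> p. \<forall>g\<in>Tspace \<alpha> p.
       (AE t in rplus. stieltjes \<beta> \<mu> f t = stieltjes \<beta> \<mu> g t) \<longrightarrow> (AE t in rplus. f t = g t)) \<and>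
    (\<exists>g\<in>Tspace \<alpha> p. \<forall>f\<in>Tspace \<alpha> p. \<not> (AE t in rplus. stieltjes \<beta> \<mu> f t = g t)) \<and>
    (\<forall>g\<in>Tspace \<alpha> p. \<forall>\<epsilon>>0. \<exists>f\<in>Tspace \<alpha> p.
       Tnorm \<alpha> p (\<lambda>t. stieltjes \<beta> \<mu> f t - g t) < \<epsilon>)"
proof -
  note a = assms(1) and p = assms(2) and q = assms(3) and b = assms(4,5)
  note qq = conj_exponent[OF p q]
  \<comment> \<open>The transposed parameter satisfies the same inequalities for p', as its
    difference with 1/p' is \<mu> - (\<beta> - 1/p).\<close>
  have b': "0 < (\<mu> - \<beta> + 1) - 1 / p'" "(\<mu> - \<beta> + 1) - 1 / p' < \<mu>" using b qq by auto
  interpret S: hom_kernel p "stieltjes_kernel \<beta> \<mu>" by (rule hom_kernel_stieltjes[OF p b])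
  interpret S': hom_kernel p' "stieltjes_kernel (\<mu> - \<beta> + 1) \<mu>" by (rule hom_kernel_stieltjes[OF qq(1) b'])
  note T = stieltjes_Tspace[OF a p b] and T' = stieltjes_Tspace[OF a qq(1) b']
  show ?thesis
  proof (intro conjI ballI allI impI)
    show "stieltjes \<beta> \<mu> f \<in> Tspace \<alpha> p" if "f \<in> Tspace \<alpha> p" for f by (rule T(1)[OF that])
    show "stieltjes (\<mu> - \<beta> + 1) \<mu> g \<in> Tspace \<alpha> p'" if "g \<in> Tspace \<alpha> p'" for g by (rule T'(1)[OF that])
  next
    fix f g assume f: "f \<in> Tspace \<alpha> p" and g: "g \<in> Tspace \<alpha> p'"
    define h where "h = Dext \<alpha> p f"
    define k where "k = Dext \<alpha> p' g"
    have h: "h \<in> Lp p" and k: "k \<in> Lp p'" unfolding h_def k_def by (rule T(3)[OF f], rule T'(3)[OF g])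
    note [measurable] = Lp_measurable[OF h] Lp_measurable[OF k] Lp_measurable[OF S.kernel_op_Lp[OF h]]
      Lp_measurable[OF S'.kernel_op_Lp[OF k]] Lp_measurable[OF T(3)[OF T(1)[OF f]]] Lp_measurable[OF T'(3)[OF T'(1)[OF g]]]
    have "pairing \<alpha> p p' (stieltjes \<beta> \<mu> f) g = (LINT t|rplus. kernel_op (stieltjes_kernel \<beta> \<mu>) h t * k t)"
      unfolding pairing_def k_def[symmetric]
    proof (rule integral_cong_AE)
      show "AE t in rplus. Dext \<alpha> p (stieltjes \<beta> \<mu> f) t * k t = kernel_op (stieltjes_kernel \<beta> \<mu>) h t * k t"
        using T(2)[OF f] by eventually_elim (simp add: h_def stieltjes_kernel_op)
    qed measurable
    also have "\<dots> = (LINT t|rplus. h t * kernel_op (stieltjes_kernel (\<mu> - \<beta> + 1) \<mu>) k t)"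
      unfolding S.kernel_op_adjoint[OF h k q] stieltjes_kernel_transpose ..
    also have "\<dots> = pairing \<alpha> p p' f (stieltjes (\<mu> - \<beta> + 1) \<mu> g)"
      unfolding pairing_def h_def[symmetric]
    proof (rule integral_cong_AE)
      show "AE t in rplus. h t * kernel_op (stieltjes_kernel (\<mu> - \<beta> + 1) \<mu>) k t = h t * Dext \<alpha> p' (stieltjes (\<mu> - \<beta> + 1) \<mu> g) t"
        using T'(2)[OF g] by eventually_elim (simp add: k_def stieltjes_kernel_op)
    qed measurable
    finally show "pairing \<alpha> p p' (stieltjes \<beta> \<mu> f) g = pairing \<alpha> p p' f (stieltjes (\<mu> - \<beta> + 1) \<mu> g)" .
  next
    fix f g assume f: "f \<in> Tspace \<alpha> p" and g: "g \<in> Tspace \<alpha> p"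
      and e: "AE t in rplus. stieltjes \<beta> \<mu> f t = stieltjes \<beta> \<mu> g t"
    have fg: "f \<in> Lp p" "g \<in> Lp p" using f g Tspace_iff[OF a p] by auto
    \<comment> \<open>Injectivity needs no transport: the completed space consists of functions in
      \<open>Lp p\<close>, where the operator is already injective.\<close>
    have "AE t in rplus. f t - g t = 0"
    proof (rule stieltjes_injective[OF p q b])
      show "(\<lambda>t. f t - g t) \<in> Lp p" using p by (intro Lp_diff fg) auto
      show "AE t in rplus. stieltjes \<beta> \<mu> (\<lambda>t. f t - g t) t = 0"
        using e S.kernel_op_diff_AE[OF fg] unfolding stieltjes_kernel_op by eventually_elim simp
    qed
    then show "AE t in rplus. f t = g t" by simp
  next
    \<comment> \<open>The function outside the range is \<open>Dplus_inv\<close> of this indicator.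
      A preimage \<open>Dplus_inv\<close> of h would, by commutation and injectivity of
      \<open>Dplus_inv\<close>, give i = S h almost everywhere for the Stieltjes operator S, against
      continuity at 1.\<close>
    define i where "i = (\<lambda>t::real. complex_of_real (indicator {1..2} t * 1))"
    have i: "i \<in> Lp p" unfolding i_def using p by (intro Lp_indicator_cbox) auto
    show "\<exists>g\<in>Tspace \<alpha> p. \<forall>f\<in>Tspace \<alpha> p. \<not> (AE t in rplus. stieltjes \<beta> \<mu> f t = g t)"
    proof (intro bexI ballI notI)
      show "Dplus_inv \<alpha> i \<in> Tspace \<alpha> p" using Tspace_iff[OF a p] Dplus_inv_Lp[OF a p i] i by auto
      fix f assume f: "f \<in> Tspace \<alpha> p" and e: "AE t in rplus. stieltjes \<beta> \<mu> f t = Dplus_inv \<alpha> i t"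
      obtain h where h: "f \<in> Lp p" "h \<in> Lp p" "AE t in rplus. f t = Dplus_inv \<alpha> h t" using f Tspace_iff[OF a p] by blast
      note Sh = stieltjes_Dplus_inv[OF a p b h(2,1,3)]
      have "AE t in rplus. Dplus_inv \<alpha> (stieltjes \<beta> \<mu> h) t = Dplus_inv \<alpha> i t" using e Sh(3) by eventually_elim simp
      then have "AE t in rplus. stieltjes \<beta> \<mu> h t = i t" by (rule Dplus_inv_inj[OF a p Sh(1) i])
      then have "AE t in rplus. stieltjes \<beta> \<mu> h t = indicator {1..2} t"
        by eventually_elim (simp add: i_def indicator_def)
      then show False using stieltjes_not_indicator[OF p b h(2)] by blast
    qed
  next
    fix g \<epsilon> assume g: "g \<in> Tspace \<alpha> p" and \<epsilon>: "(\<epsilon>::real) > 0"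
    obtain k where k: "g \<in> Lp p" "k \<in> Lp p" "AE t in rplus. g t = Dplus_inv \<alpha> k t" using g Tspace_iff[OF a p] by blast
    \<comment> \<open>The tolerance for the modular that corresponds to \<epsilon> for the
      norm.\<close>
    have "\<epsilon> powr p > 0" using \<epsilon> by simp
    then obtain h where h: "h \<in> Lp p" "Lp_modular p (\<lambda>t. k t - stieltjes \<beta> \<mu> h t) < \<epsilon> powr p"
      using stieltjes_dense[OF p b k(2)] by blast
    define f where "f = Dplus_inv \<alpha> h"
    have f: "f \<in> Lp p" "AE t in rplus. f t = Dplus_inv \<alpha> h t" unfolding f_def using Dplus_inv_Lp[OF a p h(1)] by auto
    note Sh = stieltjes_Dplus_inv[OF a p b h(1) f]
    define d where "d t = stieltjes \<beta> \<mu> h t - k t" for t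
    have d: "d \<in> Lp p" unfolding d_def using p by (intro Lp_diff Sh k) auto
    have sg: "(\<lambda>t. stieltjes \<beta> \<mu> f t - g t) \<in> Lp p" using p by (intro Lp_diff Sh k) auto
    have "AE t in rplus. stieltjes \<beta> \<mu> f t - g t = Dplus_inv \<alpha> d t"
      \<comment> \<open>The error is \<open>Dplus_inv\<close> of the error d on the side of
        \<open>Lp p\<close>, so its norm in the completion equals the norm of d.\<close>
      using Sh(3) k(3) Dplus_inv_diff[OF a p Sh(1) k(2)] unfolding d_def by eventually_elim simp
    note D = Dext_Dplus_inv[OF a p d sg this]
    have "Lp_modular p (Dext \<alpha> p (\<lambda>t. stieltjes \<beta> \<mu> f t - g t)) = Lp_modular p d"
      by (intro Lp_modular_cong_AE Lp_measurable[OF d] Lp_measurable[OF D(1)] D(2))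
    also have "\<dots> < \<epsilon> powr p" using h(2) unfolding d_def by (subst Lp_modular_minus_commute)
    finally have "Tnorm \<alpha> p (\<lambda>t. stieltjes \<beta> \<mu> f t - g t) < \<epsilon>"
      unfolding Tnorm_def using p \<epsilon> by (subst Lp_norm_less_iff) auto
    moreover have "f \<in> Tspace \<alpha> p" using f h(1) Tspace_iff[OF a p] by blast
    ultimately show "\<exists>f\<in>Tspace \<alpha> p. Tnorm \<alpha> p (\<lambda>t. stieltjes \<beta> \<mu> f t - g t) < \<epsilon>" by blast
  qed
qed

end
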